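(* Let $p>1$. For every $\varepsilon>0$ there exist $\delta>0$ and $n_0$ such that for all $n\geq n_0$: every $\mathcal{M}$-free $3$-graph $H$ on $n$ vertices with $\lambda^{(p)}(H)>(1-\delta)\cdot\frac49 n^{3(1-1/p)}$ can be transformed into a $3$-graph that is either semibipartite or $G_6^2$-colorable by removing at most $\varepsilon n$ vertices.
   Context: For a $3$-graph $H$ on $[n]$ and real $p\geq1$, $\lambda^{(p)}(H)=\max_{\bm{x}\in\mathbb{R}^n,\ \|\bm{x}\|_p=1}6\sum_{\{i,j,k\}\in E(H)}x_ix_jx_k$. A $3$-graph is semibipartite if there is a partition $V=A\cup B$ with $|e\cap A|=1$, $|e\cap B|=2$ for all edges $e$. $G_n^1$ is the edge-maximal semibipartite $3$-graph on $n$ vertices with $|A|=\lfloor n/3\rfloor$, $|B|=\lceil 2n/3\rceil$. $G_6^2$ is the $3$-graph on $[6]$ whose edge set is all triples except $123,126,345,456$. For a $3$-graph $F$ on $[m]$ and positive integers $k_1,\dots,k_m$, the blow-up $F(k_1,\dots,k_m)$ replaces each vertex $v$ by a set $U_v$ of size $k_v$ and each edge $\{v_1,v_2,v_3\}$ by the complete $3$-partite $3$-graph with classes $U_{v_1},U_{v_2},U_{v_3}$; $G_n^2$ is an $n$-vertex blow-up of $G_6^2$ with the maximum number of edges. A $3$-graph is $G_6^2$-colorable if it is a subgraph of a blow-up of $G_6^2$. For $t\geq4$, $\mathcal{K}_t^{(3)}$ is the family of all $3$-graphs $F$ with at most $\binom t2$ edges such that for some $t$-set $C\subseteq V(F)$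 (a core) every pair in $C$ is contained in an edge of $F$. The transversal number is the minimum size of a vertex set meeting all edges. $\mathcal{M}=M_1\cup M_2\cup M_3$: $M_1$ consists of the complete $3$-graph on five vertices with one edge removed; $M_2$ is the set of all $3$-graphs in $\mathcal{K}_7^{(3)}$ having a core whose induced subgraph has transversal number at least two; $M_3$ is the set of all $F\in\mathcal{K}_6^{(3)}$ with $F\not\subseteq G_n^1$ and $F\not\subseteq G_n^2$ for all positive integers $n$. $H$ is $\mathcal{M}$-free if it contains no member of $\mathcal{M}$ as a subgraph. *)

theory Defs
  imports Complex_Main
begin

record 'a hypergraph =
  verts :: "'a set"
  edges :: "'a set set"

definition three_graph :: "'a hypergraph \<Rightarrow> bool" where
  "three_graph H \<longleftrightarrow> finite (verts H) \<and> (\<forall>e\<in>edges H. e \<subseteq> verts H \<and> card e = 3)"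

text \<open>Containment as a subgraph is up to isomorphism, and need not be induced.\<close>

definition embeds :: "'a hypergraph \<Rightarrow> 'b hypergraph \<Rightarrow> bool" where
  "embeds F H \<longleftrightarrow>
     (\<exists>f. inj_on f (verts F) \<and> f ` verts F \<subseteq> verts H \<and> (\<forall>e\<in>edges F. f ` e \<in> edges H))"

definition induced :: "'a hypergraph \<Rightarrow> 'a set \<Rightarrow> 'a hypergraph" where
  "induced H S = \<lparr>verts = verts H \<inter> S, edges = {e \<in> edges H. e \<subseteq> S}\<rparr>"

definition remove_verts :: "'a hypergraph \<Rightarrow> 'a set \<Rightarrow> 'a hypergraph" where
  "remove_verts H S = induced H (verts H - S)"

definition transversal_number :: "'a hypergraph \<Rightarrow> nat" where
  "transversal_number H =
     (LEAST k. \<exists>S. S \<subseteq> verts H \<and> card S = k \<and> (\<forall>e\<in>edges H. S \<inter> e \<noteq> {}))"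

definition lp_norm :: "'a set \<Rightarrow> real \<Rightarrow> ('a \<Rightarrow> real) \<Rightarrow> real" where
  "lp_norm V p x = (\<Sum>i\<in>V. \<bar>x i\<bar> powr p) powr (1 / p)"

text \<open>A vector indexed by the vertices is a function of which only the values on
  \<^term>\<open>verts H\<close> matter.  For a finite nonempty vertex set and \<open>p \<ge> 1\<close> the supremum
  ranges over the continuous image of a nonempty compact set, so it is a maximum.\<close>

definition p_spectral_radius :: "real \<Rightarrow> 'a hypergraph \<Rightarrow> real" where
  "p_spectral_radius p H =
     Sup {6 * (\<Sum>e\<in>edges H. \<Prod>i\<in>e. x i) | x. lp_norm (verts H) p x = 1}"

definition semibipartite :: "'a hypergraph \<Rightarrow> bool" where
  "semibipartite H \<longleftrightarrow>
     (\<exists>A B. A \<union> B = verts H \<and> A \<inter> B = {} \<and>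
        (\<forall>e\<in>edges H. card (e \<inter> A) = 1 \<and> card (e \<inter> B) = 2))"

text \<open>The edge-maximal semibipartite 3-graph with (disjoint) parts \<open>A\<close>, \<open>B\<close>.\<close>

definition complete_semibipartite :: "'a set \<Rightarrow> 'a set \<Rightarrow> 'a hypergraph" where
  "complete_semibipartite A B =
     \<lparr>verts = A \<union> B, edges = {e. e \<subseteq> A \<union> B \<and> card (e \<inter> A) = 1 \<and> card (e \<inter> B) = 2}\<rparr>"

text \<open>The second part has \<open>n - \<lfloor>n/3\<rfloor> = \<lceil>2n/3\<rceil>\<close> elements.\<close>

definition G1 :: "nat \<Rightarrow> nat hypergraph" where
  "G1 n = complete_semibipartite {1..n div 3} {n div 3 + 1..n}"

definition G62 :: "nat hypergraph" where
  "G62 = \<lparr>verts = {1..6},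
          edges = {e. e \<subseteq> {1..6} \<and> card e = 3} - {{1,2,3}, {1,2,6}, {3,4,5}, {4,5,6}}\<rparr>"

text \<open>The class replacing the vertex \<open>v\<close> is \<open>{v} \<times> {1..k v}\<close>.\<close>

definition blowup :: "'a hypergraph \<Rightarrow> ('a \<Rightarrow> nat) \<Rightarrow> ('a \<times> nat) hypergraph" where
  "blowup F k =
     \<lparr>verts = (SIGMA v:verts F. {1..k v}),
      edges = {e. e \<subseteq> (SIGMA v:verts F. {1..k v}) \<and> inj_on fst e \<and> fst ` e \<in> edges F}\<rparr>"

definition is_blowup :: "'a hypergraph \<Rightarrow> ('a \<times> nat) hypergraph \<Rightarrow> bool" where
  "is_blowup F G \<longleftrightarrow> (\<exists>k. (\<forall>v\<in>verts F. 0 < k v) \<and> G = blowup F k)"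

definition colorable :: "'b hypergraph \<Rightarrow> 'a hypergraph \<Rightarrow> bool" where
  "colorable F H \<longleftrightarrow> (\<exists>G. is_blowup F G \<and> embeds H G)"

text \<open>A predicate, since an edge-maximum blow-up need not be unique, and none exists
  for \<open>n < 6\<close>.\<close>

definition is_G2 :: "nat \<Rightarrow> (nat \<times> nat) hypergraph \<Rightarrow> bool" where
  "is_G2 n G \<longleftrightarrow> is_blowup G62 G \<and> card (verts G) = n \<and>
     (\<forall>G'. is_blowup G62 G' \<and> card (verts G') = n \<longrightarrow> card (edges G') \<le> card (edges G))"

definition is_core :: "nat \<Rightarrow> 'a hypergraph \<Rightarrow> 'a set \<Rightarrow> bool" where
  "is_core t F C \<longleftrightarrow> C \<subseteq> verts F \<and> card C = t \<and>
     (\<forall>u\<in>C. \<forall>v\<in>C. u \<noteq> v \<longrightarrow> (\<exists>e\<in>edges F. {u, v} \<subseteq> e))"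

text \<open>The forbidden 3-graphs are finite, so up to isomorphism they live on \<^typ>\<open>nat\<close>.\<close>

definition K_family :: "nat \<Rightarrow> nat hypergraph set" where
  "K_family t = {F. three_graph F \<and> card (edges F) \<le> t choose 2 \<and> (\<exists>C. is_core t F C)}"

definition M1 :: "nat hypergraph set" where
  "M1 = {\<lparr>verts = {1..5}, edges = {e. e \<subseteq> {1..5} \<and> card e = 3} - {{1,2,3}}\<rparr>}"

definition M2 :: "nat hypergraph set" where
  "M2 = {F \<in> K_family 7. \<exists>C. is_core 7 F C \<and> 2 \<le> transversal_number (induced F C)}"

definition M3 :: "nat hypergraph set" where
  "M3 = {F \<in> K_family 6.
           \<forall>n>0. \<not> embeds F (G1 n) \<and> (\<forall>G. is_G2 n G \<longrightarrow> \<not> embeds F G)}"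

definition M_free :: "'a hypergraph \<Rightarrow> bool" where
  "M_free H \<longleftrightarrow> (\<forall>F \<in> M1 \<union> M2 \<union> M3. \<not> embeds F H)"

end

theory Submission
  imports Defs "HOL-Analysis.Analysis"
begin

text \<open>Give the vertices nonnegative weights of total 1. The forbidden 3-graphs have pairwise adjacent cores,
  so being M-free passes to blow-ups and everything can be phrased for weights on a fixed
  3-graph. Moving weight between two nonadjacent vertices of the support does not decrease the
  Lagrange polynomial in one of the two directions, and a support whose pairs are all covered is
  semibipartite or \<open>G62\<close>-colourable; hence the polynomial is at most \<open>4 / 9\<close>.

  For weights close to this maximum, let \<open>Z\<close> be the set of vertices of small degree; it has small
  weight. The 3-graph outside \<open>Z\<close> is coloured: this holds at the end of the symmetrization, and
  is carried backwards through small transfers of weight, since the coloured part loses only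
  little weight and a vertex of almost maximal degree can always be added to a colouring of
  almost full weight, as otherwise generic vertices would exhibit a forbidden core.

  A vector that almost attains the claimed p-spectral radius yields such weights, and by the power
  mean inequality on the complement of \<open>Z\<close>, where \<open>p > 1\<close> enters, \<open>Z\<close> has few vertices.\<close>

section \<open>Colour patterns and auxiliary inequalities\<close>

text \<open>Both patterns have maximum 4 / 9 because the \<open>G62\<close> polynomial, once
  nonnegative penalties are dropped, is the semibipartite cubic \<open>3 * a * b^2\<close>. The
  forbidden families enter at three points only: \<open>two_missing_triples\<close>
  (\<open>M1\<close>), \<open>core7_common_vertex\<close> (\<open>M2\<close>) and
  \<open>core6_structure\<close> (\<open>M3\<close>).

  The obstacle in going backwards is that one symmetrization step may move a large weight, so a
  colouring for the weights after it says little about those before. Along a step the polynomial is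
  linear and does not decrease, so all intermediate weights are as close to extremal as the initial
  ones; the step is therefore cut into 10^43 equal parts. Each part recolours all vertices outside
  the low-degree set of its own weights, so errors do not accumulate and no constant depends on the
  number of vertices or steps.

  Chain of constants: deficiency 10^-86 and degree threshold 10^-42 bound the low-degree weight by
  10^-44; a transfer of at most 10^-43 keeps the lost weight below 10^-42; degrees into the coloured
  part then fall short of 4 / 9 by at most 10^-41.\<close>

lemma one_to_six: "{1..6} = {1, 2, 3, 4, 5, 6::nat}"
  by auto

lemma transversal_number_ge_2:
  assumes "finite (verts G)" "{} \<notin> edges G" "\<And>e. e \<in> edges G \<Longrightarrow> e \<subseteq> verts G"
    and ne: "edges G \<noteq> {}" and "\<And>a. a \<in> verts G \<Longrightarrow> \<exists>e\<in>edges G. a \<notin> e"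
  shows "2 \<le> transversal_number G"
proof -
  let ?P = "\<lambda>k. \<exists>S. S \<subseteq> verts G \<and> card S = k \<and> (\<forall>e\<in>edges G. S \<inter> e \<noteq> {})"
  have "?P (card (verts G))" using assms(2,3)
    by (intro exI[of _ "verts G"]) (metis inf.absorb_iff2 order_refl)
  then have "?P (transversal_number G)" unfolding transversal_number_def by (rule LeastI)
  then obtain S where S: "S \<subseteq> verts G" "card S = transversal_number G" "\<forall>e\<in>edges G. S \<inter> e \<noteq> {}"
    by blast
  have fS: "finite S" using S(1) assms(1) finite_subset by blast
  have "card S \<noteq> 0" using fS S(3) ne by auto
  moreover have "card S \<noteq> 1"
  proof
    assume "card S = 1"
    then obtain a where "S = {a}" by (auto simp: card_1_singleton_iff)
    then show False using S(1,3) assms(5)[of a] by auto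
  qed
  ultimately show ?thesis using S(2) by linarith
qed

text \<open>Some point has degree at least 5, and its link graph has at least 5 edges, hence at least 4 vertices.\<close>

lemma triples_cover_pairs:
  assumes C: "finite C" "card C = 6" and T: "T \<subseteq> {K. K \<subseteq> C \<and> card K = 3}" "card T = 9"
  shows "\<exists>Q. Q \<subseteq> {K. K \<subseteq> C \<and> card K = 2} \<and> (\<forall>K\<in>Q. \<exists>e\<in>T. K \<subseteq> e) \<and> 9 \<le> card Q"
proof -
  have finT: "finite T" using T(2) card.infinite by fastforce
  have fe: "finite e" if "e \<in> T" for e using that T(1) C(1) finite_subset by blast
  \<comment> \<open>Incidences are counted in both orders: nine triples give 27, and 27 exceeds 6 *
    4.\<close>
  have "(\<Sum>a\<in>C. card {e \<in> T. a \<in> e}) = (\<Sum>a\<in>C. \<Sum>e\<in>T. if a \<in> e then 1 else 0)"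
    using finT by (simp add: sum.inter_filter[symmetric])
  also have "\<dots> = (\<Sum>e\<in>T. \<Sum>a\<in>C. if a \<in> e then 1 else 0)" by (rule sum.swap)
  also have "\<dots> = (\<Sum>e\<in>T. card {a \<in> C. a \<in> e})"
    using C(1) by (simp add: sum.inter_filter[symmetric])
  also have "\<dots> = (\<Sum>e\<in>T. 3)"
  proof (rule sum.cong)
    fix e assume "e \<in> T"
    then have "{a \<in> C. a \<in> e} = e" "card e = 3" using T(1) by auto
    then show "card {a \<in> C. a \<in> e} = 3" by simp
  qed auto
  finally have tot: "(\<Sum>a\<in>C. card {e \<in> T. a \<in> e}) = 27" using T(2) by simp
  have "\<exists>a\<in>C. 5 \<le> card {e \<in> T. a \<in> e}"
  proof (rule ccontr)
    assume "\<not> ?thesis"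
    then have "(\<Sum>a\<in>C. card {e \<in> T. a \<in> e}) \<le> (\<Sum>a\<in>C. 4)" by (intro sum_mono) force
    then show False using tot C(2) by simp
  qed
  then obtain a where a: "a \<in> C" "5 \<le> card {e \<in> T. a \<in> e}" by blast
  define G where "G = (\<lambda>e. e - {a}) ` {e \<in> T. a \<in> e}"
  have injG: "inj_on (\<lambda>e. e - {a}) {e \<in> T. a \<in> e}" by (rule inj_onI) blast
  have cG: "5 \<le> card G" using a(2) card_image[OF injG] by (simp add: G_def)
  have G2: "K \<subseteq> C - {a} \<and> card K = 2 \<and> insert a K \<in> T" if "K \<in> G" for K
    using that T(1) fe by (auto simp: G_def insert_absorb)
  have GS: "G \<subseteq> {K. K \<subseteq> \<Union>G \<and> card K = 2}" using G2 by blast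
  have finU: "finite (\<Union>G)" by (rule finite_subset[OF _ C(1)]) (use G2 in blast)
  have "card G \<le> card (\<Union>G) choose 2"
    using card_mono[OF _ GS] n_subsets[OF finU] finU by simp
  then have cU: "4 \<le> card (\<Union>G)"
  proof -
    assume *: "card G \<le> card (\<Union>G) choose 2"
    have "card (\<Union>G) choose 2 \<le> 3 choose 2" if "card (\<Union>G) \<le> 3"
      using that by (rule binomial_right_mono)
    then show ?thesis using * cG by (fastforce simp: choose_two)
  qed
  \<comment> \<open>Link pairs avoid \<open>a\<close> and the pairs \<open>{a, x}\<close> contain
    it, so the two kinds are disjoint: at least 5 + 4.\<close>
  define Q where "Q = G \<union> (\<lambda>x. {a, x}) ` \<Union>G"
  have fG: "finite G" using cG card.infinite by fastforce
  have "card Q = card G + card ((\<lambda>x. {a, x}) ` \<Union>G)"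
    unfolding Q_def by (rule card_Un_disjoint) (use fG finU G2 in auto)
  also have "card ((\<lambda>x. {a, x}) ` \<Union>G) = card (\<Union>G)"
    by (rule card_image) (auto simp: inj_on_def doubleton_eq_iff)
  finally have "9 \<le> card Q" using cG cU by linarith
  moreover have "Q \<subseteq> {K. K \<subseteq> C \<and> card K = 2}" 
  proof
    fix K assume "K \<in> Q"
    then show "K \<in> {K. K \<subseteq> C \<and> card K = 2}"
    proof (unfold Q_def, elim UnE imageE UnionE)
      assume "K \<in> G" then show ?thesis using G2[of K] by auto
    next
      fix x X assume "K = {a, x}" "x \<in> X" "X \<in> G"
      then show ?thesis using G2[of X] a by (auto simp: card_insert_if)
    qed
  qed
  moreover have "\<exists>e\<in>T. K \<subseteq> e" if "K \<in> Q" for K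
  proof -
    from that consider "K \<in> G" | x X where "K = {a, x}" "x \<in> X" "X \<in> G"
      unfolding Q_def by (elim UnE imageE UnionE) auto
    then show ?thesis
    proof cases
      case 1 then show ?thesis using G2[of K] by (intro bexI[of _ "insert a K"]) auto
    next
      case 2 then show ?thesis using G2[of X] by (intro bexI[of _ "insert a X"]) auto
    qed
  qed
  ultimately show ?thesis by (intro exI[of _ Q]) simp
qed

text \<open>The two patterns of edge colours: colour 0 is the class of a semibipartite 3-graph that
  meets every edge once, and the colours 1 to 6 are the vertices of \<^const>\<open>G62\<close>.\<close>

definition pat1 :: "nat \<Rightarrow> nat \<Rightarrow> nat \<Rightarrow> bool" where
  "pat1 i j k \<longleftrightarrow> (i, j, k) \<in> {(0, 1, 1), (1, 0, 1), (1, 1, 0)}"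

definition pat2 :: "nat \<Rightarrow> nat \<Rightarrow> nat \<Rightarrow> bool" where
  "pat2 i j k \<longleftrightarrow> {i, j, k} \<in> edges G62"

text \<open>Two complementary pairs, 123 with 456 and 126 with 345; the complement criterion of
  \<open>core6_structure\<close> tests for this shape.\<close>

definition non_G62 :: "nat set set" where
  "non_G62 = {{1,2,3}, {1,2,6}, {3,4,5}, {4,5,6}}"

lemma non_G62_iff: "t \<in> non_G62 \<longleftrightarrow> t = {1,2,3} \<or> t = {1,2,6} \<or> t = {3,4,5} \<or> t = {4,5,6}"
  unfolding non_G62_def by (simp only: insert_iff empty_iff simp_thms)

lemma edges_G62: "edges G62 = {e. e \<subseteq> {1..6} \<and> card e = 3} - non_G62"
  by (simp add: G62_def non_G62_def)

lemma is_coreD: "is_core t F C \<Longrightarrow> x \<in> C \<Longrightarrow> y \<in> C \<Longrightarrow> x \<noteq> y \<Longrightarrow> \<exists>e\<in>edges F. {x, y} \<subseteq> e"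
  by (simp add: is_core_def)

text \<open>Two core vertices share an edge, and an edge meets the part \<open>A\<close> of
  \<open>G1 n\<close> once, so at most one core vertex is sent to \<open>A\<close>. Every edge
  inside the core must contain that vertex.\<close>

lemma embeds_G1_core:
  assumes "embeds F (G1 n)" and core: "is_core t F C" and T: "T \<subseteq> edges F" "\<And>e. e \<in> T \<Longrightarrow> e \<subseteq> C" "T \<noteq> {}"
  shows "\<exists>a\<in>C. \<forall>e\<in>T. a \<in> e"
proof -
  define A where "A = {1..n div 3}"
  define B where "B = {n div 3 + 1..n}"
  obtain f where f: "inj_on f (verts F)" "\<And>e. e \<in> edges F \<Longrightarrow> f ` e \<in> edges (G1 n)"
    using assms(1) unfolding embeds_def by blast
  have e1: "card (f ` e \<inter> A) = 1" if "e \<in> edges F" for e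
    using f(2)[OF that] by (simp add: G1_def complete_semibipartite_def A_def)
  have uni: "x = y" if xy: "x \<in> C" "y \<in> C" "f x \<in> A" "f y \<in> A" for x y
  proof (rule ccontr)
    assume "x \<noteq> y"
    then obtain e where e: "e \<in> edges F" "{x, y} \<subseteq> e" using is_coreD[OF core xy(1,2)] by blast
    have "f x \<in> f ` e \<inter> A" "f y \<in> f ` e \<inter> A" using e that by auto
    then have "f x = f y" using e1[OF e(1)] by (metis card_1_singletonE singletonD)
    then show False using f(1) core that \<open>x \<noteq> y\<close> by (auto simp: is_core_def inj_on_def)
  qed
  have ex: "\<exists>x\<in>e. f x \<in> A" if "e \<in> T" for e
  proof -
    have "f ` e \<inter> A \<noteq> {}" using e1[of e] that T(1) by auto
    then show ?thesis by auto
  qed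
  obtain e0 where "e0 \<in> T" using T(3) by blast
  then obtain a where a: "a \<in> e0" "f a \<in> A" using ex by blast
  have "a \<in> C" using a T(2) \<open>e0 \<in> T\<close> by blast
  moreover have "a \<in> e" if "e \<in> T" for e
    using ex[OF that] uni[of a] a T(2)[OF that] \<open>a \<in> C\<close> by blast
  ultimately show ?thesis by blast
qed

text \<open>An edge of a blow-up meets each class at most once, so adjacent core vertices go to
  different classes; with as many core vertices as classes, the projection to \<open>G\<close> is a
  bijection on the core.\<close>

lemma embeds_blowup_core:
  assumes "embeds F (blowup G k)" and core: "is_core t F C" and t: "t = card (verts G)" "finite (verts G)"
    and G: "\<And>e. e \<in> edges G \<Longrightarrow> e \<subseteq> verts G"
  obtains c where "bij_betw c C (verts G)" "\<And>e. e \<in> edges F \<Longrightarrow> c ` e \<in> edges G"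
proof -
  obtain f where f: "inj_on f (verts F)" "f ` verts F \<subseteq> verts (blowup G k)" 
    "\<And>e. e \<in> edges F \<Longrightarrow> f ` e \<in> edges (blowup G k)"
    using assms(1) unfolding embeds_def by blast
  define c where "c = fst \<circ> f"
  have e: "c ` e \<in> edges G" "inj_on fst (f ` e)" if "e \<in> edges F" for e
    using f(3)[OF that] by (auto simp: blowup_def c_def image_comp)
  have "inj_on c C"
  proof (rule inj_onI, rule ccontr)
    fix x y assume xy: "x \<in> C" "y \<in> C" "c x = c y" "x \<noteq> y"
    then obtain d where d: "d \<in> edges F" "{x, y} \<subseteq> d" using is_coreD[OF core xy(1,2,4)] by blast
    have "f x = f y" using inj_onD[OF e(2)[OF d(1)], of "f x" "f y"] d(2) xy(3) by (simp add: c_def)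
    then show False using f(1) core xy by (auto simp: is_core_def inj_on_def)
  qed
  moreover have sub: "c ` C \<subseteq> verts G"
    using f(2) core by (force simp: c_def is_core_def blowup_def)
  ultimately have "bij_betw c C (verts G)"
    using core t card_image[of c C] card_subset_eq[OF t(2) sub] by (auto simp: bij_betw_def is_core_def)
  then show ?thesis using that e by blast
qed

lemma sum_indicator_diff:
  fixes F :: "'a \<Rightarrow> real"
  assumes "finite A" "u \<in> A" "v \<in> A"
  shows "(\<Sum>x\<in>A. (of_bool (x = v) - of_bool (x = u)) * F x) = F v - F u"
  using assms by (simp add: left_diff_distrib sum_subtractf of_bool_def if_distrib[of "\<lambda>x. x * _"] cong: if_cong)

lemma triple_eq_iff:
  assumes "i \<noteq> j" "i \<noteq> k" "j \<noteq> k"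
  shows "{i, j, k} = {a, b, c} \<longleftrightarrow> (i = a \<and> j = b \<and> k = c) \<or> (i = a \<and> j = c \<and> k = b) \<or>
    (i = b \<and> j = a \<and> k = c) \<or> (i = b \<and> j = c \<and> k = a) \<or> (i = c \<and> j = a \<and> k = b) \<or> (i = c \<and> j = b \<and> k = a)" (is "?L \<longleftrightarrow> ?R")
proof
  assume ?L
  then have "i \<in> {a, b, c}" "j \<in> {a, b, c}" "k \<in> {a, b, c}" by (metis insertCI)+
  then have "i = a \<or> i = b \<or> i = c" "j = a \<or> j = b \<or> j = c" "k = a \<or> k = b \<or> k = c" by simp_all
  then show ?R using assms by metis
next
  assume ?R
  then show ?L by (elim disjE) (simp_all add: insert_commute)
qed

lemma pat2_iff: "pat2 i j k \<longleftrightarrow> {i, j, k} \<subseteq> {1..6} \<and> i \<noteq> j \<and> i \<noteq> k \<and> j \<noteq> k \<and> {i, j, k} \<notin> non_G62"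
proof -
  have "card {i, j, k} = 3 \<longleftrightarrow> i \<noteq> j \<and> i \<noteq> k \<and> j \<noteq> k" by (auto simp: card_insert_if)
  then show ?thesis unfolding pat2_def edges_G62 by blast
qed

text \<open>Lists and equalities of numerals instead of sets, so that \<open>simp\<close> decides
  \<open>pat2\<close> on concrete colours.\<close>

lemma pat2_code: "pat2 i j k \<longleftrightarrow> i \<in> set [1,2,3,4,5,6] \<and> j \<in> set [1,2,3,4,5,6] \<and> k \<in> set [1,2,3,4,5,6] \<and>
   i \<noteq> j \<and> i \<noteq> k \<and> j \<noteq> k \<and>
   \<not> (\<exists>(a,b,c) \<in> set [(1,2,3),(1,2,6),(3,4,5),(4,5,6)]. (i = a \<and> j = b \<and> k = c) \<or> (i = a \<and> j = c \<and> k = b) \<or>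
    (i = b \<and> j = a \<and> k = c) \<or> (i = b \<and> j = c \<and> k = a) \<or> (i = c \<and> j = a \<and> k = b) \<or> (i = c \<and> j = b \<and> k = a))"
proof -
  have "{1..6} = set [1,2,3,4,5,6::nat]" by auto
  then have range: "{i, j, k} \<subseteq> {1..6} \<longleftrightarrow> i \<in> set [1,2,3,4,5,6] \<and> j \<in> set [1,2,3,4,5,6] \<and> k \<in> set [1,2,3,4,5,6]"
    by (simp only: insert_subset empty_subsetI simp_thms)
  show ?thesis
  proof (cases "i \<noteq> j \<and> i \<noteq> k \<and> j \<noteq> k")
    case True
    then have "{i, j, k} \<in> non_G62 \<longleftrightarrow> (\<exists>(a,b,c) \<in> set [(1,2,3),(1,2,6),(3,4,5),(4,5,6)].
      (i = a \<and> j = b \<and> k = c) \<or> (i = a \<and> j = c \<and> k = b) \<or>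
      (i = b \<and> j = a \<and> k = c) \<or> (i = b \<and> j = c \<and> k = a) \<or> (i = c \<and> j = a \<and> k = b) \<or> (i = c \<and> j = b \<and> k = a))"
      unfolding non_G62_iff by (simp add: triple_eq_iff)
    then show ?thesis unfolding pat2_iff by (simp only: range conj_assoc)
  next
    case False
    then show ?thesis unfolding pat2_iff by (intro iffI) (elim conjE, simp only: simp_thms)+
  qed
qed

section \<open>Degrees and Lagrange polynomials of the two patterns\<close>

abbreviation cls :: "nat set \<Rightarrow> (nat \<Rightarrow> nat) \<Rightarrow> nat \<Rightarrow> nat set" where
  "cls X c j \<equiv> {x \<in> X. c x = j}"

text \<open>The degree of a vertex of colour \<open>i\<close> in the complete blow-up of the pattern
  with class weights \<open>W\<close>, counted over ordered pairs.\<close>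

definition pdeg :: "nat set \<Rightarrow> (nat \<Rightarrow> nat \<Rightarrow> nat \<Rightarrow> bool) \<Rightarrow> (nat \<Rightarrow> real) \<Rightarrow> nat \<Rightarrow> real" where
  "pdeg K pat W i = (\<Sum>j\<in>K. \<Sum>k\<in>K. of_bool (pat i j k) * (W j * W k))"

lemma sum_cls:
  assumes "finite X" "finite K" "c ` X \<subseteq> K"
  shows "sum f X = (\<Sum>j\<in>K. sum f (cls X c j))"
  using sum.group[OF assms, of f] by simp

lemma pdeg_pat1:
  "pdeg {0, 1} pat1 W 0 = W 1 * W 1" "pdeg {0, 1} pat1 W 1 = 2 * W 0 * W 1"
  by (simp_all add: pdeg_def pat1_def)

lemma pdeg_pat2:
  "pdeg {1..6} pat2 W 1 = 2 * (W 2 * (W 4 + W 5) + (W 4 + W 5) * (W 3 + W 6) + W 3 * W 6 + W 4 * W 5)"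
  "pdeg {1..6} pat2 W 2 = 2 * (W 1 * (W 4 + W 5) + (W 4 + W 5) * (W 3 + W 6) + W 3 * W 6 + W 4 * W 5)"
  "pdeg {1..6} pat2 W 4 = 2 * (W 5 * (W 1 + W 2) + (W 1 + W 2) * (W 3 + W 6) + W 3 * W 6 + W 1 * W 2)"
  "pdeg {1..6} pat2 W 5 = 2 * (W 4 * (W 1 + W 2) + (W 1 + W 2) * (W 3 + W 6) + W 3 * W 6 + W 1 * W 2)"
  "pdeg {1..6} pat2 W 3 = 2 * (W 6 * (W 1 + W 2 + W 4 + W 5) + (W 1 + W 2) * (W 4 + W 5))"
  "pdeg {1..6} pat2 W 6 = 2 * (W 3 * (W 1 + W 2 + W 4 + W 5) + (W 1 + W 2) * (W 4 + W 5))"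
  unfolding pdeg_def one_to_six by (simp_all add: pat2_code algebra_simps)

text \<open>The value 6 times the Lagrange polynomial of \<^const>\<open>G62\<close>, rearranged so that its maximum and
  the deviation from it can be read off; the vertices pair up as 12, 45, 36.\<close>

definition G62_poly :: "(nat \<Rightarrow> real) \<Rightarrow> real" where
  "G62_poly W = (let p = W 1 + W 2; q = W 4 + W 5; s = W 3 + W 6; r = p + q in
     3 / 2 * (r * (s + r / 2)^2 - (W 3 - W 6)^2 * r - (s + r / 4) * (p - q)^2 - (W 1 - W 2)^2 * q - (W 4 - W 5)^2 * p))"

lemma sum_pdeg_pat2: "(\<Sum>i\<in>{1..6}. W i * pdeg {1..6} pat2 W i) = G62_poly W"
proof -
  have "(\<Sum>i\<in>{1..6}. W i * pdeg {1..6} pat2 W i) = W 1 * pdeg {1..6} pat2 W 1 + W 2 * pdeg {1..6} pat2 W 2 + 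
     W 3 * pdeg {1..6} pat2 W 3 + W 4 * pdeg {1..6} pat2 W 4 + W 5 * pdeg {1..6} pat2 W 5 + W 6 * pdeg {1..6} pat2 W 6"
    by (simp add: one_to_six[unfolded One_nat_def] numeral_eq_Suc sum.atLeast_Suc_atMost)
  also have "\<dots> = G62_poly W" unfolding pdeg_pat2 G62_poly_def Let_def
    by (simp add: field_simps power2_eq_square)
  finally show ?thesis .
qed

text \<open>The semibipartite maximum in homogeneous form. The difference has the double factor
  \<open>2 * a - b\<close>: the optimum splits the weight into one third and two thirds.\<close>

lemma cubic_le:
  fixes a b :: real
  assumes "0 \<le> a" "0 \<le> b"
  shows "3 * a * b^2 \<le> 4 / 9 * (a + b)^3"
proof -
  have "4 / 9 * (a + b)^3 - 3 * a * b^2 = (2 * a - b)^2 * (a + 4 * b) / 9"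
    by (simp add: field_simps power2_eq_square power3_eq_cube)
  also have "\<dots> \<ge> 0" using assms by simp
  finally show ?thesis by simp
qed

text \<open>Without the four nonnegative penalties, \<open>G62_poly\<close> is
  \<open>3 * a * b^2\<close> with \<open>a\<close> half the weight of colours 1, 2, 4, 5 and
  \<open>b\<close> the remaining weight, so \<open>cubic_le\<close> applies again.\<close>

lemma G62_poly_le:
  assumes "\<And>i. 0 \<le> W i"
  shows "G62_poly W \<le> 4 / 9 * (\<Sum>i\<in>{1..6}. W i)^3"
proof -
  let ?r = "(W 1 + W 2 + (W 4 + W 5)) / 2" and ?s = "W 3 + W 6"
  have nn: "0 \<le> W 1" "0 \<le> W 2" "0 \<le> W 3" "0 \<le> W 4" "0 \<le> W 5" "0 \<le> W 6" using assms by auto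
  have "G62_poly W \<le> 3 / 2 * ((W 1 + W 2 + (W 4 + W 5)) * (?s + ?r)^2)"
    unfolding G62_poly_def Let_def
  proof (intro mult_left_mono)
    have "0 \<le> (W 3 - W 6)^2 * (W 1 + W 2 + (W 4 + W 5))" 
      "0 \<le> (?s + (W 1 + W 2 + (W 4 + W 5)) / 4) * (W 1 + W 2 - (W 4 + W 5))^2"
      "0 \<le> (W 1 - W 2)^2 * (W 4 + W 5)" "0 \<le> (W 4 - W 5)^2 * (W 1 + W 2)" using nn by simp_all
    then show "(W 1 + W 2 + (W 4 + W 5)) * (W 3 + W 6 + (W 1 + W 2 + (W 4 + W 5)) / 2)\<^sup>2 -
      (W 3 - W 6)\<^sup>2 * (W 1 + W 2 + (W 4 + W 5)) -
      (W 3 + W 6 + (W 1 + W 2 + (W 4 + W 5)) / 4) * (W 1 + W 2 - (W 4 + W 5))\<^sup>2 -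
      (W 1 - W 2)\<^sup>2 * (W 4 + W 5) - (W 4 - W 5)\<^sup>2 * (W 1 + W 2)
      \<le> (W 1 + W 2 + (W 4 + W 5)) * (?s + ?r)^2" by linarith
  qed simp
  also have "\<dots> = 3 * ?r * (?s + ?r)^2" by simp
  also have "\<dots> \<le> 4 / 9 * (?r + (?s + ?r))^3" by (rule cubic_le) (use nn in auto)
  also have "?r + (?s + ?r) = (\<Sum>i\<in>{1..6}. W i)"
    by (simp add: numeral_eq_Suc sum.atLeast_Suc_atMost field_simps)
  finally show ?thesis .
qed

section \<open>Product measures and the union bound\<close>

lemma sum_PiE_insert:
  assumes "i \<notin> I"
  shows "(\<Sum>g\<in>Pi\<^sub>E (insert i I) P. F g) = (\<Sum>x\<in>P i. \<Sum>g\<in>Pi\<^sub>E I P. F (g(i := x)))"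
proof -
  have "(\<Sum>g\<in>Pi\<^sub>E (insert i I) P. F g) = (\<Sum>p\<in>P i \<times> Pi\<^sub>E I P. F ((\<lambda>(y, g). g(i := y)) p))"
    unfolding PiE_insert_eq by (subst sum.reindex[OF inj_combinator[OF assms]]) simp
  then show ?thesis by (simp add: sum.cartesian_product split_def)
qed

text \<open>Fubini for a product measure on choice functions: an event depending on three
  coordinates is integrated over these, and the other coordinates contribute their total
  masses.\<close>

lemma sum_PiE_three:
  fixes \<nu> :: "'i \<Rightarrow> 'a \<Rightarrow> real"
  assumes I: "finite I" "i \<in> I" "j \<in> I" "k \<in> I" "i \<noteq> j" "i \<noteq> k" "j \<noteq> k"
    and P: "\<And>l. l \<in> I \<Longrightarrow> finite (P l)"
  shows "(\<Sum>g\<in>Pi\<^sub>E I P. (\<Prod>l\<in>I. \<nu> l (g l)) * G (g i) (g j) (g k)) =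
    (\<Sum>x\<in>P i. \<Sum>y\<in>P j. \<Sum>z\<in>P k. \<nu> i x * \<nu> j y * \<nu> k z * G x y z) * (\<Prod>l\<in>I - {i, j, k}. sum (\<nu> l) (P l))"
proof -
  define J where "J = I - {i, j, k}"
  have fJ: "finite J" "i \<notin> J" "j \<notin> J" "k \<notin> J" using I by (auto simp: J_def)
  have Ieq: "I = insert i (insert j (insert k J))" using I by (auto simp: J_def)
  have pr: "(\<Prod>l\<in>insert i (insert j (insert k J)). \<nu> l ((g(k := z, j := y, i := x)) l)) =
     \<nu> i x * \<nu> j y * \<nu> k z * (\<Prod>l\<in>J. \<nu> l (g l))" for g x y z
  proof -
    have "(\<Prod>l\<in>J. \<nu> l ((g(k := z, j := y, i := x)) l)) = (\<Prod>l\<in>J. \<nu> l (g l))"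
      by (rule prod.cong) (use fJ in auto)
    then show ?thesis using fJ I(5-7) by (simp add: mult.assoc)
  qed
  have "(\<Sum>g\<in>Pi\<^sub>E I P. (\<Prod>l\<in>I. \<nu> l (g l)) * G (g i) (g j) (g k)) =
     (\<Sum>x\<in>P i. \<Sum>y\<in>P j. \<Sum>z\<in>P k. \<Sum>g\<in>Pi\<^sub>E J P.
       (\<nu> i x * \<nu> j y * \<nu> k z * (\<Prod>l\<in>J. \<nu> l (g l))) * G x y z)"
    unfolding Ieq using fJ I(5-7)
    by (simp only: sum_PiE_insert insert_iff simp_thms pr) simp
  also have "\<dots> = (\<Sum>x\<in>P i. \<Sum>y\<in>P j. \<Sum>z\<in>P k.
       (\<nu> i x * \<nu> j y * \<nu> k z * G x y z) * (\<Sum>g\<in>Pi\<^sub>E J P. \<Prod>l\<in>J. \<nu> l (g l)))"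
    unfolding sum_distrib_left by (intro sum.cong refl) (simp add: mult_ac)
  also have "(\<Sum>g\<in>Pi\<^sub>E J P. \<Prod>l\<in>J. \<nu> l (g l)) = (\<Prod>l\<in>J. sum (\<nu> l) (P l))"
    by (rule prod_sum_PiE[symmetric]) (use fJ P in \<open>auto simp: J_def\<close>)
  finally show ?thesis by (simp add: sum_distrib_right J_def)
qed

text \<open>First moment argument with the unnormalized product measure. Each requirement fails on
  at most a fraction \<open>\<beta>\<close> of the total mass, so all failures together have less
  than the full mass.\<close>

lemma union_bound_choice:
  fixes \<nu> :: "'i \<Rightarrow> 'a \<Rightarrow> real"
  assumes I: "finite I" and P: "\<And>l. l \<in> I \<Longrightarrow> finite (P l)"
    and nonneg: "\<And>l x. l \<in> I \<Longrightarrow> x \<in> P l \<Longrightarrow> 0 \<le> \<nu> l x" and pos: "\<And>l. l \<in> I \<Longrightarrow> 0 < sum (\<nu> l) (P l)"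
    and T: "finite T" "real (card T) * \<beta> < 1"
    and ijk: "\<And>i j k. (i, j, k) \<in> T \<Longrightarrow> i \<in> I \<and> j \<in> I \<and> k \<in> I \<and> i \<noteq> j \<and> i \<noteq> k \<and> j \<noteq> k"
    and bad: "\<And>i j k. (i, j, k) \<in> T \<Longrightarrow>
      (\<Sum>x\<in>P i. \<Sum>y\<in>P j. \<Sum>z\<in>P k. \<nu> i x * \<nu> j y * \<nu> k z * of_bool (\<not> R x y z)) \<le>
        \<beta> * (sum (\<nu> i) (P i) * sum (\<nu> j) (P j) * sum (\<nu> k) (P k))"
  shows "\<exists>g\<in>Pi\<^sub>E I P. \<forall>(i, j, k)\<in>T. R (g i) (g j) (g k)"
proof (rule ccontr)
  assume no: "\<not> ?thesis"
  define \<mu> where "\<mu> g = (\<Prod>l\<in>I. \<nu> l (g l))" for g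
  define W where "W = (\<Prod>l\<in>I. sum (\<nu> l) (P l))"
  define B :: "'i \<times> 'i \<times> 'i \<Rightarrow> ('i \<Rightarrow> 'a) \<Rightarrow> real" where "B t g = (case t of (i, j, k) \<Rightarrow> (of_bool (\<not> R (g i) (g j) (g k)) :: real))" for t g
  have W0: "0 < W" unfolding W_def by (rule prod_pos) (use pos in auto)
  have \<mu>0: "0 \<le> \<mu> g" if "g \<in> Pi\<^sub>E I P" for g
    unfolding \<mu>_def by (rule prod_nonneg) (use that nonneg in auto)
  have "W = (\<Sum>g\<in>Pi\<^sub>E I P. \<mu> g)" unfolding W_def \<mu>_def by (rule prod_sum_PiE[OF I P])
  also have "\<dots> \<le> (\<Sum>g\<in>Pi\<^sub>E I P. \<mu> g * (\<Sum>t\<in>T. B t g))"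
  proof (rule sum_mono)
    fix g assume g: "g \<in> Pi\<^sub>E I P"
    then obtain i j k where t: "(i, j, k) \<in> T" "\<not> R (g i) (g j) (g k)" using no by blast
    have "B (i, j, k) g \<le> (\<Sum>t\<in>T. B t g)"
      by (rule member_le_sum[OF t(1) _ T(1)]) (auto simp: B_def split: prod.split)
    then have "1 \<le> (\<Sum>t\<in>T. B t g)" using t(2) by (simp add: B_def)
    then show "\<mu> g \<le> \<mu> g * (\<Sum>t\<in>T. B t g)" using \<mu>0[OF g] by (simp add: mult_le_cancel_left1)
  qed
  also have "\<dots> = (\<Sum>t\<in>T. \<Sum>g\<in>Pi\<^sub>E I P. \<mu> g * B t g)"
    unfolding sum_distrib_left by (rule sum.swap)
  also have "\<dots> \<le> (\<Sum>t\<in>T. \<beta> * W)"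
  proof (rule sum_mono)
    fix t assume "t \<in> T"
    then obtain i j k where t: "t = (i, j, k)" "(i, j, k) \<in> T" by (cases t) auto
    note d = ijk[OF t(2)]
    have "(\<Sum>g\<in>Pi\<^sub>E I P. \<mu> g * B t g) =
      (\<Sum>x\<in>P i. \<Sum>y\<in>P j. \<Sum>z\<in>P k. \<nu> i x * \<nu> j y * \<nu> k z * of_bool (\<not> R x y z)) * (\<Prod>l\<in>I - {i, j, k}. sum (\<nu> l) (P l))"
      unfolding \<mu>_def B_def t(1) prod.case by (rule sum_PiE_three[OF I]) (use d P in auto)
    also have "\<dots> \<le> \<beta> * (sum (\<nu> i) (P i) * sum (\<nu> j) (P j) * sum (\<nu> k) (P k)) * (\<Prod>l\<in>I - {i, j, k}. sum (\<nu> l) (P l))"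
      by (intro mult_right_mono bad[OF t(2)] prod_nonneg) (auto intro: less_imp_le pos)
    also have "\<dots> = \<beta> * W"
    proof -
      have "I = insert i (insert j (insert k (I - {i, j, k})))" using d by auto
      then have "W = (\<Prod>l\<in>insert i (insert j (insert k (I - {i, j, k}))). sum (\<nu> l) (P l))"
        by (simp add: W_def)
      then show ?thesis using I d by (simp add: mult_ac)
    qed
    finally show "(\<Sum>g\<in>Pi\<^sub>E I P. \<mu> g * B t g) \<le> \<beta> * W" .
  qed
  also have "\<dots> = (real (card T) * \<beta>) * W" by simp
  also have "\<dots> < 1 * W" using T(2) W0 by (intro mult_strict_right_mono) auto
  finally show False by simp
qed

section \<open>Stability of the extremal class weights\<close>

lemma square_root_bound:
  fixes x s :: real
  assumes "x^2 \<le> s^2" "0 \<le> s"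
  shows "\<bar>x\<bar> \<le> s"
  using assms by (simp add: abs_le_square_iff[symmetric])

text \<open>Replacing one variable by its bound, 1 minus the other, leaves a cubic in one variable
  whose distance to 4 / 9 has a double zero at the optimum and a cofactor at least 1. The deviation
  is thus at most the square root \<open>s\<close> of the deficiency.\<close>

lemma cubic_stable:
  fixes a b s :: real
  assumes "0 \<le> a" "0 \<le> b" "a + b \<le> 1" "4 / 9 - s^2 \<le> 3 * a * b^2" "0 \<le> s"
  shows "\<bar>a - 1 / 3\<bar> \<le> s" "\<bar>b - 2 / 3\<bar> \<le> s"
proof -
  have "3 * a * b^2 \<le> 3 * a * (1 - a)^2"
    using assms(1-3) by (intro mult_left_mono power_mono) auto
  also have "\<dots> = 4 / 9 - 3 * (a - 1 / 3)^2 * (4 / 3 - a)"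
    by (simp add: field_simps power2_eq_square)
  finally have *: "3 * (a - 1 / 3)^2 * (4 / 3 - a) \<le> s^2" using assms(4) by linarith
  have "(a - 1 / 3)^2 * 1 \<le> (a - 1 / 3)^2 * (3 * (4 / 3 - a))"
    using assms(1-3) by (intro mult_left_mono) auto
  moreover have "3 * (a - 1 / 3)^2 * (4 / 3 - a) = (a - 1 / 3)^2 * (3 * (4 / 3 - a))" by (simp only: mult_ac)
  ultimately have "(a - 1 / 3)^2 \<le> s^2" using * by linarith
  then show "\<bar>a - 1 / 3\<bar> \<le> s" by (rule square_root_bound) (rule assms)
  have "3 * a * b^2 \<le> 3 * (1 - b) * b^2"
    using assms(1-3) by (intro mult_right_mono) auto
  also have "\<dots> = 4 / 9 - 3 * (b - 2 / 3)^2 * (1 / 3 + b)"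
    by (simp add: field_simps power2_eq_square)
  finally have *: "3 * (b - 2 / 3)^2 * (1 / 3 + b) \<le> s^2" using assms(4) by linarith
  have "(b - 2 / 3)^2 * 1 \<le> (b - 2 / 3)^2 * (3 * (1 / 3 + b))"
    using assms(1-3) by (intro mult_left_mono) auto
  moreover have "3 * (b - 2 / 3)^2 * (1 / 3 + b) = (b - 2 / 3)^2 * (3 * (1 / 3 + b))" by (simp only: mult_ac)
  ultimately have "(b - 2 / 3)^2 \<le> s^2" using * by linarith
  then show "\<bar>b - 2 / 3\<bar> \<le> s" by (rule square_root_bound) (rule assms)
qed

text \<open>The cubic fixes \<open>r\<close> and \<open>t\<close> up to a multiple of
  \<open>s\<close>, and the penalties total at most \<open>2 / 3 * s^2\<close>. As \<open>s\<close>
  is small, the factors multiplying the squares are at least 1 / 4, so paired weights differ by at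
  most \<open>2 * s\<close>.\<close>

lemma G62_poly_stable:
  assumes W: "\<And>i. 0 \<le> W i" "(\<Sum>i\<in>{1..6}. W i) \<le> 1" and s: "4 / 9 - s^2 \<le> G62_poly W" "0 \<le> s" "s \<le> 1 / 100"
    and i: "i \<in> {1..6}"
  shows "\<bar>W i - 1 / 6\<bar> \<le> 3 * s"
proof -
  define p q t r where "p = W 1 + W 2" and "q = W 4 + W 5" and "t = W 3 + W 6" and "r = p + q"
  have nn: "0 \<le> p" "0 \<le> q" "0 \<le> t" "0 \<le> r" using W(1) by (simp_all add: p_def q_def t_def r_def add_nonneg_nonneg)
  have "(\<Sum>i\<in>{1..6}. W i) = r + t"
    by (simp add: numeral_eq_Suc sum.atLeast_Suc_atMost p_def q_def t_def r_def)
  then have rt: "r + t \<le> 1" using W(2) by simp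
  define A B C D where "A = (W 3 - W 6)^2 * r" and "B = (t + r / 4) * (p - q)^2"
    and "C = (W 1 - W 2)^2 * q" and "D = (W 4 - W 5)^2 * p"
  define M where "M = 3 * (r / 2) * (t + r / 2)^2"
  have G: "G62_poly W = M - 3 / 2 * (A + B + C + D)"
    unfolding M_def G62_poly_def Let_def A_def B_def C_def D_def p_def q_def t_def r_def by (simp add: field_simps)
  have ABCD: "0 \<le> A" "0 \<le> B" "0 \<le> C" "0 \<le> D" using nn by (simp_all add: A_def B_def C_def D_def)
  have "0 \<le> A + B + C + D" using ABCD by simp
  then have "G62_poly W \<le> M" unfolding G by simp
  then have "4 / 9 - s^2 \<le> M" by (rule order_trans[OF s(1)])
  then have lo: "4 / 9 - s^2 \<le> 3 * (r / 2) * (t + r / 2)^2" by (simp only: M_def)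
  have stab: "\<bar>r / 2 - 1 / 3\<bar> \<le> s" "\<bar>t + r / 2 - 2 / 3\<bar> \<le> s"
    using cubic_stable[OF _ _ _ lo s(2)] nn rt by auto
  have "M \<le> 4 / 9 * (r / 2 + (t + r / 2))^3" unfolding M_def by (rule cubic_le) (use nn in auto)
  also have "\<dots> \<le> 4 / 9 * 1^3" using nn rt by (intro mult_left_mono power_mono) auto
  finally have M49: "M \<le> 4 / 9 * 1^3" .
  have sm: "A + B + C + D \<le> 2 / 3 * s^2" 
  proof -
    define u where "u = s^2"
    have "M \<le> 4 / 9" using M49 by simp
    moreover have "4 / 9 - u \<le> M - 3 / 2 * (A + B + C + D)" using s(1) unfolding G u_def .
    ultimately have "3 / 2 * (A + B + C + D) \<le> u" by linarith
    then have "A + B + C + D \<le> 2 / 3 * u" by simp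
    then show ?thesis by (simp only: u_def)
  qed
  have tr: "1 / 3 \<le> t + r / 4" "1 / 3 \<le> r" using stab s(3) by linarith+
  have "(p - q)^2 * (1 / 3) \<le> (p - q)^2 * (t + r / 4)" using tr by (intro mult_left_mono) auto
  then have "(p - q)^2 * (1 / 3) \<le> B" by (simp add: B_def mult.commute)
  then have "(p - q)^2 \<le> 2 * s^2" using sm ABCD by linarith
  moreover have "s^2 \<ge> 0" by simp
  moreover have "(2 * s)^2 = 4 * s^2" by (simp add: power_mult_distrib)
  ultimately have "(p - q)^2 \<le> (2 * s)^2" by linarith
  then have pq: "\<bar>p - q\<bar> \<le> 2 * s" by (rule square_root_bound) (use s in simp)
  have pq3: "1 / 4 \<le> p" "1 / 4 \<le> q"
  proof -
    have r: "2 / 3 - 2 * s \<le> r" using stab(1) by (simp add: abs_le_iff)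
    have "p - q \<le> 2 * s" "q - p \<le> 2 * s" "r = p + q" using pq by (simp_all add: r_def)
    then show "1 / 4 \<le> p" "1 / 4 \<le> q" using r s(3) by linarith+
  qed
  have sq4: "4 * s^2 = (2 * s)^2" by (simp add: power_mult_distrib)
  have "(W 3 - W 6)^2 * (1 / 4) \<le> A" unfolding A_def using tr by (intro mult_left_mono) auto
  then have "(W 3 - W 6)^2 \<le> (2 * s)^2" using sm ABCD sq4 zero_le_power2[of s] by linarith
  then have d36: "\<bar>W 3 - W 6\<bar> \<le> 2 * s" by (rule square_root_bound) (use s in simp)
  have "(W 1 - W 2)^2 * (1 / 4) \<le> C" unfolding C_def using pq3 by (intro mult_left_mono) auto
  then have "(W 1 - W 2)^2 \<le> (2 * s)^2" using sm ABCD sq4 zero_le_power2[of s] by linarith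
  then have d12: "\<bar>W 1 - W 2\<bar> \<le> 2 * s" by (rule square_root_bound) (use s in simp)
  have "(W 4 - W 5)^2 * (1 / 4) \<le> D" unfolding D_def using pq3 by (intro mult_left_mono) auto
  then have "(W 4 - W 5)^2 \<le> (2 * s)^2" using sm ABCD sq4 zero_le_power2[of s] by linarith
  then have d45: "\<bar>W 4 - W 5\<bar> \<le> 2 * s" by (rule square_root_bound) (use s in simp)
  have "\<bar>W 1 - 1 / 6\<bar> \<le> 3 * s" "\<bar>W 2 - 1 / 6\<bar> \<le> 3 * s" "\<bar>W 4 - 1 / 6\<bar> \<le> 3 * s" "\<bar>W 5 - 1 / 6\<bar> \<le> 3 * s"
    "\<bar>W 3 - 1 / 6\<bar> \<le> 3 * s" "\<bar>W 6 - 1 / 6\<bar> \<le> 3 * s"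
    using d12 d36 d45 pq stab s(2) p_def q_def t_def r_def by linarith+
  then show ?thesis using i unfolding one_to_six by auto
qed

section \<open>Finite facts about the edges of \<open>G62\<close>\<close>

lemma pat1_sym: "pat1 i j k \<Longrightarrow> pat1 j i k \<and> pat1 i k j"
  by (auto simp: pat1_def)

lemma pat2_sym: "pat2 i j k \<Longrightarrow> pat2 j i k \<and> pat2 i k j"
  by (simp add: pat2_def insert_commute)

lemma pat2_range: "pat2 i j k \<Longrightarrow> i \<in> {1..6} \<and> j \<in> {1..6} \<and> k \<in> {1..6} \<and> i \<noteq> j \<and> i \<noteq> k \<and> j \<noteq> k"
  by (simp add: pat2_iff)

lemma pdeg_pat2_sixth:
  assumes "i \<in> {1..6}"
  shows "pdeg {1..6} pat2 (\<lambda>_. 1 / 6) i = 4 / 9"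
proof -
  have "i \<in> {1, 2, 3, 4, 5, 6}" using assms unfolding one_to_six .
  then show ?thesis by (elim insertE emptyE) (simp_all only: pdeg_pat2, simp_all)
qed

lemma abs_diff_bounds:
  fixes x a d l u :: real
  assumes "\<bar>x - a\<bar> \<le> d" "l \<le> a - d" "a + d \<le> u"
  shows "l \<le> x" "x \<le> u"
  using assms by linarith+

text \<open>The sixteen edges in all six orders, as rewrite rules for the case checks that
  follow.\<close>

lemma pat2_edges:
  "pat2 1 2 4" "pat2 1 4 2" "pat2 2 1 4" "pat2 2 4 1" "pat2 4 1 2" "pat2 4 2 1"
  "pat2 1 2 5" "pat2 1 5 2" "pat2 2 1 5" "pat2 2 5 1" "pat2 5 1 2" "pat2 5 2 1"
  "pat2 1 3 4" "pat2 1 4 3" "pat2 3 1 4" "pat2 3 4 1" "pat2 4 1 3" "pat2 4 3 1"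
  "pat2 1 3 5" "pat2 1 5 3" "pat2 3 1 5" "pat2 3 5 1" "pat2 5 1 3" "pat2 5 3 1"
  "pat2 1 3 6" "pat2 1 6 3" "pat2 3 1 6" "pat2 3 6 1" "pat2 6 1 3" "pat2 6 3 1"
  "pat2 1 4 5" "pat2 1 5 4" "pat2 4 1 5" "pat2 4 5 1" "pat2 5 1 4" "pat2 5 4 1"
  "pat2 1 4 6" "pat2 1 6 4" "pat2 4 1 6" "pat2 4 6 1" "pat2 6 1 4" "pat2 6 4 1"
  "pat2 1 5 6" "pat2 1 6 5" "pat2 5 1 6" "pat2 5 6 1" "pat2 6 1 5" "pat2 6 5 1"
  "pat2 2 3 4" "pat2 2 4 3" "pat2 3 2 4" "pat2 3 4 2" "pat2 4 2 3" "pat2 4 3 2"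
  "pat2 2 3 5" "pat2 2 5 3" "pat2 3 2 5" "pat2 3 5 2" "pat2 5 2 3" "pat2 5 3 2"
  "pat2 2 3 6" "pat2 2 6 3" "pat2 3 2 6" "pat2 3 6 2" "pat2 6 2 3" "pat2 6 3 2"
  "pat2 2 4 5" "pat2 2 5 4" "pat2 4 2 5" "pat2 4 5 2" "pat2 5 2 4" "pat2 5 4 2"
  "pat2 2 4 6" "pat2 2 6 4" "pat2 4 2 6" "pat2 4 6 2" "pat2 6 2 4" "pat2 6 4 2"
  "pat2 2 5 6" "pat2 2 6 5" "pat2 5 2 6" "pat2 5 6 2" "pat2 6 2 5" "pat2 6 5 2"
  "pat2 3 4 6" "pat2 3 6 4" "pat2 4 3 6" "pat2 4 6 3" "pat2 6 3 4" "pat2 6 4 3"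
  "pat2 3 5 6" "pat2 3 6 5" "pat2 5 3 6" "pat2 5 6 3" "pat2 6 3 5" "pat2 6 5 3"
  by (simp_all add: pat2_code)

text \<open>Two completions, not one: pairs of colours stay covered by pattern edges when a third
  colour has to be avoided, as in \<open>G62_codegree_small\<close>.\<close>

lemma pat2_two_thirds:
  assumes "j \<in> {1..6}" "k \<in> {1..6}" "j \<noteq> k"
  shows "\<exists>l l'. l \<noteq> l' \<and> pat2 j k l \<and> pat2 j k l'"
proof -
  have "\<forall>j\<in>{1,2,3,4,5,6}. \<forall>k\<in>{1,2,3,4,5,6}. j \<noteq> k \<longrightarrow>
     (\<exists>(l, l')\<in>set [(4,5),(2,3),(3,4),(1,3),(1,2)]. pat2 j k l \<and> pat2 j k l')"
    \<comment> \<open>\<open>simp\<close> normalizes 1 to \<open>Suc 0\<close>, hence the facts in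
      both forms.\<close>
    by (simp add: pat2_edges pat2_edges[unfolded One_nat_def])
  moreover have "j \<in> {1,2,3,4,5,6}" "k \<in> {1,2,3,4,5,6}" using assms unfolding one_to_six by simp_all
  ultimately obtain l l' where "(l, l') \<in> set [(4,5),(2,3),(3,4),(1,3),(1,2::nat)]" "pat2 j k l" "pat2 j k l'"
    using assms(3) by blast
  moreover have "l \<noteq> l'" using calculation(1) by auto
  ultimately show ?thesis by blast
qed

text \<open>After removing the colour \<open>i\<close>, the remaining edges still have no common
  vertex; this excludes the star case in \<open>no_core6\<close>.\<close>

lemma pat2_avoid:
  assumes "i \<in> {1..6}" "m \<in> {1..6}"
  shows "\<exists>a b d. pat2 a b d \<and> i \<notin> {a, b, d} \<and> m \<notin> {a, b, d}"
proof -
  have A: "\<forall>i\<in>{1,2,3,4,5,6}. \<forall>m\<in>{1,2,3,4,5,6::nat}. \<exists>(a, b, d)\<in>set [(1,2,4),(3,5,6),(1,2,5),(3,4,6),(1,3,4),(2,5,6),(1,3,5),(2,4,6),(1,3,6),(2,4,5),(1,4,5),(2,3,6),(1,4,6),(2,3,5),(1,5,6),(2,3,4::nat)].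
     i \<noteq> a \<and> i \<noteq> b \<and> i \<noteq> d \<and> m \<noteq> a \<and> m \<noteq> b \<and> m \<noteq> d \<and> pat2 a b d"
    by (simp add: pat2_edges pat2_edges[unfolded One_nat_def])
  have im: "i \<in> {1,2,3,4,5,6}" "m \<in> {1,2,3,4,5,6}" using assms unfolding one_to_six by simp_all
  obtain x where "case x of (a, b, d) \<Rightarrow> i \<noteq> a \<and> i \<noteq> b \<and> i \<noteq> d \<and> m \<noteq> a \<and> m \<noteq> b \<and> m \<noteq> d \<and> pat2 a b d"
    using bspec[OF bspec[OF A im(1)] im(2)] by (elim bexE)
  then show ?thesis by (cases x) auto
qed

text \<open>Triples through 1 represent the ten complementary pairs. The first two pairs are those
  missing from \<open>G62\<close>, the others form \<open>complementary_pairs\<close>.\<close>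

lemma triples_with_1:
  assumes "t \<subseteq> {1..6::nat}" "card t = 3" "1 \<in> t"
  shows "\<exists>b d a' b' d'. (b, d, a', b', d') \<in> set [(2,3,4,5,6),(2,6,3,4,5),(2,4,3,5,6),(2,5,3,4,6),(3,4,2,5,6),(3,5,2,4,6),(3,6,2,4,5),
    (4,5,2,3,6),(4,6,2,3,5),(5,6,2,3,4)] \<and> t = {1, b, d} \<and> {1..6} - t = {a', b', d'}"
proof -
  have "finite t" using assms(2) card.infinite by fastforce
  then have "card (t - {1}) = 2" using assms by simp
  then obtain x y where xy: "t - {1} = {x, y}" "x \<noteq> y" by (auto simp: card_2_iff)
  have "\<exists>b d. t - {1} = {b, d} \<and> b < d" using xy by (metis insert_commute linorder_neqE_nat)
  then obtain b d where bd: "t - {1} = {b, d}" "b < d" by blast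
  have t: "t = {1, b, d}" using bd(1) assms(3) by blast
  have "b \<in> t - {1}" "d \<in> t - {1}" using bd by auto
  then have "2 \<le> b" "d \<le> 6" using assms(1) by force+
  then have "(b = 2 \<and> d = 3) \<or> (b = 2 \<and> d = 6) \<or> (b = 2 \<and> d = 4) \<or> (b = 2 \<and> d = 5) \<or> (b = 3 \<and> d = 4) \<or> (b = 3 \<and> d = 5) \<or> (b = 3 \<and> d = 6) \<or> (b = 4 \<and> d = 5) \<or> (b = 4 \<and> d = 6) \<or> (b = 5 \<and> d = 6)"
    using bd(2) by presburger
  then show ?thesis
  proof (elim disjE conjE)
    assume bd': "b = 2" "d = 3"
    have "t = {1, 2, 3}" using t bd' by simp
    moreover from this have "{1..6} - t = {4, 5, 6}" by auto
    ultimately show ?thesis by (intro exI[of _ 2] exI[of _ 3] exI[of _ 4] exI[of _ 5] exI[of _ 6]) simp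
  next
    assume bd': "b = 2" "d = 6"
    have "t = {1, 2, 6}" using t bd' by simp
    moreover from this have "{1..6} - t = {3, 4, 5}" by auto
    ultimately show ?thesis by (intro exI[of _ 2] exI[of _ 6] exI[of _ 3] exI[of _ 4] exI[of _ 5]) simp
  next
    assume bd': "b = 2" "d = 4"
    have "t = {1, 2, 4}" using t bd' by simp
    moreover from this have "{1..6} - t = {3, 5, 6}" by auto
    ultimately show ?thesis by (intro exI[of _ 2] exI[of _ 4] exI[of _ 3] exI[of _ 5] exI[of _ 6]) simp
  next
    assume bd': "b = 2" "d = 5"
    have "t = {1, 2, 5}" using t bd' by simp
    moreover from this have "{1..6} - t = {3, 4, 6}" by auto
    ultimately show ?thesis by (intro exI[of _ 2] exI[of _ 5] exI[of _ 3] exI[of _ 4] exI[of _ 6]) simp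
  next
    assume bd': "b = 3" "d = 4"
    have "t = {1, 3, 4}" using t bd' by simp
    moreover from this have "{1..6} - t = {2, 5, 6}" by auto
    ultimately show ?thesis by (intro exI[of _ 3] exI[of _ 4] exI[of _ 2] exI[of _ 5] exI[of _ 6]) simp
  next
    assume bd': "b = 3" "d = 5"
    have "t = {1, 3, 5}" using t bd' by simp
    moreover from this have "{1..6} - t = {2, 4, 6}" by auto
    ultimately show ?thesis by (intro exI[of _ 3] exI[of _ 5] exI[of _ 2] exI[of _ 4] exI[of _ 6]) simp
  next
    assume bd': "b = 3" "d = 6"
    have "t = {1, 3, 6}" using t bd' by simp
    moreover from this have "{1..6} - t = {2, 4, 5}" by auto
    ultimately show ?thesis by (intro exI[of _ 3] exI[of _ 6] exI[of _ 2] exI[of _ 4] exI[of _ 5]) simp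
  next
    assume bd': "b = 4" "d = 5"
    have "t = {1, 4, 5}" using t bd' by simp
    moreover from this have "{1..6} - t = {2, 3, 6}" by auto
    ultimately show ?thesis by (intro exI[of _ 4] exI[of _ 5] exI[of _ 2] exI[of _ 3] exI[of _ 6]) simp
  next
    assume bd': "b = 4" "d = 6"
    have "t = {1, 4, 6}" using t bd' by simp
    moreover from this have "{1..6} - t = {2, 3, 5}" by auto
    ultimately show ?thesis by (intro exI[of _ 4] exI[of _ 6] exI[of _ 2] exI[of _ 3] exI[of _ 5]) simp
  next
    assume bd': "b = 5" "d = 6"
    have "t = {1, 5, 6}" using t bd' by simp
    moreover from this have "{1..6} - t = {2, 3, 4}" by auto
    ultimately show ?thesis by (intro exI[of _ 5] exI[of _ 6] exI[of _ 2] exI[of _ 3] exI[of _ 4]) simp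
  qed
qed

text \<open>Prepares \<open>G62_no_extra\<close>, where the vertices with labels in \<open>t\<close>
  are prescribed and only edges with one label in \<open>t\<close> and two in \<open>U\<close> can
  be found. Such edges cover all pairs not inside \<open>t\<close> and have no common
  vertex.\<close>

lemma non_G62_split:
  assumes "t \<in> non_G62"
  defines "U \<equiv> {1..6} - t"
  shows "\<And>a l. a \<in> t \<Longrightarrow> l \<in> U \<Longrightarrow> \<exists>m\<in>U. pat2 a l m"
    and "\<And>l m. l \<in> U \<Longrightarrow> m \<in> U \<Longrightarrow> l \<noteq> m \<Longrightarrow> \<exists>a\<in>t. pat2 a l m"
    and "\<And>m. \<exists>a\<in>t - {m}. \<exists>l\<in>U - {m}. \<exists>l'\<in>U - {m}. pat2 a l l'"
proof -
  have U: "(t = {1,2,3} \<and> U = {4,5,6}) \<or> (t = {1,2,6} \<and> U = {3,4,5}) \<or> (t = {3,4,5} \<and> U = {1,2,6}) \<or> (t = {4,5,6} \<and> U = {1,2,3})"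
  proof -
    have "{1..6} - {1,2,3} = {4,5,6::nat}" "{1..6} - {1,2,6} = {3,4,5::nat}" "{1..6} - {3,4,5} = {1,2,6::nat}"
      "{1..6} - {4,5,6} = {1,2,3::nat}" by auto
    then show ?thesis using assms(1) unfolding non_G62_iff U_def by metis
  qed
  show "\<exists>m\<in>U. pat2 a l m" if "a \<in> t" "l \<in> U" for a l
    using U that by (elim disjE conjE) (auto simp: pat2_edges pat2_edges[unfolded One_nat_def])
  show "\<exists>a\<in>t. pat2 a l m" if "l \<in> U" "m \<in> U" "l \<noteq> m" for l m
    using U that by (elim disjE conjE) (auto simp: pat2_edges pat2_edges[unfolded One_nat_def])
  have "\<exists>a\<in>t. \<exists>(l, l')\<in>set [(4,5),(4,6),(5,6),(3,4),(3,5),(1,2),(1,6),(2,6),(1,3),(2,3)]. l \<in> U \<and> l' \<in> U \<and> a \<noteq> m \<and> l \<noteq> m \<and> l' \<noteq> m \<and> pat2 a l l'"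
    if "m \<in> {1,2,3,4,5,6,0}" for m
    using U that by (elim disjE conjE insertE emptyE) (simp_all add: pat2_edges pat2_edges[unfolded One_nat_def])
  note six = this
  show "\<exists>a\<in>t - {m}. \<exists>l\<in>U - {m}. \<exists>l'\<in>U - {m}. pat2 a l l'" for m
  proof (cases "m \<in> {1,2,3,4,5,6,0}")
    case True then show ?thesis using six[OF True] by blast
  next
    case False
    obtain a l l' where "a \<in> t" "l \<in> U" "l' \<in> U" "pat2 a l l'" using six[of 0] by blast
    moreover have "t \<subseteq> {1,2,3,4,5,6,0}" "U \<subseteq> {1,2,3,4,5,6,0}" using U by auto
    ultimately show ?thesis using False by blast
  qed
qed

text \<open>A tuple \<open>(b, d, a', b', d')\<close> stands for the triple \<open>{1, b, d}\<close>
  and its complement \<open>{a', b', d'}\<close>; exactly the eight pairs consisting of edges of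
  \<open>G62\<close> are listed.\<close>

abbreviation complementary_pairs :: "(nat \<times> nat \<times> nat \<times> nat \<times> nat) set" where
  "complementary_pairs \<equiv> set [(2,4,3,5,6),(2,5,3,4,6),(3,4,2,5,6),(3,5,2,4,6),(3,6,2,4,5),
     (4,5,2,3,6),(4,6,2,3,5),(5,6,2,3,4)]"

lemma complementary_edges:
  assumes "(b, d, a', b', d') \<in> complementary_pairs"
  shows "pat2 1 b d" "pat2 a' b' d'" "{1, b, d} \<inter> {a', b', d'} = {}"
  using assms by (auto simp: pat2_edges pat2_edges[unfolded One_nat_def])

text \<open>The two triples share out the three elements of \<open>t\<close>. Being edges, neither
  is \<open>t\<close> or its complement, so the shares are 1 and 2, and the triple with share 1 is
  the one wanted.\<close>

lemma complementary_edges_split: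
  assumes "(b, d, a', b', d') \<in> complementary_pairs" and "t \<in> non_G62"
  defines "U \<equiv> {1..6} - t"
  shows "(1 \<in> t \<and> b \<in> U \<and> d \<in> U) \<or> (b \<in> t \<and> 1 \<in> U \<and> d \<in> U) \<or> (d \<in> t \<and> 1 \<in> U \<and> b \<in> U) \<or>
    (a' \<in> t \<and> b' \<in> U \<and> d' \<in> U) \<or> (b' \<in> t \<and> a' \<in> U \<and> d' \<in> U) \<or> (d' \<in> t \<and> a' \<in> U \<and> b' \<in> U)"
proof -
  have U: "(t = {1,2,3} \<and> U = {4,5,6}) \<or> (t = {1,2,6} \<and> U = {3,4,5}) \<or> (t = {3,4,5} \<and> U = {1,2,6}) \<or> (t = {4,5,6} \<and> U = {1,2,3})"
  proof -
    have "{1..6} - {1,2,3} = {4,5,6::nat}" "{1..6} - {1,2,6} = {3,4,5::nat}" "{1..6} - {3,4,5} = {1,2,6::nat}"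
      "{1..6} - {4,5,6} = {1,2,3::nat}" by auto
    then show ?thesis using assms(2) unfolding non_G62_iff U_def by metis
  qed
  have "(b = 2 \<and> d = 4 \<and> a' = 3 \<and> b' = 5 \<and> d' = 6) \<or> (b = 2 \<and> d = 5 \<and> a' = 3 \<and> b' = 4 \<and> d' = 6) \<or>
    (b = 3 \<and> d = 4 \<and> a' = 2 \<and> b' = 5 \<and> d' = 6) \<or> (b = 3 \<and> d = 5 \<and> a' = 2 \<and> b' = 4 \<and> d' = 6) \<or>
    (b = 3 \<and> d = 6 \<and> a' = 2 \<and> b' = 4 \<and> d' = 5) \<or> (b = 4 \<and> d = 5 \<and> a' = 2 \<and> b' = 3 \<and> d' = 6) \<or>
    (b = 4 \<and> d = 6 \<and> a' = 2 \<and> b' = 3 \<and> d' = 5) \<or> (b = 5 \<and> d = 6 \<and> a' = 2 \<and> b' = 3 \<and> d' = 4)"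
    using assms(1) by simp
  then show ?thesis using U by (elim disjE conjE) simp_all
qed

lemma sum_two_of_six:
  fixes p q :: real
  assumes "i \<in> {1..6}" "j \<in> {1..6}" "i \<noteq> j"
  shows "(\<Sum>a\<in>{1..6::nat}. if a = i \<or> a = j then p else q) = 2 * p + 4 * q"
proof -
  have "(\<Sum>a\<in>{1..6}. if a = i \<or> a = j then p else q) =
    (\<Sum>a\<in>{1..6} - {i, j}. if a = i \<or> a = j then p else q) + (\<Sum>a\<in>{i, j}. if a = i \<or> a = j then p else q)"
    by (rule sum.subset_diff) (use assms in auto)
  also have "(\<Sum>a\<in>{1..6} - {i, j}. if a = i \<or> a = j then p else q) = (\<Sum>a\<in>{1..6} - {i, j}. q)"
    by (rule sum.cong) auto
  also have "\<dots> = 4 * q" using assms by (simp add: card_Diff_subset)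
  finally show ?thesis using assms(3) by simp
qed

lemma non_pat2_in_non_G62:
  assumes "i \<in> {1..6}" "j \<in> {1..6}" "k \<in> {1..6}" "i \<noteq> j" "i \<noteq> k" "j \<noteq> k" "\<not> pat2 i j k"
  shows "{i, j, k} \<in> non_G62"
  using assms unfolding pat2_iff by simp

text \<open>The power mean inequality, by convexity of \<open>powr\<close> with equal weights
  \<open>1 / k\<close> on the \<open>k\<close> nonzero entries.\<close>

lemma sum_le_card_powr:
  fixes x :: "'a \<Rightarrow> real"
  assumes "finite A" "p > 1" "real (card A) \<le> m" "(\<Sum>i\<in>A. \<bar>x i\<bar> powr p) \<le> 1"
  shows "(\<Sum>i\<in>A. \<bar>x i\<bar>) \<le> m powr (1 - 1 / p)"
proof -
  define B where "B = {i \<in> A. x i \<noteq> 0}"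
  have fB: "finite B" using assms(1) by (simp add: B_def)
  have sB: "(\<Sum>i\<in>A. \<bar>x i\<bar>) = (\<Sum>i\<in>B. \<bar>x i\<bar>)"
    by (rule sum.mono_neutral_right) (use assms(1) in \<open>auto simp: B_def\<close>)
  have pB: "(\<Sum>i\<in>B. \<bar>x i\<bar> powr p) \<le> 1"
    using sum_mono2[of A B "\<lambda>i. \<bar>x i\<bar> powr p"] assms(1,4) by (auto simp: B_def)
  show ?thesis
  proof (cases "B = {}")
    case True then show ?thesis using sB by simp
  next
    case False
    define k where "k = real (card B)"
    have k0: "0 < k" using False fB by (simp add: k_def card_gt_0_iff)
    have km: "k \<le> m" using card_mono[OF assms(1), of B] assms(3) by (auto simp: k_def B_def)
    define S where "S = (\<Sum>i\<in>B. \<bar>x i\<bar>)"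
    have S0: "0 \<le> S" by (simp add: S_def sum_nonneg)
    have "(\<Sum>i\<in>B. (1 / k) *\<^sub>R \<bar>x i\<bar>) powr p \<le> (\<Sum>i\<in>B. 1 / k * (\<bar>x i\<bar> powr p))"
      by (rule convex_on_sum[OF fB False powr_convex[of p], where a = "\<lambda>_. 1 / k"])
        (use assms(2) k0 in \<open>auto simp: k_def B_def\<close>)
    moreover have "(\<Sum>i\<in>B. (1 / k) *\<^sub>R \<bar>x i\<bar>) = S / k" by (simp add: S_def sum_divide_distrib)
    moreover have "(\<Sum>i\<in>B. 1 / k * (\<bar>x i\<bar> powr p)) \<le> 1 / k"
      unfolding sum_distrib_left[symmetric] using pB k0 by (simp add: field_simps)
    ultimately have "(S / k) powr p \<le> 1 / k" by simp
    then have "((S / k) powr p) powr (1 / p) \<le> (1 / k) powr (1 / p)"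
      using assms(2) by (intro powr_mono2) auto
    then have "S / k \<le> (1 / k) powr (1 / p)" using assms(2) S0 k0 by (simp add: powr_powr)
    then have "S \<le> k * (1 / k) powr (1 / p)" using k0 by (simp add: field_simps)
    also have "\<dots> = k powr (1 - 1 / p)" using k0 by (simp add: powr_diff powr_divide)
    also have "\<dots> \<le> m powr (1 - 1 / p)" using k0 km assms(2) by (intro powr_mono2) auto
    finally show ?thesis by (simp add: sB S_def)
  qed
qed

section \<open>Cores in M-free 3-graphs\<close>

locale M_free_graph =
  fixes H :: "nat hypergraph"
  assumes three_graph_H: "three_graph H" and M_free_H: "M_free H"
begin

abbreviation "V \<equiv> verts H"
abbreviation "E \<equiv> edges H"

definition adj :: "nat \<Rightarrow> nat \<Rightarrow> bool" where
  "adj x y \<longleftrightarrow> x \<noteq> y \<and> (\<exists>e\<in>E. {x, y} \<subseteq> e)"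

lemma finite_V [simp]: "finite V"
  using three_graph_H by (simp add: three_graph_def)

lemma edgeD: "e \<in> E \<Longrightarrow> e \<subseteq> V \<and> card e = 3"
  using three_graph_H by (simp add: three_graph_def)

lemma finite_E [simp]: "finite E"
  by (rule finite_subset[of _ "Pow V"]) (use edgeD in auto)

lemma finite_edge: "e \<in> E \<Longrightarrow> finite e"
  using edgeD finite_V finite_subset by blast

lemma embeds_subgraph:
  assumes "verts F = V" "edges F \<subseteq> E"
  shows "embeds F H"
  unfolding embeds_def using assms by (intro exI[of _ id]) auto

text \<open>The edges \<open>T\<close> are kept, and each core pair outside \<open>Q\<close> gets
  one covering edge. Since \<open>T\<close> covers the pairs in \<open>Q\<close> and
  \<open>card T\<close> is at most \<open>card Q\<close>, the bound \<open>t choose 2\<close> on the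
  number of edges survives.\<close>

lemma K_family_subgraph:
  assumes C: "C \<subseteq> V" "card C = t" "\<And>x y. x \<in> C \<Longrightarrow> y \<in> C \<Longrightarrow> x \<noteq> y \<Longrightarrow> adj x y"
    and T: "T \<subseteq> E"
    and Q: "Q \<subseteq> {K. K \<subseteq> C \<and> card K = 2}" "\<And>K. K \<in> Q \<Longrightarrow> \<exists>e\<in>T. K \<subseteq> e"
    and le: "card T \<le> card Q"
  obtains F where "verts F = V" "T \<subseteq> edges F" "edges F \<subseteq> E" "F \<in> K_family t" "is_core t F C"
proof -
  let ?P = "{K. K \<subseteq> C \<and> card K = 2}"
  have finC: "finite C" using C(1) finite_V finite_subset by blast
  have finP: "finite ?P" using finC by simp
  have cardP: "card ?P = t choose 2" using n_subsets[OF finC] C(2) by simp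
  have cov: "\<exists>e\<in>E. K \<subseteq> e" if "K \<in> ?P" for K
  proof -
    from that obtain x y where "K = {x, y}" "x \<noteq> y" by (auto simp: card_2_iff)
    then show ?thesis using that C(3)[of x y] by (auto simp: adj_def)
  qed
  then obtain g where g: "\<And>K. K \<in> ?P \<Longrightarrow> g K \<in> E \<and> K \<subseteq> g K" by metis
  define F where "F = \<lparr>verts = V, edges = T \<union> g ` (?P - Q)\<rparr>"
  have sub: "edges F \<subseteq> E" using T g by (auto simp: F_def)
  have "card (edges F) \<le> card T + card (g ` (?P - Q))" by (simp add: F_def card_Un_le)
  also have "\<dots> \<le> card Q + (card ?P - card Q)"
  proof -
    have "card (g ` (?P - Q)) \<le> card (?P - Q)" by (rule card_image_le) (use finP in auto)
    also have "\<dots> = card ?P - card Q"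
      by (rule card_Diff_subset) (use Q(1) finP finite_subset in auto)
    finally show ?thesis using le by linarith
  qed
  also have "\<dots> = t choose 2" using card_mono[OF finP Q(1)] cardP by simp
  finally have cF: "card (edges F) \<le> t choose 2" .
  have core: "is_core t F C"
    unfolding is_core_def
  proof (intro conjI ballI impI)
    show "C \<subseteq> verts F" "card C = t" using C by (auto simp: F_def)
    fix u v assume uv: "u \<in> C" "v \<in> C" "u \<noteq> v"
    then have "{u, v} \<in> ?P" by auto
    then show "\<exists>e\<in>edges F. {u, v} \<subseteq> e"
      using Q(2)[of "{u,v}"] g[of "{u,v}"] by (cases "{u,v} \<in> Q") (auto simp: F_def)
  qed
  have "three_graph F" using sub edgeD by (auto simp: three_graph_def F_def)
  then have "F \<in> K_family t" using cF core by (auto simp: K_family_def)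
  then show ?thesis using that[of F] sub core by (auto simp: F_def)
qed

text \<open>Otherwise an edge \<open>e\<close> inside the core, together with an edge avoiding each
  of its three vertices, has no transversal of size one. These at most four edges extend to a member
  of \<open>M2\<close>.\<close>

lemma core7_common_vertex:
  assumes C: "C \<subseteq> V" "card C = 7" "\<And>x y. x \<in> C \<Longrightarrow> y \<in> C \<Longrightarrow> x \<noteq> y \<Longrightarrow> adj x y"
  shows "\<exists>a\<in>C. \<forall>e\<in>E. e \<subseteq> C \<longrightarrow> a \<in> e"
proof (rule ccontr)
  assume "\<not> ?thesis"
  then obtain g where g: "\<And>a. a \<in> C \<Longrightarrow> g a \<in> E \<and> g a \<subseteq> C \<and> a \<notin> g a" by metis
  have finC: "finite C" using C(1) finite_V finite_subset by blast
  obtain c where "c \<in> C" using C(2) by (metis card.empty ex_in_conv zero_neq_numeral)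
  define e where "e = g c"
  have e: "e \<in> E" "e \<subseteq> C" using g \<open>c \<in> C\<close> by (auto simp: e_def)
  obtain x y z where xyz: "e = {x, y, z}" "x \<noteq> y" "x \<noteq> z" "y \<noteq> z"
    using edgeD[OF e(1)] by (auto simp: card_3_iff)
  define T where "T = insert e (g ` e)"
  have TE: "T \<subseteq> E" using e g by (auto simp: T_def)
  have TC: "t \<subseteq> C" if "t \<in> T" for t using that e g by (auto simp: T_def)
  have cT: "card T \<le> 4"
    using card_image_le[of e g] edgeD[OF e(1)] finite_edge[OF e(1)]
    by (simp add: T_def card_insert_if)
  have gx: "g x \<in> E" "g x \<subseteq> C" "x \<notin> g x" using g[of x] e xyz by auto
  have "\<not> g x \<subseteq> e"
  proof
    assume "g x \<subseteq> e"
    then have "g x = e" using edgeD[OF gx(1)] edgeD[OF e(1)] finite_edge[OF e(1)]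
      by (metis card_subset_eq)
    then show False using gx(3) xyz by auto
  qed
  then obtain p where p: "p \<in> g x" "p \<notin> e" by auto
  have "card (g x - {p}) = 2" using edgeD[OF gx(1)] p finite_edge[OF gx(1)] by simp
  then obtain q where q: "q \<in> g x" "q \<noteq> p"
    by (metis Diff_iff card.empty ex_in_conv singletonI zero_neq_numeral)
  \<comment> \<open>Three pairs inside \<open>e\<close> and one pair of \<open>g x\<close> leaving
    \<open>e\<close>: four covered pairs pay for the at most four edges of \<open>T\<close>.\<close>
  define Q where "Q = {{x,y},{x,z},{y,z},{p,q}}"
  have cQ: "card Q = 4"
    using xyz p q by (auto simp: Q_def card_insert_if doubleton_eq_iff)
  have Q: "Q \<subseteq> {K. K \<subseteq> C \<and> card K = 2}" using xyz e p q gx by (auto simp: Q_def)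
  have QT: "\<exists>t\<in>T. K \<subseteq> t" if "K \<in> Q" for K
    using that xyz p q by (auto simp: Q_def T_def)
  obtain F where F: "verts F = V" "T \<subseteq> edges F" "edges F \<subseteq> E" "F \<in> K_family 7" "is_core 7 F C"
    using K_family_subgraph[OF C TE Q QT] cT cQ by auto
  have TI: "t \<in> edges (induced F C)" if "t \<in> T" for t
    using that F TC by (auto simp: induced_def)
  have "2 \<le> transversal_number (induced F C)"
  proof (rule transversal_number_ge_2)
    show "finite (verts (induced F C))" using F(1) by (simp add: induced_def)
    show "{} \<notin> edges (induced F C)" using F(3) edgeD by (fastforce simp: induced_def)
    show "f \<subseteq> verts (induced F C)" if "f \<in> edges (induced F C)" for f
      using that F(1,3) edgeD by (auto simp: induced_def)
    show "edges (induced F C) \<noteq> {}" using TI[of e] by (auto simp: T_def)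
    fix a assume "a \<in> verts (induced F C)"
    then have "a \<in> C" by (simp add: induced_def)
    show "\<exists>f\<in>edges (induced F C). a \<notin> f"
    proof (cases "a \<in> e")
      case True
      then have "g a \<in> T" by (simp add: T_def)
      then show ?thesis using TI g[OF \<open>a \<in> C\<close>] by blast
    next
      case False
      then show ?thesis using TI[of e] by (auto simp: T_def)
    qed
  qed
  then have "F \<in> M2" using F by (auto simp: M2_def)
  then show False using M_free_H embeds_subgraph[OF F(1,3)] by (auto simp: M_free_def)
qed

text \<open>The form used below: two disjoint edges in a covered set of seven vertices have no
  common vertex, against \<open>core7_common_vertex\<close>.\<close>

lemma no_core7:
  assumes z: "\<And>i. i \<in> I \<Longrightarrow> z i \<in> V" and I: "card I = 7"
    and adj: "\<And>i j. i \<in> I \<Longrightarrow> j \<in> I \<Longrightarrow> i \<noteq> j \<Longrightarrow> adj (z i) (z j)"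
    and sub: "{a, b, c} \<subseteq> I" "{a', b', c'} \<subseteq> I" "{a, b, c} \<inter> {a', b', c'} = {}"
    and e: "{z a, z b, z c} \<in> E" "{z a', z b', z c'} \<in> E"
  shows False
proof -
  have inj: "inj_on z I" using adj by (auto simp: inj_on_def adj_def)
  have "\<exists>v\<in>z ` I. \<forall>e\<in>E. e \<subseteq> z ` I \<longrightarrow> v \<in> e"
    by (rule core7_common_vertex) (use z I adj card_image[OF inj] in auto)
  then obtain v where v: "\<And>e. e \<in> E \<Longrightarrow> e \<subseteq> z ` I \<Longrightarrow> v \<in> e" by blast
  have "{z a, z b, z c} \<subseteq> z ` I" "{z a', z b', z c'} \<subseteq> z ` I" using sub by auto
  then have "v \<in> {z a, z b, z c}" "v \<in> {z a', z b', z c'}" using v e by blast+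
  then have "v \<in> z ` {a, b, c}" "v \<in> z ` {a', b', c'}" by simp_all
  then obtain i j where ij: "i \<in> {a,b,c}" "j \<in> {a',b',c'}" "z i = z j" by (elim imageE) simp
  then have "i = j" using inj_onD[OF inj ij(3)] sub(1,2) by blast
  then show False using ij sub(3) by blast
qed

text \<open>A 3-graph on six vertices lies in a copy of \<^const>\<open>G62\<close> iff it misses two of the ten
  complementary pairs of triples. If at most one such pair is missed, then nine edges from distinct
  pairs, completed to cover the core, form a member of \<^const>\<open>M3\<close>; nine triples already cover
  nine pairs of vertices, so the bound of 15 edges is respected.\<close>

lemma core6_structure:
  assumes C: "C \<subseteq> V" "card C = 6" "\<And>x y. x \<in> C \<Longrightarrow> y \<in> C \<Longrightarrow> x \<noteq> y \<Longrightarrow> adj x y"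
  shows "(\<exists>a\<in>C. \<forall>e\<in>E. e \<subseteq> C \<longrightarrow> a \<in> e) \<or>
    (\<exists>e1 e2. e1 \<subseteq> C \<and> card e1 = 3 \<and> e2 \<subseteq> C \<and> card e2 = 3 \<and> e2 \<noteq> e1 \<and> e2 \<noteq> C - e1 \<and>
       {e1, C - e1, e2, C - e2} \<inter> E = {})"
proof (rule ccontr)
  assume "\<not> ?thesis"
  then have N1: "\<And>a. a \<in> C \<Longrightarrow> \<exists>e\<in>E. e \<subseteq> C \<and> a \<notin> e"
    and N2: "\<And>e1 e2. e1 \<subseteq> C \<Longrightarrow> card e1 = 3 \<Longrightarrow> e2 \<subseteq> C \<Longrightarrow> card e2 = 3 \<Longrightarrow> e2 \<noteq> e1 \<Longrightarrow>
        e2 \<noteq> C - e1 \<Longrightarrow> {e1, C - e1, e2, C - e2} \<inter> E \<noteq> {}" by blast+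
  have finC: "finite C" using C(1) finite_V finite_subset by blast
  obtain c0 where c0: "c0 \<in> C" using C(2) by (metis card.empty ex_in_conv zero_neq_numeral)
  \<comment> \<open>Triples through \<open>c0\<close> represent the ten complementary pairs of
    triples of \<open>C\<close>.\<close>
  define All where "All = {t. t \<subseteq> C \<and> card t = 3 \<and> c0 \<in> t}"
  have finAll: "finite All" using finC by (simp add: All_def)
  have "All = insert c0 ` {K. K \<subseteq> C - {c0} \<and> card K = 2}"
  proof (intro equalityI subsetI)
    fix t assume t: "t \<in> All"
    then have ft: "finite t" using finC finite_subset by (auto simp: All_def)
    have "t - {c0} \<subseteq> C - {c0}" "card (t - {c0}) = 2" "t = insert c0 (t - {c0})"
      using t ft by (auto simp: All_def)
    then show "t \<in> insert c0 ` {K. K \<subseteq> C - {c0} \<and> card K = 2}" by blast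
  next
    fix t assume "t \<in> insert c0 ` {K. K \<subseteq> C - {c0} \<and> card K = 2}"
    then obtain K where K: "t = insert c0 K" "K \<subseteq> C - {c0}" "card K = 2" by blast
    then have "finite K" "c0 \<notin> K" using finC finite_subset by blast+
    then show "t \<in> All" using K c0 by (auto simp: All_def)
  qed
  moreover have "inj_on (insert c0) {K. K \<subseteq> C - {c0} \<and> card K = 2}" 
    by (rule inj_onI) (metis (no_types, lifting) Diff_insert_absorb mem_Collect_eq subset_Diff_insert)
  ultimately have cAll: "card All = 10"
    using n_subsets[of "C - {c0}" 2] finC C(2) c0 by (simp add: card_image choose_two)
  define Mis where "Mis = {t \<in> All. t \<notin> E \<and> C - t \<notin> E}"
  have finMis: "finite Mis" using finAll by (simp add: Mis_def)
  have "card Mis \<le> 1"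
  proof (rule ccontr)
    assume "\<not> card Mis \<le> 1"
    then obtain t1 t2 where t: "t1 \<in> Mis" "t2 \<in> Mis" "t1 \<noteq> t2"
      by (metis card_le_Suc0_iff_eq finMis One_nat_def)
    then show False using N2[of t1 t2] by (auto simp: Mis_def All_def)
  qed
  then have "9 \<le> card (All - Mis)" using cAll finMis by (simp add: card_Diff_subset Mis_def)
  then obtain Th where Th: "Th \<subseteq> All - Mis" "card Th = 9" by (meson obtain_subset_with_card_n)
  have finTh: "finite Th" using Th(1) finAll finite_subset by blast
  \<comment> \<open>An edge from the pair \<open>t\<close>, \<open>C - t\<close>; outside
    \<open>Mis\<close> there is one.\<close>
  define rep where "rep t = (if t \<in> E then t else C - t)" for t
  define T0 where "T0 = rep ` Th"
  have "inj_on rep Th"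
  proof (rule inj_onI)
    fix s t assume "s \<in> Th" "t \<in> Th" "rep s = rep t"
    moreover have "s \<subseteq> C" "t \<subseteq> C" "c0 \<in> s" "c0 \<in> t" using calculation Th(1) by (auto simp: All_def)
    ultimately show "s = t" using c0 by (auto simp: rep_def split: if_splits)
  qed
  then have cT0: "card T0 = 9" using Th(2) card_image by (force simp: T0_def)
  have T0E: "T0 \<subseteq> E" using Th(1) by (auto simp: T0_def rep_def Mis_def All_def)
  have T0C: "T0 \<subseteq> {K. K \<subseteq> C \<and> card K = 3}"
    using T0E edgeD Th(1) by (auto simp: T0_def rep_def All_def)
  have finT0: "finite T0" using finTh by (simp add: T0_def)
  \<comment> \<open>\<open>T\<close> must have no common vertex, so that \<open>F\<close> cannot
    embed into any \<open>G1 n\<close>; \<open>Q\<close> pays for the edges of \<open>T\<close> in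
    \<open>K_family_subgraph\<close>.\<close>
  have "\<exists>T Q. T0 \<subseteq> T \<and> T \<subseteq> E \<and> T \<subseteq> Pow C \<and> (\<forall>a\<in>C. \<exists>e\<in>T. a \<notin> e) \<and>
     Q \<subseteq> {K. K \<subseteq> C \<and> card K = 2} \<and> (\<forall>K\<in>Q. \<exists>e\<in>T. K \<subseteq> e) \<and> card T \<le> card Q"
  proof (cases "\<forall>a\<in>C. \<exists>e\<in>T0. a \<notin> e")
    case True
    obtain Q where "Q \<subseteq> {K. K \<subseteq> C \<and> card K = 2}" "\<forall>K\<in>Q. \<exists>e\<in>T0. K \<subseteq> e" "9 \<le> card Q"
      using triples_cover_pairs[OF finC C(2) T0C cT0] by blast
    then show ?thesis using True T0E T0C cT0 by (intro exI[of _ T0] exI[of _ Q]) auto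
  next
    case False
    then obtain a where a: "a \<in> C" "\<And>e. e \<in> T0 \<Longrightarrow> a \<in> e" by blast
    obtain g where g: "g \<in> E" "g \<subseteq> C" "a \<notin> g" using N1[OF a(1)] by blast
    obtain e where e: "e \<in> T0" using cT0 by fastforce
    have "card e = 3" using e T0C by blast
    then have "card (e - {a}) = 2" using a(2)[OF e] by (simp add: card.remove)
    then obtain x where x: "x \<in> e" "x \<noteq> a"
      by (metis Diff_iff card.empty ex_in_conv singletonI zero_neq_numeral)
    \<comment> \<open>All nine triples contain \<open>a\<close>, so removing it gives nine distinct
      pairs; the tenth pair \<open>{a, x}\<close> pays for the added edge \<open>g\<close>.\<close>
    define Q where "Q = insert {a, x} ((\<lambda>e. e - {a}) ` T0)"
    have "inj_on (\<lambda>e. e - {a}) T0" by (rule inj_onI) (use a(2) in blast)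
    then have cQ: "card Q = 10" using cT0 finT0 by (auto simp: Q_def card_image card_insert_if)
    have "card (e - {a}) = 2" if "e \<in> T0" for e
    proof -
      have "card e = 3" using that T0C by blast
      then show ?thesis using a(2)[OF that] by simp
    qed
    then have Q: "Q \<subseteq> {K. K \<subseteq> C \<and> card K = 2}" "\<forall>K\<in>Q. \<exists>e\<in>T0. K \<subseteq> e"
      using x e T0C a by (auto simp: Q_def)
    have "\<exists>d\<in>insert g T0. b \<notin> d" if "b \<in> C" for b
    proof (cases "b = a")
      case True then show ?thesis using g by auto
    next
      case False
      show ?thesis
      proof (rule ccontr)
        assume "\<not> ?thesis"
        then have b: "\<And>d. d \<in> T0 \<Longrightarrow> b \<in> d" by auto
        \<comment> \<open>With a second common vertex \<open>b\<close>, at most six triples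
          \<open>{a, b, y}\<close> would be possible.\<close>
        have "T0 \<subseteq> (\<lambda>y. {a, b, y}) ` C"
        proof
          fix d assume d: "d \<in> T0"
          then have "card d = 3" "d \<subseteq> C" "a \<in> d" "b \<in> d" using T0C a b by auto
          then show "d \<in> (\<lambda>y. {a, b, y}) ` C" using False by (auto simp: card_3_iff)
        qed
        then have "card T0 \<le> card ((\<lambda>y. {a, b, y}) ` C)" using finC by (intro card_mono) auto
        also have "\<dots> \<le> card C" by (rule card_image_le) (rule finC)
        finally show False using cT0 C(2) by simp
      qed
    qed
    moreover have "card (insert g T0) \<le> card Q" using cQ cT0 finT0 by (simp add: card_insert_if)
    ultimately show ?thesis using Q g T0E T0C by (intro exI[of _ "insert g T0"] exI[of _ Q]) auto
  qed
  then obtain T Q where T: "T0 \<subseteq> T" "T \<subseteq> E" "T \<subseteq> Pow C" "\<forall>a\<in>C. \<exists>e\<in>T. a \<notin> e"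
    and Q: "Q \<subseteq> {K. K \<subseteq> C \<and> card K = 2}" "\<And>K. K \<in> Q \<Longrightarrow> \<exists>e\<in>T. K \<subseteq> e" "card T \<le> card Q"
    by (elim exE conjE) auto
  obtain F where F: "verts F = V" "T \<subseteq> edges F" "edges F \<subseteq> E" "F \<in> K_family 6" "is_core 6 F C"
    by (rule K_family_subgraph[OF C T(2) Q])
  have "F \<notin> M3" using M_free_H embeds_subgraph[OF F(1,3)] by (auto simp: M_free_def)
  then consider n where "embeds F (G1 n)" | n G where "is_G2 n G" "embeds F G"
    using F(4) by (auto simp: M3_def)
  then show False
  proof cases
    case 1
    have "T \<noteq> {}" using T(1) cT0 by auto
    then show False using embeds_G1_core[OF 1 F(5,2)] T(3,4) by blast
  next
    case 2
    then obtain k where "embeds F (blowup G62 k)" by (auto simp: is_G2_def is_blowup_def)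
    then obtain c where c: "bij_betw c C (verts G62)" "\<And>e. e \<in> edges F \<Longrightarrow> c ` e \<in> edges G62"
      by (rule embeds_blowup_core[OF _ F(5)]) (auto simp: G62_def)
    have cV: "bij_betw c C {1..6}" using c(1) by (simp add: G62_def)
    define pre where "pre t = {x \<in> C. c x \<in> t}" for t
    have pre: "c ` pre t = t" if "t \<subseteq> {1..6}" for t
      using cV that by (auto simp: pre_def bij_betw_def)
    have pre_compl: "C - pre t = pre ({1..6} - t)" for t
      using cV by (auto simp: pre_def bij_betw_def)
    have card_pre: "card (pre t) = card t" if "t \<subseteq> {1..6}" for t
    proof -
      have "inj_on c (pre t)" using cV by (auto simp: pre_def bij_betw_def inj_on_def)
      then show ?thesis using pre[OF that] card_image by metis
    qed
    have notT: "pre t \<notin> T" if "t \<in> non_G62" for t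
    proof
      assume "pre t \<in> T"
      moreover have "t \<subseteq> {1..6}" using that by (auto simp: non_G62_def)
      ultimately have "t \<in> edges G62" using c(2)[of "pre t"] pre[of t] F(2) by auto
      then show False using that by (simp add: edges_G62)
    qed
    have compl: "{1..6} - {1,2,3} = {4,5,6::nat}" "{1..6} - {1,2,6} = {3,4,5::nat}" by auto
    \<comment> \<open>The two complementary pairs missing from \<open>G62\<close> are pulled back to
      \<open>C\<close> and represented by their members through \<open>c0\<close>. Neither pair has
      a member in \<open>T\<close>, yet only one triple of \<open>All\<close> lies outside
      \<open>Th\<close>.\<close>
    define s1 where "s1 = (if c0 \<in> pre {1,2,3} then pre {1,2,3} else pre {4,5,6})"
    define s2 where "s2 = (if c0 \<in> pre {1,2,6} then pre {1,2,6} else pre {3,4,5})"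
    have "c c0 \<in> {1..6}" using cV c0 by (auto simp: bij_betw_def)
    moreover have "{1..6} = {1, 2, 3, 4, 5, 6::nat}" by auto
    ultimately have c0r: "c c0 \<in> {1, 2, 3, 4, 5, 6}" by metis
    have s: "s1 \<in> All" "s2 \<in> All"
    proof -
      have "c0 \<in> s1" "c0 \<in> s2" using c0 c0r by (auto simp: s1_def s2_def pre_def)
      moreover have "card s1 = 3" "card s2 = 3" unfolding s1_def s2_def
        using card_pre[of "{1,2,3}"] card_pre[of "{1,2,6}"] card_pre[of "{3,4,5}"] card_pre[of "{4,5,6}"]
        by auto
      moreover have "s1 \<subseteq> C" "s2 \<subseteq> C" by (auto simp: s1_def s2_def pre_def)
      ultimately show "s1 \<in> All" "s2 \<in> All" by (auto simp: All_def)
    qed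
    have "1 \<in> c ` s1 \<longleftrightarrow> 3 \<in> c ` s1" "1 \<in> c ` s2 \<longleftrightarrow> 3 \<notin> c ` s2" unfolding s1_def s2_def
      using pre[of "{1,2,3}"] pre[of "{1,2,6}"] pre[of "{3,4,5}"] pre[of "{4,5,6}"] by auto
    then have "s1 \<noteq> s2" by metis
    have sT: "s1 \<notin> T" "C - s1 \<notin> T" "s2 \<notin> T" "C - s2 \<notin> T"
    proof -
      have "{1..6} - {4,5,6} = {1,2,3::nat}" "{1..6} - {3,4,5} = {1,2,6::nat}" by auto
      then have "{s1, C - s1, s2, C - s2} \<subseteq> pre ` non_G62"
        using compl by (auto simp: s1_def s2_def pre_compl non_G62_def)
      then show "s1 \<notin> T" "C - s1 \<notin> T" "s2 \<notin> T" "C - s2 \<notin> T" using notT by auto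
    qed
    have "s1 \<notin> Th" "s2 \<notin> Th"
      using sT T(1) by (auto simp: T0_def rep_def image_subset_iff split: if_splits)
    then have "{s1, s2} \<subseteq> All - Th" using s by auto
    then have "card {s1, s2} \<le> card (All - Th)" using finAll by (intro card_mono) auto
    moreover have "card (All - Th) = 1" using Th cAll finTh by (subst card_Diff_subset) auto
    ultimately show False using \<open>s1 \<noteq> s2\<close> by simp
  qed
qed

text \<open>With at most one triple missing, sending 123 to it embeds the member of
  \<open>M1\<close>; with none missing, any triple can take that place.\<close>

lemma two_missing_triples:
  assumes "S \<subseteq> V" "card S = 5"
  shows "\<exists>e1 e2. e1 \<noteq> e2 \<and> e1 \<subseteq> S \<and> e2 \<subseteq> S \<and> card e1 = 3 \<and> card e2 = 3 \<and> e1 \<notin> E \<and> e2 \<notin> E"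
proof (rule ccontr)
  assume no: "\<not> ?thesis"
  have "\<exists>e. e \<subseteq> S \<and> card e = 3 \<and> (\<forall>e'. e' \<subseteq> S \<and> card e' = 3 \<and> e' \<noteq> e \<longrightarrow> e' \<in> E)"
  proof (cases "\<exists>e. e \<subseteq> S \<and> card e = 3 \<and> e \<notin> E")
    case True then show ?thesis using no by blast
  next
    case False
    moreover obtain e where "e \<subseteq> S" "card e = 3"
      using obtain_subset_with_card_n[of 3 S] assms(2) by auto
    ultimately show ?thesis by blast
  qed
  then obtain e where e: "e \<subseteq> S" "card e = 3"
    and eE: "\<And>e'. e' \<subseteq> S \<Longrightarrow> card e' = 3 \<Longrightarrow> e' \<noteq> e \<Longrightarrow> e' \<in> E" by blast
  have fS: "finite S" using assms(1) finite_V finite_subset by blast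
  obtain x y z where xyz: "e = {x, y, z}" "x \<noteq> y" "x \<noteq> z" "y \<noteq> z"
    using e(2) by (auto simp: card_3_iff)
  have "card (S - e) = 2" using e assms(2) fS by (subst card_Diff_subset) (auto intro: finite_subset)
  then obtain u v where uv: "S - e = {u, v}" "u \<noteq> v" by (auto simp: card_2_iff)
  \<comment> \<open>The default value \<open>x\<close> serves as the image of 1.\<close>
  define f where "f = (\<lambda>_::nat. x)(2 := y, 3 := z, 4 := u, 5 := v)"
  have five: "{1..5} = {1, 2, 3, 4, 5::nat}" by auto
  have uvn: "u \<notin> e" "v \<notin> e" "u \<in> S" "v \<in> S" using uv by blast+
  have inj: "inj_on f {1..5}" using xyz uv(2) uvn unfolding five by (auto simp: f_def)
  have img: "f ` {1..5} \<subseteq> S" using e(1) xyz uvn unfolding five by (auto simp: f_def)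
  have fe: "f ` {1, 2, 3} = e" using xyz by (auto simp: f_def)
  let ?F = "\<lparr>verts = {1..5}, edges = {e. e \<subseteq> {1..5} \<and> card e = 3} - {{1,2,3::nat}}\<rparr>"
  have "embeds ?F H"
    unfolding embeds_def
  proof (intro exI[of _ f] conjI ballI)
    show "inj_on f (verts ?F)" using inj by simp
    show "f ` verts ?F \<subseteq> V" using img assms(1) by auto
    fix d assume d: "d \<in> edges ?F"
    have "card (f ` d) = 3" using d inj by (simp add: card_image inj_on_subset)
    moreover have "f ` d \<noteq> e"
      using d inj_on_image_eq_iff[OF inj, of d "{1,2,3}"] fe by auto
    ultimately show "f ` d \<in> E" using eE[of "f ` d"] d img by auto
  qed
  then show False using M_free_H by (auto simp: M_free_def M1_def)
qed

section \<open>Colourings of covered vertex sets\<close>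

definition hom :: "nat set \<Rightarrow> (nat \<Rightarrow> nat \<Rightarrow> nat \<Rightarrow> bool) \<Rightarrow> (nat \<Rightarrow> nat) \<Rightarrow> nat set \<Rightarrow> bool" where
  "hom K pat c X \<longleftrightarrow> c ` X \<subseteq> K \<and>
     (\<forall>x\<in>X. \<forall>y\<in>X. \<forall>z\<in>X. {x, y, z} \<in> E \<longrightarrow> pat (c x) (c y) (c z))"

text \<open>The conclusion of the theorem for the 3-graph induced on \<open>X\<close>, in terms of
  colourings; \<open>good_remove_verts\<close> translates it.\<close>

definition good :: "nat set \<Rightarrow> bool" where
  "good X \<longleftrightarrow> (\<exists>c. hom {0, 1} pat1 c X) \<or> (\<exists>c. hom {1..6} pat2 c X)"

lemma hom_mono: "hom K pat c X \<Longrightarrow> Y \<subseteq> X \<Longrightarrow> hom K pat c Y"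
  unfolding hom_def by (intro conjI ballI impI) (auto simp: subset_iff)

lemma good_mono: "good X \<Longrightarrow> Y \<subseteq> X \<Longrightarrow> good Y"
  unfolding good_def using hom_mono by metis

lemma edge_distinct: "{x, y, z} \<in> E \<Longrightarrow> x \<noteq> y \<and> x \<noteq> z \<and> y \<noteq> z"
  using edgeD[of "{x,y,z}"] by (auto simp: card_insert_if split: if_splits)

lemma star_good:
  assumes "\<And>e. e \<in> E \<Longrightarrow> e \<subseteq> S \<Longrightarrow> a \<in> e"
  shows "good S"
proof -
  have "hom {0, 1} pat1 (\<lambda>x. if x = a then 0 else 1) S"
    unfolding hom_def
  proof (intro conjI ballI impI)
    fix x y z assume *: "x \<in> S" "y \<in> S" "z \<in> S" "{x, y, z} \<in> E"
    then have "a \<in> {x, y, z}" using assms[of "{x,y,z}"] by simp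
    then show "pat1 (if x = a then 0 else 1) (if y = a then 0 else 1) (if z = a then 0 else 1)"
      using edge_distinct[OF *(4)] by (auto simp: pat1_def)
  qed auto
  then show ?thesis by (auto simp: good_def)
qed

text \<open>If all vertices get different colours, only the four non-edges of \<open>G62\<close> can
  be violated. \<open>K\<close> may be a proper subset of the colours when \<open>S\<close> has
  fewer than six vertices.\<close>

lemma G62_labelling_good:
  assumes g: "inj_on g K" "g ` K = S" "K \<subseteq> {1..6}"
    and non: "\<And>t. t \<in> non_G62 \<Longrightarrow> t \<subseteq> K \<Longrightarrow> g ` t \<notin> E"
  shows "good S"
proof -
  let ?c = "inv_into K g"
  have cK: "?c x \<in> K" if "x \<in> S" for x using that g(2) inv_into_into by metis
  have gc: "g (?c x) = x" if "x \<in> S" for x using that g(2) f_inv_into_f by metis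
  have "hom {1..6} pat2 ?c S"
    unfolding hom_def
  proof (intro conjI ballI impI)
    show "?c ` S \<subseteq> {1..6}" using cK g(3) by blast
    fix x y z assume *: "x \<in> S" "y \<in> S" "z \<in> S" "{x, y, z} \<in> E"
    have img: "g ` {?c x, ?c y, ?c z} = {x, y, z}" using gc * by simp
    have sub: "{?c x, ?c y, ?c z} \<subseteq> K" using cK * by simp
    have "card {?c x, ?c y, ?c z} = card {x, y, z}"
      using card_image[OF inj_on_subset[OF g(1) sub]] img by simp
    then have "card {?c x, ?c y, ?c z} = 3" using edgeD[OF *(4)] by simp
    moreover have "{?c x, ?c y, ?c z} \<notin> non_G62" using non[OF _ sub] img *(4) by auto
    ultimately show "pat2 (?c x) (?c y) (?c z)" unfolding pat2_def edges_G62 using sub g(3) by blast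
  qed
  then show ?thesis by (auto simp: good_def)
qed

text \<open>Two triples sharing two vertices can be labelled 123 and 126; their complements are then
  456 and 345, so all four non-edges of \<open>G62\<close> are missing.\<close>

lemma two_missing_complements_good:
  assumes fC: "finite C" and C: "card C = 6" "e1 \<subseteq> C" "card e1 = 3" "e2 \<subseteq> C" "card e2 = 3"
    and int: "card (e1 \<inter> e2) = 2" and mis: "{e1, C - e1, e2, C - e2} \<inter> E = {}"
  shows "good C"
proof -
  have f12: "finite e1" "finite e2" using fC C finite_subset by auto
  obtain a b where ab: "e1 \<inter> e2 = {a, b}" "a \<noteq> b" using int by (auto simp: card_2_iff)
  have "card (e1 - e2) = 1" "card (e2 - e1) = 1"
    using card_Diff_subset_Int[of e1 e2] card_Diff_subset_Int[of e2 e1] f12 int C by (auto simp: Int_commute)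
  then obtain c d where cd: "e1 - e2 = {c}" "e2 - e1 = {d}" by (auto simp: card_1_singleton_iff)
  have "card (e1 \<union> e2) = 4" using card_Un_Int[OF f12] int C by simp
  then have "card (C - (e1 \<union> e2)) = 2" using C f12 fC by (subst card_Diff_subset) auto
  then obtain u v where uv: "C - (e1 \<union> e2) = {u, v}" "u \<noteq> v" by (auto simp: card_2_iff)
  have e1: "e1 = {a, b, c}" and e2: "e2 = {a, b, d}" using ab cd by blast+
  have Ceq: "C = {a, b, c, u, v, d}" using uv e1 e2 C by blast
  have "a \<in> e1" "a \<in> e2" "b \<in> e1" "b \<in> e2" "c \<in> e1" "c \<notin> e2" "d \<notin> e1" "d \<in> e2"
    "u \<notin> e1" "u \<notin> e2" "v \<notin> e1" "v \<notin> e2" using ab(1) cd uv(1) by blast+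
  then have dist: "distinct [a, b, c, u, v, d]" using ab(2) uv(2) by auto
  define g where "g = (\<lambda>_::nat. a)(2 := b, 3 := c, 4 := u, 5 := v, 6 := d)"
  have six: "{1..6} = {1, 2, 3, 4, 5, 6::nat}" by auto
  show ?thesis
  proof (rule G62_labelling_good[of g "{1..6}"])
    show "inj_on g {1..6}" using dist unfolding six by (auto simp: g_def)
    show "g ` {1..6} = C" unfolding six Ceq by (auto simp: g_def)
    fix t assume "t \<in> non_G62"
    moreover have "g ` {1, 2, 3} = e1" "g ` {1, 2, 6} = e2" unfolding e1 e2 by (auto simp: g_def)
    moreover have "C - e1 = {u, v, d}" "C - e2 = {c, u, v}" unfolding Ceq e1 e2 using dist by auto
    moreover have "g ` {4, 5, 6} = {u, v, d}" "g ` {3, 4, 5} = {c, u, v}" by (auto simp: g_def)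
    ultimately have "g ` t = e1 \<or> g ` t = C - e1 \<or> g ` t = e2 \<or> g ` t = C - e2"
      unfolding non_G62_iff by metis
    then show "g ` t \<notin> E" using mis by auto
  qed simp
qed

text \<open>Triples meeting in one vertex are labelled 126 and 456, without colour 3; triples
  meeting in two are labelled 123 and 126, without colour 5. No other non-edge of \<open>G62\<close>
  avoids the omitted colour.\<close>

lemma two_missing_good5:
  assumes fS: "finite S" and S: "card S = 5" "e1 \<subseteq> S" "card e1 = 3" "e2 \<subseteq> S" "card e2 = 3" "e1 \<noteq> e2"
    and mis: "e1 \<notin> E" "e2 \<notin> E"
  shows "good S"
proof -
  have f12: "finite e1" "finite e2" using fS S finite_subset by auto
  have "card (e1 \<union> e2) \<le> 5" using card_mono[OF fS, of "e1 \<union> e2"] S by auto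
  then have "card (e1 \<inter> e2) \<ge> 1" using card_Un_Int[OF f12] S by simp
  moreover have "card (e1 \<inter> e2) \<noteq> 3"
    using card_subset_eq[OF f12(1), of "e1 \<inter> e2"] card_subset_eq[OF f12(2), of "e1 \<inter> e2"] S by auto
  moreover have "card (e1 \<inter> e2) \<le> 3" using card_mono[OF f12(1), of "e1 \<inter> e2"] S by auto
  ultimately consider "card (e1 \<inter> e2) = 1" | "card (e1 \<inter> e2) = 2" by linarith
  then show ?thesis
  proof cases
    case 1
    then obtain a where a: "e1 \<inter> e2 = {a}" by (auto simp: card_1_singleton_iff)
    have "card (e1 - e2) = 2" "card (e2 - e1) = 2"
      using card_Diff_subset_Int[of e1 e2] card_Diff_subset_Int[of e2 e1] f12 1 S by (auto simp: Int_commute)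
    then obtain b c d f where bc: "e1 - e2 = {b, c}" "b \<noteq> c" "e2 - e1 = {d, f}" "d \<noteq> f"
      by (auto simp: card_2_iff)
    have e1: "e1 = {a, b, c}" and e2: "e2 = {a, d, f}" using a bc by blast+
    have "a \<in> e1" "a \<in> e2" "b \<in> e1" "b \<notin> e2" "c \<in> e1" "c \<notin> e2" "d \<notin> e1" "d \<in> e2"
      "f \<notin> e1" "f \<in> e2" using a bc by blast+
    then have dist: "distinct [a, b, c, d, f]" using bc(2,4) by auto
    have "{a, b, c, d, f} \<subseteq> S" "card {a, b, c, d, f} = 5" using e1 e2 S dist by auto
    then have Seq: "{a, b, c, d, f} = S" using S fS card_subset_eq by metis
    define g where "g = (\<lambda>_::nat. a)(1 := b, 2 := c, 4 := d, 5 := f)"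
    show ?thesis
    proof (rule G62_labelling_good[of g "{6, 1, 2, 4, 5}"])
      show "inj_on g {6, 1, 2, 4, 5}" using dist by (auto simp: g_def)
      show "g ` {6, 1, 2, 4, 5} = S" unfolding Seq[symmetric] by (auto simp: g_def)
      fix t :: "nat set" assume "t \<in> non_G62" "t \<subseteq> {6, 1, 2, 4, 5}"
      then have "t = {1, 2, 6} \<or> t = {4, 5, 6}" unfolding non_G62_iff by (elim disjE) simp_all
      moreover have "g ` {1, 2, 6} = e1" "g ` {4, 5, 6} = e2" unfolding e1 e2 by (auto simp: g_def)
      ultimately have "g ` t = e1 \<or> g ` t = e2" by metis
      then show "g ` t \<notin> E" using mis by auto
    qed auto
  next
    case 2
    then obtain a b where ab: "e1 \<inter> e2 = {a, b}" "a \<noteq> b" by (auto simp: card_2_iff)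
    have "card (e1 - e2) = 1" "card (e2 - e1) = 1"
      using card_Diff_subset_Int[of e1 e2] card_Diff_subset_Int[of e2 e1] f12 2 S by (auto simp: Int_commute)
    then obtain c d where cd: "e1 - e2 = {c}" "e2 - e1 = {d}" by (auto simp: card_1_singleton_iff)
    have "card (e1 \<union> e2) = 4" using card_Un_Int[OF f12] 2 S by simp
    then have "card (S - (e1 \<union> e2)) = 1" using S f12 fS by (subst card_Diff_subset) auto
    then obtain u where u: "S - (e1 \<union> e2) = {u}" by (auto simp: card_1_singleton_iff)
    have e1: "e1 = {a, b, c}" and e2: "e2 = {a, b, d}" using ab cd by blast+
    have Seq: "S = {a, b, c, d, u}" using u e1 e2 S by blast
    have "a \<in> e1" "a \<in> e2" "b \<in> e1" "b \<in> e2" "c \<in> e1" "c \<notin> e2" "d \<notin> e1" "d \<in> e2"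
      "u \<notin> e1" "u \<notin> e2" using ab(1) cd u by blast+
    then have dist: "distinct [a, b, c, d, u]" using ab(2) by auto
    define g where "g = (\<lambda>_::nat. a)(2 := b, 3 := c, 6 := d, 4 := u)"
    show ?thesis
    proof (rule G62_labelling_good[of g "{1, 2, 3, 6, 4}"])
      show "inj_on g {1, 2, 3, 6, 4}" using dist by (auto simp: g_def)
      show "g ` {1, 2, 3, 6, 4} = S" unfolding Seq by (auto simp: g_def)
      fix t :: "nat set" assume "t \<in> non_G62" "t \<subseteq> {1, 2, 3, 6, 4}"
      then have "t = {1, 2, 3} \<or> t = {1, 2, 6}" unfolding non_G62_iff by (elim disjE) simp_all
      moreover have "g ` {1, 2, 3} = e1" "g ` {1, 2, 6} = e2" unfolding e1 e2 by (auto simp: g_def)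
      ultimately have "g ` t = e1 \<or> g ` t = e2" by metis
      then show "g ` t \<notin> E" using mis by auto
    qed auto
  qed
qed

text \<open>Edges spanning at most seven vertices lie in a seven-vertex core and so have a common
  vertex. This applies to two edges, hence to three (3 + 2 + 2 vertices), and finally to an edge
  with, for each of its vertices, an edge avoiding it: these share two vertices with it (3 + 1 + 1 +
  1).\<close>

lemma large_covered_star:
  assumes S: "S \<subseteq> V" "7 \<le> card S" and cov: "\<And>x y. x \<in> S \<Longrightarrow> y \<in> S \<Longrightarrow> x \<noteq> y \<Longrightarrow> adj x y"
  shows "\<exists>a. \<forall>e\<in>E. e \<subseteq> S \<longrightarrow> a \<in> e"
proof (rule ccontr)
  assume "\<not> ?thesis"
  then obtain g where g: "\<And>a. g a \<in> E \<and> g a \<subseteq> S \<and> a \<notin> g a" by metis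
  have fS: "finite S" using S(1) finite_V finite_subset by blast
  have common: "\<exists>a. \<forall>e\<in>E. e \<subseteq> D \<longrightarrow> a \<in> e" if D: "D \<subseteq> S" "card D \<le> 7" for D
  proof -
    have "\<exists>C. D \<subseteq> C \<and> C \<subseteq> S \<and> card C = 7"
      using exists_subset_between[of D 7 S] D S(2) fS by auto
    then obtain C where C: "D \<subseteq> C" "C \<subseteq> S" "card C = 7" by blast
    have "\<exists>a\<in>C. \<forall>e\<in>E. e \<subseteq> C \<longrightarrow> a \<in> e"
      by (rule core7_common_vertex) (use C S(1) cov in \<open>auto intro!: cov\<close>)
    then obtain a where "\<And>e. e \<in> E \<Longrightarrow> e \<subseteq> C \<Longrightarrow> a \<in> e" by blast
    then have "\<forall>e\<in>E. e \<subseteq> D \<longrightarrow> a \<in> e" using order_trans[OF _ C(1)] by simp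
    then show ?thesis by blast
  qed
  have meet2: "\<exists>a. a \<in> e \<inter> f" if "e \<in> E" "f \<in> E" "e \<subseteq> S" "f \<subseteq> S" for e f
  proof -
    have "card (e \<union> f) \<le> 7" using card_Un_le[of e f] edgeD[OF that(1)] edgeD[OF that(2)] by simp
    then show ?thesis using common[of "e \<union> f"] that by auto
  qed
  have meet3: "\<exists>a. a \<in> e \<inter> f \<inter> h" if "e \<in> E" "f \<in> E" "h \<in> E" "e \<subseteq> S" "f \<subseteq> S" "h \<subseteq> S" for e f h
  proof -
    have less: "card (d - e) \<le> 2" if d: "d \<in> E" "d \<subseteq> S" for d
    proof -
      obtain x where "x \<in> d \<inter> e" using meet2[OF d(1) \<open>e \<in> E\<close> d(2) \<open>e \<subseteq> S\<close>] by blast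
      then have "d - e \<subseteq> d - {x}" "card (d - {x}) = 2" using edgeD[OF that(1)] by auto
      then show ?thesis using card_mono[of "d - {x}" "d - e"] finite_edge[OF that(1)] by simp
    qed
    have "e \<union> f \<union> h = e \<union> ((f - e) \<union> (h - e))" by blast
    then have "card (e \<union> f \<union> h) \<le> card e + (card (f - e) + card (h - e))"
      using card_Un_le[of e "(f - e) \<union> (h - e)"] card_Un_le[of "f - e" "h - e"] by simp
    then have "card (e \<union> f \<union> h) \<le> 7" using less[of f] less[of h] edgeD[of e] that by simp
    then show ?thesis using common[of "e \<union> f \<union> h"] that by auto
  qed
  define e where "e = g 0"
  have e: "e \<in> E" "e \<subseteq> S" using g by (auto simp: e_def)
  obtain x y z where xyz: "e = {x, y, z}" "x \<noteq> y" "x \<noteq> z" "y \<noteq> z"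
    using edgeD[OF e(1)] by (auto simp: card_3_iff)
  have gs: "g u \<in> E" "g u \<subseteq> S" "u \<notin> g u" for u using g by auto
  \<comment> \<open>The common vertex of \<open>e\<close>, \<open>g x\<close> and \<open>g y\<close>
    lies in \<open>e\<close> and is neither \<open>x\<close> nor \<open>y\<close>.\<close>
  have in1: "z \<in> g x" "z \<in> g y"
    using meet3[OF e(1) gs(1) gs(1) e(2) gs(2) gs(2), of x y] gs(3)[of x] gs(3)[of y] xyz by auto
  have in2: "y \<in> g x" "y \<in> g z"
    using meet3[OF e(1) gs(1) gs(1) e(2) gs(2) gs(2), of x z] gs(3)[of x] gs(3)[of z] xyz by auto
  have in3: "x \<in> g y" "x \<in> g z"
    using meet3[OF e(1) gs(1) gs(1) e(2) gs(2) gs(2), of y z] gs(3)[of y] gs(3)[of z] xyz by auto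
  have one: "card (g u - e) \<le> 1" if "p \<in> g u" "q \<in> g u" "p \<in> e" "q \<in> e" "p \<noteq> q" for u p q
  proof -
    have "g u - e \<subseteq> g u - {p, q}" "card (g u - {p, q}) = 1"
      using that edgeD[OF gs(1)[of u]] by (auto simp: card_Diff_subset)
    then show ?thesis using card_mono[of "g u - {p,q}" "g u - e"] finite_edge[OF gs(1)[of u]] by simp
  qed
  have "e \<union> g x \<union> g y \<union> g z = e \<union> ((g x - e) \<union> ((g y - e) \<union> (g z - e)))" by blast
  then have "card (e \<union> g x \<union> g y \<union> g z) \<le> card e + (card (g x - e) + (card (g y - e) + card (g z - e)))"
    using card_Un_le[of e "(g x - e) \<union> ((g y - e) \<union> (g z - e))"]
      card_Un_le[of "g x - e" "(g y - e) \<union> (g z - e)"] card_Un_le[of "g y - e" "g z - e"] by simp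
  then have "card (e \<union> g x \<union> g y \<union> g z) \<le> 7"
    using one[of z x y] one[of z y x] one[of y z x] in1 in2 in3 xyz edgeD[OF e(1)] by auto
  then obtain a where a: "\<forall>d\<in>E. d \<subseteq> e \<union> g x \<union> g y \<union> g z \<longrightarrow> a \<in> d"
    using common[of "e \<union> g x \<union> g y \<union> g z"] e gs by auto
  then have "a \<in> e" "a \<in> g x" "a \<in> g y" "a \<in> g z" using e gs(1) by auto
  then show False using gs(3) xyz by auto
qed

text \<open>The end of the symmetrization. Seven or more vertices form a star, six are handled by
  \<open>M3\<close>, five by \<open>M1\<close>, and four or fewer can always be labelled.\<close>

lemma covered_good:
  assumes S: "S \<subseteq> V" and cov: "\<And>x y. x \<in> S \<Longrightarrow> y \<in> S \<Longrightarrow> x \<noteq> y \<Longrightarrow> adj x y"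
  shows "good S"
proof -
  have fS: "finite S" using S finite_V finite_subset by blast
  consider "7 \<le> card S" | "card S = 6" | "card S = 5" | "card S \<le> 4" by linarith
  then show ?thesis
  proof cases
    case 1
    then show ?thesis using large_covered_star[OF S 1 cov] star_good by blast
  next
    case 2
    show ?thesis
    proof (rule disjE[OF core6_structure[OF S 2 cov]])
      assume "\<exists>a\<in>S. \<forall>e\<in>E. e \<subseteq> S \<longrightarrow> a \<in> e"
      then show ?thesis using star_good by blast
    next
      assume "\<exists>e1 e2. e1 \<subseteq> S \<and> card e1 = 3 \<and> e2 \<subseteq> S \<and> card e2 = 3 \<and> e2 \<noteq> e1 \<and> e2 \<noteq> S - e1 \<and>
       {e1, S - e1, e2, S - e2} \<inter> E = {}"
      then obtain e1 e2 where e: "e1 \<subseteq> S" "card e1 = 3" "e2 \<subseteq> S" "card e2 = 3" "e2 \<noteq> e1" "e2 \<noteq> S - e1"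
        "{e1, S - e1, e2, S - e2} \<inter> E = {}" by (elim exE conjE) (rule that)
      have f12: "finite e1" "finite e2" using finite_subset[OF e(1) fS] finite_subset[OF e(3) fS] by auto
      have c': "card (S - e2) = 3" "card (S - e1) = 3" using e f12 2 by (auto simp: card_Diff_subset)
      have "card (e1 \<inter> e2) \<noteq> 3"
        using card_subset_eq[OF f12(1), of "e1 \<inter> e2"] card_subset_eq[OF f12(2), of "e1 \<inter> e2"] e by auto
      moreover have "card (e1 \<inter> e2) \<le> 3" using card_mono[OF f12(1), of "e1 \<inter> e2"] e by auto
      moreover have "card (e1 \<inter> e2) \<noteq> 0"
      proof
        assume "card (e1 \<inter> e2) = 0"
        then have "e2 \<subseteq> S - e1" using f12 e by auto
        then show False using card_subset_eq[of "S - e1" e2] fS c' e by auto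
      qed
      ultimately consider "card (e1 \<inter> e2) = 2" | "card (e1 \<inter> e2) = 1" by linarith
      then show ?thesis
      proof cases
        case A: 1
        show ?thesis by (rule two_missing_complements_good[OF fS 2 e(1-4) A e(7)])
      next
        case B: 2
        \<comment> \<open>Replacing \<open>e2\<close> by its complement turns an intersection of
          size 1 into one of size 2.\<close>
        have "e1 \<inter> (S - e2) = e1 - e1 \<inter> e2" using e by blast
        then have "card (e1 \<inter> (S - e2)) = 2" using B e f12 by (simp add: card_Diff_subset)
        moreover have "{e1, S - e1, S - e2, S - (S - e2)} \<inter> E = {}" using e by (simp add: double_diff)
        ultimately show ?thesis
          using two_missing_complements_good[OF fS 2 e(1,2), of "S - e2"] c' by auto
      qed
    qed
  next
    case 3
    obtain e1 e2 where "e1 \<noteq> e2" "e1 \<subseteq> S" "e2 \<subseteq> S" "card e1 = 3" "card e2 = 3" "e1 \<notin> E" "e2 \<notin> E"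
      using two_missing_triples[OF S 3] by (elim exE conjE) (rule that)
    then show ?thesis using two_missing_good5[OF fS 3] by simp
  next
    case 4
    \<comment> \<open>The set 1346 contains no non-edge of \<open>G62\<close>, so every injective
      labelling by these colours works.\<close>
    have "card {1, 3, 4, 6::nat} = 4" by simp
    then obtain K where K: "K \<subseteq> {1, 3, 4, 6::nat}" "card K = card S"
      using 4 by (metis obtain_subset_with_card_n)
    then have fK: "finite K" using finite_subset[OF K(1)] by simp
    obtain g where g: "bij_betw g K S" using finite_same_card_bij[OF fK fS K(2)] by blast
    show ?thesis
    proof (rule G62_labelling_good[of g K])
      show "inj_on g K" "g ` K = S" using g by (auto simp: bij_betw_def)
      show "K \<subseteq> {1..6}" using K(1) by auto
      fix t assume "t \<in> non_G62" "t \<subseteq> K"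
      then have "t \<subseteq> {1, 3, 4, 6}" using K(1) by simp
      then have False using \<open>t \<in> non_G62\<close> unfolding non_G62_iff by (elim disjE) simp_all
      then show "g ` t \<notin> E" by simp
    qed
  qed
qed

section \<open>Weights and symmetrization\<close>

definition edge :: "nat \<Rightarrow> nat \<Rightarrow> nat \<Rightarrow> real" where
  "edge x y z = of_bool ({x, y, z} \<in> E)"

lemma edge_swap: "edge x y z = edge y x z" "edge x y z = edge x z y"
  by (simp_all add: edge_def insert_commute)

lemma edge_nonneg [simp]: "0 \<le> edge x y z" and edge_le_1 [simp]: "edge x y z \<le> 1"
  by (simp_all add: edge_def)

lemma edge_same [simp]: "edge x x z = 0" "edge x z x = 0" "edge z x x = 0"
  using edge_distinct[of x x z] edge_distinct[of x z x] edge_distinct[of z x x] by (auto simp: edge_def)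

text \<open>Pairs are ordered. By the symmetry of \<open>tri\<close>, \<open>link w V V v\<close> is
  one third of the partial derivative of \<open>lag V\<close> at \<open>v\<close>.\<close>

definition link :: "(nat \<Rightarrow> real) \<Rightarrow> nat set \<Rightarrow> nat set \<Rightarrow> nat \<Rightarrow> real" where
  "link w A B v = (\<Sum>y\<in>A. \<Sum>z\<in>B. edge v y z * (w y * w z))"

text \<open>The symmetric trilinear form polarizing 6 times the Lagrange polynomial
  (\<open>lag_eq_edge_sum\<close>), so that \<open>lag\<close> has an exact Taylor expansion along
  lines.\<close>

definition tri :: "nat set \<Rightarrow> (nat \<Rightarrow> real) \<Rightarrow> (nat \<Rightarrow> real) \<Rightarrow> (nat \<Rightarrow> real) \<Rightarrow> real" where
  "tri X a b c = (\<Sum>x\<in>X. \<Sum>y\<in>X. \<Sum>z\<in>X. edge x y z * (a x * b y * c z))"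

abbreviation lag :: "nat set \<Rightarrow> (nat \<Rightarrow> real) \<Rightarrow> real" where
  "lag X w \<equiv> tri X w w w"

lemma tri_swap12: "tri X a b c = tri X b a c"
proof -
  have "tri X a b c = (\<Sum>y\<in>X. \<Sum>x\<in>X. \<Sum>z\<in>X. edge x y z * (a x * b y * c z))"
    unfolding tri_def by (rule sum.swap)
  also have "\<dots> = tri X b a c" unfolding tri_def
    by (intro sum.cong refl) (simp add: edge_swap(1) mult.commute)
  finally show ?thesis .
qed

lemma tri_swap23: "tri X a b c = tri X a c b"
proof -
  have "tri X a b c = (\<Sum>x\<in>X. \<Sum>z\<in>X. \<Sum>y\<in>X. edge x y z * (a x * b y * c z))"
    unfolding tri_def by (intro sum.cong refl sum.swap)
  also have "\<dots> = tri X a c b" unfolding tri_def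
    by (intro sum.cong refl) (simp add: edge_swap(2) mult_ac)
  finally show ?thesis .
qed

lemma tri_link: "tri X a w w = (\<Sum>x\<in>X. a x * link w X X x)"
  unfolding tri_def link_def sum_distrib_left by (intro sum.cong refl) (simp add: mult_ac)

lemma tri_linear1: "tri X (\<lambda>x. a x + t * b x) c d = tri X a c d + t * tri X b c d"
  unfolding tri_def sum_distrib_left sum.distrib[symmetric]
  by (intro sum.cong refl) (simp add: algebra_simps)

lemma tri_linear2: "tri X c (\<lambda>x. a x + t * b x) d = tri X c a d + t * tri X c b d"
  using tri_linear1[of X a t b c d] tri_swap12 by metis

lemma tri_linear3: "tri X c d (\<lambda>x. a x + t * b x) = tri X c d a + t * tri X c d b"
  using tri_linear2[of X c a t b d] tri_swap23 by metis

lemma lag_expand: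
  "lag X (\<lambda>x. a x + t * b x) = lag X a + 3 * t * tri X b a a + 3 * t^2 * tri X b b a + t^3 * lag X b"
proof -
  have "tri X a a b = tri X b a a" "tri X a b a = tri X b a a" "tri X a b b = tri X b b a"
    "tri X b a b = tri X b b a" using tri_swap12 tri_swap23 by metis+
  then show ?thesis unfolding tri_linear1 tri_linear2 tri_linear3
    by (simp add: algebra_simps power2_eq_square power3_eq_cube)
qed

lemma tri_nonneg:
  assumes "\<And>x. x \<in> X \<Longrightarrow> 0 \<le> a x" "\<And>x. x \<in> X \<Longrightarrow> 0 \<le> b x" "\<And>x. x \<in> X \<Longrightarrow> 0 \<le> c x"
  shows "0 \<le> tri X a b c"
  unfolding tri_def by (intro sum_nonneg mult_nonneg_nonneg) (auto simp: assms)

lemma tri_mono3: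
  assumes "\<And>x. x \<in> X \<Longrightarrow> 0 \<le> a x" "\<And>x. x \<in> X \<Longrightarrow> 0 \<le> b x" "\<And>x. x \<in> X \<Longrightarrow> c x \<le> d x"
  shows "tri X a b c \<le> tri X a b d"
  unfolding tri_def by (intro sum_mono mult_left_mono mult_nonneg_nonneg) (auto simp: assms)

lemma link_le:
  assumes "\<And>x. x \<in> A \<union> B \<Longrightarrow> 0 \<le> w x"
  shows "link w A B v \<le> sum w A * sum w B"
  unfolding link_def sum_product
  by (intro sum_mono mult_left_le_one_le mult_nonneg_nonneg) (auto simp: assms)

lemma link_commute: "link w A B v = link w B A v"
  unfolding link_def by (subst sum.swap) (simp add: edge_swap(2) mult.commute)

definition shift :: "(nat \<Rightarrow> real) \<Rightarrow> nat \<Rightarrow> nat \<Rightarrow> real \<Rightarrow> nat \<Rightarrow> real" where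
  "shift w u v t = (\<lambda>x. w x + t * (of_bool (x = v) - of_bool (x = u)))"

text \<open>The direction is supported on \<open>u\<close> and \<open>v\<close>, so its quadratic
  and cubic terms see only edges containing both. The third vertex of such an edge has weight zero
  and is neither \<open>u\<close> nor \<open>v\<close>, so these terms vanish.\<close>

lemma lag_shift:
  assumes uv: "u \<in> V" "v \<in> V" "u \<noteq> v" and no: "\<And>z. z \<in> V \<Longrightarrow> w z \<noteq> 0 \<Longrightarrow> {u, v, z} \<notin> E"
  shows "lag V (shift w u v t) = lag V w + 3 * t * (link w V V v - link w V V u)"
proof -
  define g :: "nat \<Rightarrow> real" where "g x = of_bool (x = v) - of_bool (x = u)" for x
  have gs: "(\<Sum>x\<in>V. g x * F x) = F v - F u" for F
    unfolding g_def by (rule sum_indicator_diff) (use uv in auto)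
  have gg: "tri V g g c = 0" if c: "\<And>z. z \<in> V \<Longrightarrow> edge u v z * c z = 0" for c
  proof -
    define D where "D x y = (\<Sum>z\<in>V. edge x y z * c z)" for x y
    have "tri V g g c = (\<Sum>x\<in>V. g x * (\<Sum>y\<in>V. g y * D x y))"
      unfolding tri_def D_def sum_distrib_left by (intro sum.cong refl) (simp add: mult_ac)
    also have "\<dots> = D v v - D v u - (D u v - D u u)" by (simp only: gs)
    also have "D v u = D u v" by (simp add: D_def edge_swap(1))
    also have "D u v = 0" unfolding D_def by (rule sum.neutral) (use c in auto)
    finally show ?thesis by (simp add: D_def)
  qed
  have "tri V g g w = 0" by (rule gg) (use no in \<open>auto simp: edge_def\<close>)
  moreover have "tri V g g g = 0" by (rule gg) (auto simp: g_def)
  moreover have "tri V g w w = link w V V v - link w V V u" by (simp add: tri_link gs)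
  moreover have "shift w u v t = (\<lambda>x. w x + t * g x)" by (simp add: shift_def g_def)
  ultimately show ?thesis by (simp add: lag_expand)
qed

lemma sum_shift:
  assumes "u \<in> V" "v \<in> V"
  shows "sum (shift w u v t) V = sum w V"
  using sum_indicator_diff[OF finite_V assms, of "\<lambda>_. 1"]
  by (simp add: shift_def sum.distrib sum_distrib_left[symmetric])

lemma shift_nonneg:
  assumes "\<And>x. x \<in> V \<Longrightarrow> 0 \<le> w x" "0 \<le> t" "t \<le> w u" "u \<noteq> v" "x \<in> V"
  shows "0 \<le> shift w u v t x"
  using assms(1)[OF assms(5)] assms(2-4) by (auto simp: shift_def)

text \<open>Between vertices \<open>u\<close>, \<open>v\<close> without common edge in the support, the Lagrange polynomial is
  linear in the transferred weight.\<close>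

lemma symmetrization_induct:
  assumes nonneg: "\<And>x. x \<in> V \<Longrightarrow> 0 \<le> w x"
    and base: "\<And>w. (\<And>x. x \<in> V \<Longrightarrow> 0 \<le> w x) \<Longrightarrow> good {x \<in> V. w x \<noteq> 0} \<Longrightarrow> Q w"
    and step: "\<And>w u v. (\<And>x. x \<in> V \<Longrightarrow> 0 \<le> w x) \<Longrightarrow> u \<in> V \<Longrightarrow> v \<in> V \<Longrightarrow> u \<noteq> v \<Longrightarrow>
      (\<And>z. z \<in> V \<Longrightarrow> w z \<noteq> 0 \<Longrightarrow> {u, v, z} \<notin> E) \<Longrightarrow> link w V V u \<le> link w V V v \<Longrightarrow>
      Q (shift w u v (w u)) \<Longrightarrow> Q w"
  shows "Q w"
  using nonneg
proof (induction "card {x \<in> V. w x \<noteq> 0}" arbitrary: w rule: less_induct)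
  case less
  let ?S = "{x \<in> V. w x \<noteq> 0}"
  show ?case
  proof (cases "\<forall>x\<in>?S. \<forall>y\<in>?S. x \<noteq> y \<longrightarrow> (\<exists>z\<in>?S. {x, y, z} \<in> E)")
    case True
    have "good ?S"
    proof (rule covered_good)
      fix x y assume "x \<in> ?S" "y \<in> ?S" "x \<noteq> y"
      then obtain z where "{x, y, z} \<in> E" using True by blast
      then show "adj x y" using \<open>x \<noteq> y\<close> unfolding adj_def by (intro conjI bexI[of _ "{x,y,z}"]) auto
    qed auto
    then show ?thesis by (intro base less.prems)
  next
    case False
    then obtain x y where xy: "x \<in> ?S" "y \<in> ?S" "x \<noteq> y" "\<And>z. z \<in> ?S \<Longrightarrow> {x, y, z} \<notin> E" by blast
    have main: "Q w" if uv: "u \<in> ?S" "v \<in> ?S" "u \<noteq> v" "\<And>z. z \<in> ?S \<Longrightarrow> {u, v, z} \<notin> E"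
      "link w V V u \<le> link w V V v" for u v
    proof (rule step[of w u v])
      let ?w = "shift w u v (w u)"
      have wu: "0 \<le> w u" using less.prems uv(1) by simp
      \<comment> \<open>\<open>u\<close> loses all its weight and \<open>v\<close> already had some,
        so the support strictly shrinks.\<close>
      have "{x \<in> V. ?w x \<noteq> 0} \<subset> ?S" using uv(1,2,3) by (auto simp: shift_def split: if_splits)
      then have "card {x \<in> V. ?w x \<noteq> 0} < card ?S" by (intro psubset_card_mono) auto
      then show "Q ?w" by (rule less.hyps) (intro shift_nonneg less.prems wu order_refl uv(3))
    qed (use uv less.prems in auto)
    show ?thesis
    proof (cases "link w V V x \<le> link w V V y")
      case True then show ?thesis using main[of x y] xy by blast
    next
      case False
      have "\<And>z. z \<in> ?S \<Longrightarrow> {y, x, z} \<notin> E" using xy(4) by (simp add: insert_commute)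
      then show ?thesis using main[of y x] xy False by fastforce
    qed
  qed
qed

lemma link_cls:
  assumes "finite X" "finite K" "c ` X \<subseteq> K"
  shows "link w X X v = (\<Sum>j\<in>K. \<Sum>k\<in>K. link w (cls X c j) (cls X c k) v)"
proof -
  have "link w X X v = (\<Sum>j\<in>K. \<Sum>y\<in>cls X c j. \<Sum>z\<in>X. edge v y z * (w y * w z))"
    unfolding link_def by (rule sum_cls[OF assms])
  also have "\<dots> = (\<Sum>j\<in>K. \<Sum>y\<in>cls X c j. \<Sum>k\<in>K. \<Sum>z\<in>cls X c k. edge v y z * (w y * w z))"
    by (intro sum.cong refl sum_cls[OF assms])
  also have "\<dots> = (\<Sum>j\<in>K. \<Sum>k\<in>K. link w (cls X c j) (cls X c k) v)"
    unfolding link_def by (intro sum.cong refl sum.swap)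
  finally show ?thesis .
qed

lemma hom_link_le:
  assumes "hom K pat c X" "x \<in> X" and w: "\<And>x. x \<in> X \<Longrightarrow> 0 \<le> w x"
  shows "link w (cls X c j) (cls X c k) x \<le>
    of_bool (pat (c x) j k) * (sum w (cls X c j) * sum w (cls X c k))"
proof (cases "pat (c x) j k")
  case True then show ?thesis using link_le[of "cls X c j" "cls X c k" w x] w by auto
next
  case False
  then have "link w (cls X c j) (cls X c k) x = 0"
    using assms(1,2) unfolding link_def hom_def by (intro sum.neutral ballI) (auto simp: edge_def)
  then show ?thesis using False by simp
qed

lemma hom_deg_le:
  assumes "hom K pat c X" "finite X" "finite K" "x \<in> X" and w: "\<And>x. x \<in> X \<Longrightarrow> 0 \<le> w x"
  shows "link w X X x \<le> pdeg K pat (\<lambda>j. sum w (cls X c j)) (c x)"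
  using assms unfolding pdeg_def link_cls[OF assms(2,3), of c w x, OF conjunct1[OF assms(1)[unfolded hom_def]]]
  by (intro sum_mono hom_link_le)

text \<open>A coloured 3-graph is at most as dense as the complete blow-up of its pattern, which
  leaves a polynomial in the class weights.\<close>

lemma hom_lag_le:
  assumes "hom K pat c X" "finite X" "finite K" and w: "\<And>x. x \<in> X \<Longrightarrow> 0 \<le> w x"
  shows "lag X w \<le> (\<Sum>i\<in>K. sum w (cls X c i) * pdeg K pat (\<lambda>j. sum w (cls X c j)) i)"
proof -
  let ?W = "\<lambda>j. sum w (cls X c j)"
  have cK: "c ` X \<subseteq> K" using assms(1) by (simp add: hom_def)
  have "lag X w \<le> (\<Sum>x\<in>X. w x * pdeg K pat ?W (c x))"
    unfolding tri_link by (intro sum_mono mult_left_mono hom_deg_le assms) auto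
  also have "\<dots> = (\<Sum>i\<in>K. \<Sum>x\<in>cls X c i. w x * pdeg K pat ?W (c x))"
    by (rule sum_cls[OF assms(2,3) cK])
  also have "\<dots> = (\<Sum>i\<in>K. ?W i * pdeg K pat ?W i)"
    unfolding sum_distrib_right by (intro sum.cong refl) simp
  finally show ?thesis .
qed

lemma good_lag_le:
  assumes "good X" "finite X" and w: "\<And>x. x \<in> X \<Longrightarrow> 0 \<le> w x"
  shows "lag X w \<le> 4 / 9 * (sum w X)^3"
proof -
  consider c where "hom {0, 1} pat1 c X" | c where "hom {1..6} pat2 c X"
    using assms(1) by (auto simp: good_def)
  then show ?thesis
  proof cases
    case (1 c)
    let ?W = "\<lambda>j. sum w (cls X c j)"
    have "lag X w \<le> (\<Sum>i\<in>{0, 1}. ?W i * pdeg {0, 1} pat1 ?W i)"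
      by (rule hom_lag_le[OF 1 assms(2) _ w]) auto
    also have "\<dots> = 3 * ?W 0 * (?W 1)^2"
      by (simp add: pdeg_pat1 pdeg_pat1[unfolded One_nat_def] power2_eq_square)
    also have "\<dots> \<le> 4 / 9 * (?W 0 + ?W 1)^3" by (rule cubic_le) (auto intro!: sum_nonneg w)
    also have "?W 0 + ?W 1 = sum w X" 
      using sum_cls[OF assms(2), of "{0,1}" c w] 1 by (simp add: hom_def)
    finally show ?thesis .
  next
    case (2 c)
    let ?W = "\<lambda>j. sum w (cls X c j)"
    have "lag X w \<le> (\<Sum>i\<in>{1..6}. ?W i * pdeg {1..6} pat2 ?W i)"
      by (rule hom_lag_le[OF 2 assms(2) _ w]) auto
    also have "\<dots> = G62_poly ?W" by (rule sum_pdeg_pat2)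
    also have "\<dots> \<le> 4 / 9 * (\<Sum>i\<in>{1..6}. ?W i)^3" by (rule G62_poly_le) (auto intro!: sum_nonneg w)
    also have "(\<Sum>i\<in>{1..6}. ?W i) = sum w X" 
      using sum_cls[OF assms(2), of "{1..6}" c w] 2 by (simp add: hom_def)
    finally show ?thesis .
  qed
qed

lemma lag_support: "lag V w = lag {x \<in> V. w x \<noteq> 0} w"
proof -
  let ?S = "{x \<in> V. w x \<noteq> 0}"
  have *: "link w V V x = link w ?S ?S x" for x
  proof -
    have "link w V V x = (\<Sum>y\<in>?S. \<Sum>z\<in>V. edge x y z * (w y * w z))"
      unfolding link_def by (rule sum.mono_neutral_right) auto
    also have "\<dots> = link w ?S ?S x"
      unfolding link_def by (intro sum.cong refl sum.mono_neutral_right) auto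
    finally show ?thesis .
  qed
  show ?thesis unfolding tri_link * by (rule sum.mono_neutral_right) auto
qed

lemma lag_le:
  assumes "\<And>x. x \<in> V \<Longrightarrow> 0 \<le> w x"
  shows "lag V w \<le> 4 / 9 * (sum w V)^3"
  using assms
proof (rule symmetrization_induct)
  fix w assume w: "\<And>x. x \<in> V \<Longrightarrow> 0 \<le> (w x :: real)" and "good {x \<in> V. w x \<noteq> 0}"
  then have "lag {x \<in> V. w x \<noteq> 0} w \<le> 4 / 9 * (sum w {x \<in> V. w x \<noteq> 0})^3"
    by (intro good_lag_le) auto
  moreover have "sum w {x \<in> V. w x \<noteq> 0} = sum w V" by (rule sum.mono_neutral_left) auto
  ultimately show "lag V w \<le> 4 / 9 * (sum w V)^3" using lag_support[of w] by simp
next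
  fix w u v
  assume w: "\<And>x. x \<in> V \<Longrightarrow> 0 \<le> (w x :: real)" and uv: "u \<in> V" "v \<in> V" "u \<noteq> v"
    and no: "\<And>z. z \<in> V \<Longrightarrow> w z \<noteq> 0 \<Longrightarrow> {u, v, z} \<notin> E" and le: "link w V V u \<le> link w V V v"
    and IH: "lag V (shift w u v (w u)) \<le> 4 / 9 * (sum (shift w u v (w u)) V)^3"
  have "lag V w \<le> lag V (shift w u v (w u))"
    using lag_shift[OF uv no, of w "w u"] w[OF uv(1)] le by simp
  then show "lag V w \<le> 4 / 9 * (sum w V)^3" using IH sum_shift[OF uv(1,2)] by simp
qed

text \<open>Deleting weight \<open>t\<close> from \<open>Z\<close> costs at most
  \<open>3 * t * (4 / 9 - \<theta>)\<close> of \<open>lag\<close>, whereas \<open>lag_le\<close>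
  forces a drop of about \<open>4 / 3 * t\<close> less the deficiency \<open>\<delta>\<close>.
  Comparing the two bounds \<open>t * \<theta>\<close> by \<open>\<delta>\<close>.\<close>

lemma low_degree_weight:
  assumes w: "\<And>x. x \<in> V \<Longrightarrow> 0 \<le> w x" "sum w V = 1" and lag: "4 / 9 - \<delta> \<le> lag V w"
    and Z: "Z \<subseteq> V" "\<And>x. x \<in> Z \<Longrightarrow> link w V V x \<le> 4 / 9 - \<theta>" and \<theta>: "0 < \<theta>" "\<delta> < \<theta>^2"
  shows "sum w Z \<le> \<delta> / \<theta>"
proof (cases "sum w Z = 0")
  case True
  have "0 \<le> \<delta>" using lag lag_le[of w] w by simp
  then show ?thesis using True \<theta> by simp
next
  case False
  define z where "z = sum w Z"
  have z0: "0 < z" using False w(1) Z(1) by (metis z_def sum_nonneg subsetD order_less_le)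
  have z1: "z \<le> 1" unfolding z_def w(2)[symmetric] by (rule sum_mono2) (use Z w in auto)
  \<comment> \<open>The cap at \<open>\<theta>\<close> lets \<open>t * \<theta>\<close> absorb the
    quadratic term; \<open>\<delta> < \<theta>^2\<close> shows afterwards that the cap is not
    reached, so \<open>t = z\<close>.\<close>
  define t where "t = min z \<theta>"
  have t: "0 < t" "t \<le> z" "t \<le> \<theta>" "t \<le> 1" using z0 z1 \<theta> by (auto simp: t_def)
  define g where "g x = (if x \<in> Z then t / z * w x else 0)" for x
  have gw: "0 \<le> g x" "g x \<le> w x" if "x \<in> V" for x
  proof -
    have "t / z * w x \<le> 1 * w x" using w(1)[OF that] t z0 by (intro mult_right_mono) auto
    then show "0 \<le> g x" "g x \<le> w x" using w(1)[OF that] t z0 by (auto simp: g_def)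
  qed
  have gs: "(\<Sum>x\<in>V. g x * F x) = t / z * (\<Sum>x\<in>Z. w x * F x)" for F
  proof -
    have "(\<Sum>x\<in>V. g x * F x) = (\<Sum>x\<in>Z. g x * F x)"
      by (rule sum.mono_neutral_right) (use Z(1) in \<open>auto simp: g_def\<close>)
    also have "\<dots> = t / z * (\<Sum>x\<in>Z. w x * F x)"
      unfolding sum_distrib_left by (intro sum.cong refl) (simp add: g_def)
    finally show ?thesis .
  qed
  have sg: "sum g V = t" using gs[of "\<lambda>_. 1"] z0 by (simp add: z_def)
  have "tri V g w w \<le> t * (4 / 9 - \<theta>)"
  proof -
    have "(\<Sum>x\<in>Z. w x * link w V V x) \<le> (\<Sum>x\<in>Z. w x * (4 / 9 - \<theta>))"
      using w(1) Z by (intro sum_mono mult_left_mono) auto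
    also have "\<dots> = z * (4 / 9 - \<theta>)" by (simp add: z_def sum_distrib_right)
    finally have "t / z * (\<Sum>x\<in>Z. w x * link w V V x) \<le> t / z * (z * (4 / 9 - \<theta>))"
      using t z0 by (intro mult_left_mono) auto
    then show ?thesis unfolding tri_link gs using z0 by simp
  qed
  moreover have "tri V g g g \<le> tri V g g w" "0 \<le> tri V g g g"
    using gw by (auto intro!: tri_mono3 tri_nonneg)
  moreover have "lag V (\<lambda>x. w x + (- 1) * g x) = lag V w - 3 * tri V g w w + 3 * tri V g g w - tri V g g g"
    unfolding lag_expand by simp
  moreover have "lag V (\<lambda>x. w x + (- 1) * g x) \<le> 4 / 9 * (1 - t)^3"
    using lag_le[of "\<lambda>x. w x + (- 1) * g x"] gw w(2) sg by (simp add: sum_subtractf)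
  moreover have "4 / 9 * (1 - t)^3 = 4 / 9 - 4 / 3 * t + 4 / 3 * t * t - 4 / 9 * (t * t * t)"
    by (simp add: field_simps power3_eq_cube)
  ultimately have "3 * (t * \<theta>) \<le> \<delta> + 4 / 3 * (t * t) - 4 / 9 * (t * t * t)"
    using lag by (simp add: algebra_simps)
  moreover have "t * t \<le> t * \<theta>" using t by (intro mult_left_mono) auto
  moreover have "0 \<le> t * t * t" "0 \<le> t * \<theta>" using t \<theta> by auto
  ultimately have t\<theta>: "t * \<theta> \<le> \<delta>" by linarith
  then have "t * \<theta> < \<theta> * \<theta>" using \<theta>(2) by (simp add: power2_eq_square)
  then have "t < \<theta>" using \<theta> by simp
  then have "t = z" by (simp add: t_def)
  then show ?thesis using t\<theta> \<theta> by (simp add: z_def field_simps)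
qed

section \<open>Choosing vertices at random\<close>

text \<open>A sum over non-edges: for nonnegative weights the missing weight can only shrink with
  \<open>A\<close> and \<open>B\<close>, which carries bounds from whole classes to subsets.\<close>

lemma miss_eq: "sum w A * sum w B - link w A B v = (\<Sum>y\<in>A. \<Sum>z\<in>B. (1 - edge v y z) * (w y * w z))"
  unfolding link_def sum_product sum_subtractf[symmetric] by (intro sum.cong refl) (simp add: algebra_simps)

lemma miss_mono:
  assumes "A \<subseteq> A'" "B \<subseteq> B'" "finite A'" "finite B'" "\<And>x. x \<in> A' \<union> B' \<Longrightarrow> 0 \<le> w x"
  shows "sum w A * sum w B - link w A B v \<le> sum w A' * sum w B' - link w A' B' v"
proof -
  have "(\<Sum>y\<in>A. \<Sum>z\<in>B. (1 - edge v y z) * (w y * w z)) \<le> (\<Sum>y\<in>A. \<Sum>z\<in>B'. (1 - edge v y z) * (w y * w z))"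
  proof (rule sum_mono)
    fix y assume "y \<in> A"
    then show "(\<Sum>z\<in>B. (1 - edge v y z) * (w y * w z)) \<le> (\<Sum>z\<in>B'. (1 - edge v y z) * (w y * w z))"
      using assms by (intro sum_mono2) auto
  qed
  also have "\<dots> \<le> (\<Sum>y\<in>A'. \<Sum>z\<in>B'. (1 - edge v y z) * (w y * w z))"
    by (intro sum_mono2 sum_nonneg) (use assms in auto)
  finally show ?thesis by (simp add: miss_eq)
qed

text \<open>Indices in \<open>D\<close> stand for prescribed vertices, which may have weight zero; every
  required edge contains at most one of them, in first position.\<close>

lemma choose_edges:
  assumes I: "finite I" and P: "\<And>i. i \<in> I \<Longrightarrow> P i \<subseteq> V" "\<And>i. i \<in> I \<Longrightarrow> P i \<noteq> {}"
    and w: "\<And>x. x \<in> V \<Longrightarrow> 0 \<le> w x" and pos: "\<And>i. i \<in> I \<Longrightarrow> i \<notin> D \<Longrightarrow> 0 < sum w (P i)"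
    and T: "finite T" "real (card T) * \<beta> < 1"
    and ijk: "\<And>i j k. (i, j, k) \<in> T \<Longrightarrow> i \<in> I \<and> j \<in> I \<and> k \<in> I \<and> i \<noteq> j \<and> i \<noteq> k \<and> j \<noteq> k \<and> j \<notin> D \<and> k \<notin> D"
    and miss: "\<And>i j k x. (i, j, k) \<in> T \<Longrightarrow> x \<in> P i \<Longrightarrow>
      sum w (P j) * sum w (P k) - link w (P j) (P k) x \<le> \<beta> * (sum w (P j) * sum w (P k))"
  obtains g where "\<And>i. i \<in> I \<Longrightarrow> g i \<in> P i" "\<And>i j k. (i, j, k) \<in> T \<Longrightarrow> {g i, g j, g k} \<in> E"
proof -
  define p where "p i = (SOME x. x \<in> P i)" for i
  have p: "p i \<in> P i" if "i \<in> I" for i using P(2)[OF that] by (simp add: p_def some_in_eq)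
  \<comment> \<open>Prescribed indices get a point mass at an element of \<open>P i\<close>, so
    their total mass is positive even if the weight there is zero.\<close>
  define \<nu> where "\<nu> i = (if i \<in> D then \<lambda>x. of_bool (x = p i) else w)" for i
  have fP: "finite (P i)" if "i \<in> I" for i using P(1)[OF that] finite_V finite_subset by blast
  have nn: "0 \<le> \<nu> i x" if "i \<in> I" "x \<in> P i" for i x using that P(1) w by (auto simp: \<nu>_def)
  have "\<exists>g\<in>Pi\<^sub>E I P. \<forall>(i, j, k)\<in>T. {g i, g j, g k} \<in> E"
  proof (rule union_bound_choice[where \<nu> = \<nu> and \<beta> = \<beta>, OF I fP nn _ T])
    show "0 < sum (\<nu> l) (P l)" if "l \<in> I" for l
      using pos[OF that] p[OF that] fP[OF that] by (auto simp: \<nu>_def of_bool_def)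
    show "i \<in> I \<and> j \<in> I \<and> k \<in> I \<and> i \<noteq> j \<and> i \<noteq> k \<and> j \<noteq> k" if "(i, j, k) \<in> T" for i j k
      using ijk[OF that] by blast
    fix i j k assume t: "(i, j, k) \<in> T"
    note d = ijk[OF t]
    have "(\<Sum>x\<in>P i. \<Sum>y\<in>P j. \<Sum>z\<in>P k. \<nu> i x * \<nu> j y * \<nu> k z * of_bool ({x, y, z} \<notin> E)) =
       (\<Sum>x\<in>P i. \<nu> i x * (sum w (P j) * sum w (P k) - link w (P j) (P k) x))"
      unfolding miss_eq unfolding sum_distrib_left using d
      by (intro sum.cong refl) (simp add: \<nu>_def edge_def)
    also have "\<dots> \<le> (\<Sum>x\<in>P i. \<nu> i x * (\<beta> * (sum w (P j) * sum w (P k))))"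
      using d by (intro sum_mono mult_left_mono miss[OF t] nn) auto
    also have "\<dots> = \<beta> * (sum (\<nu> i) (P i) * sum (\<nu> j) (P j) * sum (\<nu> k) (P k))"
      using d unfolding sum_distrib_right[symmetric] by (simp add: \<nu>_def)
    finally show "(\<Sum>x\<in>P i. \<Sum>y\<in>P j. \<Sum>z\<in>P k. \<nu> i x * \<nu> j y * \<nu> k z * of_bool ({x, y, z} \<notin> E)) \<le>
      \<beta> * (sum (\<nu> i) (P i) * sum (\<nu> j) (P j) * sum (\<nu> k) (P k))" .
  qed auto
  then obtain g where "g \<in> Pi\<^sub>E I P" "\<forall>(i, j, k)\<in>T. {g i, g j, g k} \<in> E" by blast
  then show ?thesis by (intro that[of g]) auto
qed

text \<open>The deficits \<open>m j k\<close> are all nonnegative and add up to \<open>pdeg\<close>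
  minus \<open>link\<close>, so each is bounded by the total. The 72 comes from at most 36 pairs of
  classes, each with error \<open>2 * \<eta>\<close> when class weights are replaced by
  \<open>\<alpha>\<close>.\<close>

lemma hom_miss_le:
  assumes hom: "hom K pat c X" and fin: "finite X" "finite K" "card K \<le> 6"
    and w: "\<And>x. x \<in> X \<Longrightarrow> 0 \<le> w x" "sum w X \<le> 1"
    and \<alpha>: "\<And>j. j \<in> K \<Longrightarrow> \<bar>sum w (cls X c j) - \<alpha> j\<bar> \<le> \<eta>" "\<And>j. j \<in> K \<Longrightarrow> 0 \<le> \<alpha> j \<and> \<alpha> j \<le> 1"
      "\<And>i. i \<in> K \<Longrightarrow> pdeg K pat \<alpha> i \<le> 4 / 9" "0 \<le> \<eta>"
    and x: "x \<in> X" "4 / 9 - \<sigma> \<le> link w X X x" and jk: "j \<in> K" "k \<in> K" "pat (c x) j k"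
  shows "sum w (cls X c j) * sum w (cls X c k) - link w (cls X c j) (cls X c k) x \<le> \<sigma> + 72 * \<eta>"
proof -
  let ?W = "\<lambda>j. sum w (cls X c j)"
  have cK: "c ` X \<subseteq> K" using hom by (simp add: hom_def)
  define m where "m j k = of_bool (pat (c x) j k) * (?W j * ?W k) - link w (cls X c j) (cls X c k) x" for j k
  have m0: "0 \<le> m j k" for j k using hom_link_le[OF hom x(1), of w j k] w(1) by (simp add: m_def)
  have W1: "0 \<le> ?W j" "?W j \<le> 1" for j
  proof -
    show "0 \<le> ?W j" by (rule sum_nonneg) (use w in auto)
    have "?W j \<le> sum w X" by (rule sum_mono2) (use fin w in auto)
    then show "?W j \<le> 1" using w(2) by simp
  qed
  have term_le: "of_bool (pat (c x) j k) * (?W j * ?W k) \<le> of_bool (pat (c x) j k) * (\<alpha> j * \<alpha> k) + 2 * \<eta>"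
    if "j \<in> K" "k \<in> K" for j k
  proof -
    have "?W j * ?W k - \<alpha> j * \<alpha> k = (?W j - \<alpha> j) * ?W k + \<alpha> j * (?W k - \<alpha> k)" by (simp add: algebra_simps)
    also have "\<dots> \<le> \<eta> * 1 + 1 * \<eta>"
    proof (rule add_mono)
      have "(?W j - \<alpha> j) * ?W k \<le> \<eta> * ?W k" using \<alpha>(1)[OF that(1)] W1 by (intro mult_right_mono) auto
      also have "\<dots> \<le> \<eta> * 1" using W1 \<alpha>(4) by (intro mult_left_mono) auto
      finally show "(?W j - \<alpha> j) * ?W k \<le> \<eta> * 1" .
      have "\<alpha> j * (?W k - \<alpha> k) \<le> \<alpha> j * \<eta>" using \<alpha>(1)[OF that(2)] \<alpha>(2)[OF that(1)] by (intro mult_left_mono) auto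
      also have "\<dots> \<le> 1 * \<eta>" using \<alpha>(2)[OF that(1)] \<alpha>(4) by (intro mult_right_mono) auto
      finally show "\<alpha> j * (?W k - \<alpha> k) \<le> 1 * \<eta>" .
    qed
    finally show ?thesis using \<alpha>(4) by (cases "pat (c x) j k") auto
  qed
  have "m j k \<le> (\<Sum>k\<in>K. m j k)" by (rule member_le_sum) (use jk fin m0 in auto)
  also have "\<dots> \<le> (\<Sum>j\<in>K. \<Sum>k\<in>K. m j k)" by (rule member_le_sum[where f = "\<lambda>j. \<Sum>k\<in>K. m j k"]) (use jk fin m0 in \<open>auto intro: sum_nonneg\<close>)
  also have "\<dots> = pdeg K pat ?W (c x) - link w X X x"
    unfolding m_def pdeg_def link_cls[OF fin(1,2) cK] by (simp add: sum_subtractf)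
  also have "pdeg K pat ?W (c x) \<le> (\<Sum>j\<in>K. \<Sum>k\<in>K. of_bool (pat (c x) j k) * (\<alpha> j * \<alpha> k) + 2 * \<eta>)"
    unfolding pdeg_def by (intro sum_mono term_le)
  also have "\<dots> = pdeg K pat \<alpha> (c x) + real (card K * card K) * (2 * \<eta>)"
    unfolding pdeg_def by (simp add: sum.distrib)
  also have "\<dots> \<le> 4 / 9 + real (6 * 6) * (2 * \<eta>)"
    using \<alpha>(3)[of "c x"] cK x(1) \<alpha>(4) of_nat_mono[OF mult_le_mono[OF fin(3,3)], where ?'a = real]
    by (intro add_mono mult_right_mono) auto
  finally show ?thesis using x(2) jk(3) by (simp add: m_def)
qed

end

section \<open>Extending a colouring by one vertex\<close>

text \<open>The constants are only required to be small enough one after the other: the near-extremal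
  degrees force every class weight up to \<open>3 / 10^20\<close>, so a vertex misses at most \<open>1 / 10^17\<close> of
  the pairs prescribed by its colour, which is at most a thousandth of the pairs between any two
  sets of weight \<open>1 / 10^7\<close>.\<close>

locale extension = M_free_graph +
  fixes X :: "nat set" and w :: "nat \<Rightarrow> real" and v :: nat
  assumes XV: "X \<subseteq> V" and vV: "v \<in> V" and vX: "v \<notin> X"
    and w_nonneg: "\<And>x. x \<in> V \<Longrightarrow> 0 \<le> w x"
    and w_le: "sum w X \<le> 1" and w_ge: "1 - 1 / 10^41 \<le> sum w X"
    and deg_ge: "\<And>x. x \<in> insert v X \<Longrightarrow> 4 / 9 - 1 / 10^41 \<le> link w X X x"
begin

lemma finite_X [simp]: "finite X"
  using XV finite_V finite_subset by blast

lemma w_nonneg_X: "x \<in> X \<Longrightarrow> 0 \<le> w x"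
  using XV w_nonneg by auto

text \<open>Stated with a square because the stability lemmas take the square root of the deficiency
  as their parameter.\<close>

lemma lag_X_ge: "4 / 9 - (1 / 10^20)^2 \<le> lag X w"
proof -
  have "(4 / 9 - 1 / 10^41) * (1 - 1 / 10^41) \<le> (4 / 9 - 1 / 10^41) * sum w X"
    using w_ge by (intro mult_left_mono) auto
  also have "\<dots> = (\<Sum>x\<in>X. w x * (4 / 9 - 1 / 10^41))" by (simp only: sum_distrib_right[symmetric] mult.commute)
  also have "\<dots> \<le> lag X w" unfolding tri_link
    by (intro sum_mono mult_left_mono) (use deg_ge w_nonneg_X in auto)
  finally show ?thesis by (simp add: power_divide)
qed

lemma sum_sub_nonneg: "A \<subseteq> X \<Longrightarrow> 0 \<le> sum w A"
  by (rule sum_nonneg) (use w_nonneg_X in auto)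

lemma sum_sub_le_1: "A \<subseteq> X \<Longrightarrow> sum w A \<le> 1"
  by (rule order_trans[OF sum_mono2 w_le]) (use w_nonneg_X in auto)

lemma semibip_weights:
  assumes "hom {0, 1} pat1 c X"
  shows "\<bar>sum w (cls X c 0) - 1 / 3\<bar> \<le> 1 / 10^20" "\<bar>sum w (cls X c 1) - 2 / 3\<bar> \<le> 1 / 10^20"
proof -
  let ?W = "\<lambda>j. sum w (cls X c j)"
  have "lag X w \<le> (\<Sum>i\<in>{0, 1}. ?W i * pdeg {0, 1} pat1 ?W i)"
    by (rule hom_lag_le[OF assms finite_X]) (use w_nonneg_X in auto)
  also have "\<dots> = 3 * ?W 0 * (?W 1)^2"
    by (simp add: pdeg_pat1 pdeg_pat1[unfolded One_nat_def] power2_eq_square)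
  finally have "4 / 9 - (1 / 10^20)^2 \<le> 3 * ?W 0 * (?W 1)^2" using lag_X_ge by (rule order_trans[rotated])
  moreover have "?W 0 + ?W 1 \<le> 1"
    using sum_cls[OF finite_X, of "{0,1}" c w] assms w_le by (simp add: hom_def)
  ultimately show "\<bar>?W 0 - 1 / 3\<bar> \<le> 1 / 10^20" "\<bar>?W 1 - 2 / 3\<bar> \<le> 1 / 10^20"
    by (intro cubic_stable; auto intro!: sum_sub_nonneg)+
qed

lemma G62_weights:
  assumes "hom {1..6} pat2 c X" "i \<in> {1..6}"
  shows "\<bar>sum w (cls X c i) - 1 / 6\<bar> \<le> 3 * (1 / 10^20)"
proof -
  let ?W = "\<lambda>j. sum w (cls X c j)"
  have "lag X w \<le> (\<Sum>i\<in>{1..6}. ?W i * pdeg {1..6} pat2 ?W i)"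
    by (rule hom_lag_le[OF assms(1) finite_X]) (use w_nonneg_X in auto)
  also have "\<dots> = G62_poly ?W" by (rule sum_pdeg_pat2)
  finally have "4 / 9 - (1 / 10^20)^2 \<le> G62_poly ?W" using lag_X_ge by (rule order_trans[rotated])
  moreover have "(\<Sum>i\<in>{1..6}. ?W i) \<le> 1"
    using sum_cls[OF finite_X, of "{1..6}" c w] assms w_le by (simp add: hom_def)
  ultimately show ?thesis
    by (intro G62_poly_stable[where W = ?W]) (use assms(2) in \<open>auto intro!: sum_sub_nonneg\<close>)
qed

lemma semibip_miss:
  assumes hom: "hom {0, 1} pat1 c X" and x: "x \<in> X" and jk: "pat1 (c x) j k"
  shows "sum w (cls X c j) * sum w (cls X c k) - link w (cls X c j) (cls X c k) x \<le> 1 / 10^17"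
proof -
  define \<alpha> :: "nat \<Rightarrow> real" where "\<alpha> j = (if j = 0 then 1 / 3 else 2 / 3)" for j
  have "sum w (cls X c j) * sum w (cls X c k) - link w (cls X c j) (cls X c k) x \<le> 1 / 10^41 + 72 * (1 / 10^20)"
  proof (rule hom_miss_le[OF hom finite_X, where \<alpha> = \<alpha>])
    show "\<bar>sum w (cls X c j) - \<alpha> j\<bar> \<le> 1 / 10^20" if "j \<in> {0, 1}" for j
      using that semibip_weights[OF hom] by (auto simp: \<alpha>_def)
    show "pdeg {0, 1} pat1 \<alpha> i \<le> 4 / 9" if "i \<in> {0, 1}" for i
      using that by (auto simp: pdeg_pat1 pdeg_pat1[unfolded One_nat_def] \<alpha>_def)
    show "j \<in> {0, 1}" "k \<in> {0, 1}" using jk by (auto simp: pat1_def)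
  qed (use w_le w_nonneg_X x jk deg_ge in \<open>auto simp: \<alpha>_def\<close>)
  then show ?thesis by simp
qed

lemma G62_miss:
  assumes hom: "hom {1..6} pat2 c X" and x: "x \<in> X" and jk: "pat2 (c x) j k"
  shows "sum w (cls X c j) * sum w (cls X c k) - link w (cls X c j) (cls X c k) x \<le> 1 / 10^17"
proof -
  have "sum w (cls X c j) * sum w (cls X c k) - link w (cls X c j) (cls X c k) x \<le> 1 / 10^41 + 72 * (3 * (1 / 10^20))"
  proof (rule hom_miss_le[OF hom finite_X, where \<alpha> = "\<lambda>_. 1 / 6"])
    show "\<bar>sum w (cls X c j) - 1 / 6\<bar> \<le> 3 * (1 / 10^20)" if "j \<in> {1..6}" for j
      by (rule G62_weights[OF hom that])
    show "pdeg {1..6} pat2 (\<lambda>_. 1 / 6) i \<le> 4 / 9" if "i \<in> {1..6}" for i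
      using pdeg_pat2_sixth[OF that] by simp
    show "j \<in> {1..6}" "k \<in> {1..6}" using pat2_range[OF jk] by auto
  qed (use w_le w_nonneg_X x jk deg_ge in auto)
  then show ?thesis by simp
qed

lemma relative_miss:
  assumes "sum w A' * sum w B' - link w A' B' x \<le> 1 / 10^17" "A \<subseteq> A'" "B \<subseteq> B'" "A' \<subseteq> X" "B' \<subseteq> X"
    and "1 / 10^7 \<le> sum w A" "1 / 10^7 \<le> sum w B"
  shows "sum w A * sum w B - link w A B x \<le> 1 / 1000 * (sum w A * sum w B)"
proof -
  have "sum w A * sum w B - link w A B x \<le> sum w A' * sum w B' - link w A' B' x"
    by (rule miss_mono) (use assms w_nonneg_X finite_subset[OF _ finite_X] in auto)
  also have "\<dots> \<le> 1 / 1000 * (1 / 10^7 * (1 / 10^7))" using assms(1) by simp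
  also have "\<dots> \<le> 1 / 1000 * (sum w A * sum w B)"
    using assms(6,7) by (intro mult_left_mono mult_mono) auto
  finally show ?thesis .
qed

text \<open>Eight indices allow at most 8^3 = 512 required edges, each failing at rate at most 1 /
  1000.\<close>

lemma pick:
  assumes I: "I \<subseteq> {..7::nat}" and P: "\<And>i. i \<in> I \<Longrightarrow> P i \<subseteq> V" "\<And>i. i \<in> I \<Longrightarrow> i \<in> D \<Longrightarrow> P i \<noteq> {}"
    and pos: "\<And>i. i \<in> I \<Longrightarrow> i \<notin> D \<Longrightarrow> 1 / 10^7 \<le> sum w (P i)"
    and ijk: "\<And>i j k. (i, j, k) \<in> T \<Longrightarrow> i \<in> I \<and> j \<in> I \<and> k \<in> I \<and> i \<noteq> j \<and> i \<noteq> k \<and> j \<noteq> k \<and> j \<notin> D \<and> k \<notin> D"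
    and miss: "\<And>i j k x. (i, j, k) \<in> T \<Longrightarrow> x \<in> P i \<Longrightarrow>
      sum w (P j) * sum w (P k) - link w (P j) (P k) x \<le> 1 / 1000 * (sum w (P j) * sum w (P k))"
  obtains g where "\<And>i. i \<in> I \<Longrightarrow> g i \<in> P i" "\<And>i j k. (i, j, k) \<in> T \<Longrightarrow> {g i, g j, g k} \<in> E"
proof -
  have "T \<subseteq> {..7} \<times> {..7} \<times> {..7}" using ijk I by fastforce
  note sub = this
  have fT: "finite T" by (rule finite_subset[OF sub]) simp
  have "card T \<le> card ({..7::nat} \<times> {..7::nat} \<times> {..7::nat})" by (rule card_mono[OF _ sub]) simp
  then have "real (card T) \<le> 512" by (simp add: card_cartesian_product)
  then have cT: "real (card T) * (1 / 1000) < 1" by simp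
  have fI: "finite I" using finite_subset[OF I] by simp
  have pos': "0 < sum w (P i)" if "i \<in> I" "i \<notin> D" for i
    using pos[OF that] by (rule less_le_trans[rotated]) simp
  have ne: "P i \<noteq> {}" if "i \<in> I" for i using P(2)[OF that] pos'[OF that] by (cases "i \<in> D") auto
  show ?thesis by (rule choose_edges[of I P w D T "1 / 1000"]) (fact fI P(1) ne w_nonneg pos' fT cT ijk miss that)+
qed

lemma adjI: "{x, y, z} \<in> E \<Longrightarrow> adj x y \<and> adj y x \<and> adj x z \<and> adj z x \<and> adj y z \<and> adj z y"
  using edge_distinct[of x y z] unfolding adj_def by (auto intro!: bexI[of _ "{x, y, z}"])

text \<open>Vertices chosen from here are adjacent to \<open>v\<close> in advance, so a core
  containing \<open>v\<close> needs no generic edges through \<open>v\<close>.\<close>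

definition nbr :: "(nat \<Rightarrow> nat) \<Rightarrow> nat \<Rightarrow> nat set" where
  "nbr c j = {y \<in> cls X c j. \<exists>z\<in>X. {v, y, z} \<in> E}"

lemma nbr_sub: "nbr c j \<subseteq> cls X c j" "nbr c j \<subseteq> X" "nbr c j \<subseteq> V"
  using XV by (auto simp: nbr_def)

lemma nbr_adj: "y \<in> nbr c j \<Longrightarrow> adj v y \<and> adj y v"
  unfolding nbr_def by (auto dest: adjI)

lemma link_nbr: "link w (cls X c j) (cls X c k) v \<le> sum w (nbr c j) * sum w (nbr c k)"
proof -
  have "link w (cls X c j) (cls X c k) v = (\<Sum>y\<in>nbr c j. \<Sum>z\<in>cls X c k. edge v y z * (w y * w z))"
    unfolding link_def by (rule sum.mono_neutral_right) (auto simp: nbr_def edge_def intro!: sum.neutral)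
  also have "\<dots> = link w (nbr c j) (nbr c k) v"
    unfolding link_def
  proof (rule sum.cong[OF refl])
    fix y assume y: "y \<in> nbr c j"
    show "(\<Sum>z\<in>cls X c k. edge v y z * (w y * w z)) = (\<Sum>z\<in>nbr c k. edge v y z * (w y * w z))"
    proof (rule sum.mono_neutral_right)
      show "\<forall>z\<in>cls X c k - nbr c k. edge v y z * (w y * w z) = 0"
      proof
        fix z assume "z \<in> cls X c k - nbr c k"
        then have "{v, z, y} \<notin> E" using y by (auto simp: nbr_def)
        then have "edge v z y = 0" by (simp add: edge_def)
        then show "edge v y z * (w y * w z) = 0" using edge_swap(2)[of v y z] by simp
      qed
    qed (use nbr_sub in auto)
  qed
  also have "\<dots> \<le> sum w (nbr c j) * sum w (nbr c k)"
    by (rule link_le) (use nbr_sub w_nonneg in blast)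
  finally show ?thesis .
qed

lemma hom_insert:
  assumes hom: "hom K pat c X" and i: "i \<in> K" and sym: "\<And>i j k. pat i j k \<Longrightarrow> pat j i k \<and> pat i k j"
    and new: "\<And>y z. y \<in> X \<Longrightarrow> z \<in> X \<Longrightarrow> {v, y, z} \<in> E \<Longrightarrow> pat i (c y) (c z)"
  shows "hom K pat (c(v := i)) (insert v X)"
  unfolding hom_def
proof (intro conjI ballI impI)
  let ?c = "c(v := i)"
  show "?c ` insert v X \<subseteq> K" using hom i by (auto simp: hom_def)
  have eq: "?c y = c y" if "y \<in> X" for y using that vX by auto
  fix x y z assume xyz: "x \<in> insert v X" "y \<in> insert v X" "z \<in> insert v X" and e: "{x, y, z} \<in> E"
  note d = edge_distinct[OF e]
  consider "x = v" "y \<in> X" "z \<in> X" | "y = v" "x \<in> X" "z \<in> X" | "z = v" "x \<in> X" "y \<in> X" | "x \<in> X" "y \<in> X" "z \<in> X"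
    using xyz d by blast
  then show "pat (?c x) (?c y) (?c z)"
  proof cases
    case 1 then show ?thesis using new[of y z] e eq by simp
  next
    case 2
    then have "{v, x, z} \<in> E" using e by (simp add: insert_commute)
    then have "pat i (c x) (c z)" using new 2 by simp
    then have "pat (c x) i (c z)" by (rule conjunct1[OF sym])
    then show ?thesis using 2 eq by simp
  next
    case 3
    then have "{v, x, y} \<in> E" using e by (simp add: insert_commute)
    then have "pat i (c x) (c y)" using new 3 by simp
    then have "pat (c x) i (c y)" by (rule conjunct1[OF sym])
    then have "pat (c x) (c y) i" by (rule conjunct2[OF sym])
    then show ?thesis using 3 eq by simp
  next
    case 4 then show ?thesis using hom e eq by (simp add: hom_def)
  qed
qed

section \<open>Extending a semibipartite colouring\<close>

lemma semibip_bounds: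
  assumes "hom {0, 1} pat1 c X"
  shows "1 / 4 \<le> sum w (cls X c 0)" "1 / 2 \<le> sum w (cls X c 1)"
  by (rule abs_diff_bounds(1)[OF semibip_weights(1)[OF assms], of _ 1], simp, simp)
    (rule abs_diff_bounds(1)[OF semibip_weights(2)[OF assms], of _ 1], simp, simp)

lemma G62_bounds:
  assumes "hom {1..6} pat2 c X" "i \<in> {1..6}"
  shows "1 / 7 \<le> sum w (cls X c i)" "sum w (cls X c i) \<le> 167 / 1000"
  by (rule abs_diff_bounds[OF G62_weights[OF assms], of _ 1], simp, simp)
    (rule abs_diff_bounds(2)[OF G62_weights[OF assms], of 0], simp, simp)

text \<open>Core: \<open>a1\<close>, \<open>a2\<close> and five generic vertices of class 1. The
  given edge serves only to make \<open>a1\<close> and \<open>a2\<close> adjacent; generic edges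
  through them cover all other pairs and contain two disjoint ones.\<close>

lemma semibip_no_AA:
  assumes hom: "hom {0, 1} pat1 c X" and a: "a1 \<in> cls X c 0" "a2 \<in> cls X c 0" and e: "{v, a1, a2} \<in> E"
  shows False
proof -
  let ?B = "cls X c 1"
  define P where "P i = (if i = 0 then {a1} else if i = 1 then {a2} else ?B)" for i :: nat
  define T :: "(nat \<times> nat \<times> nat) set" where "T = {(a, i, j). a \<in> {0, 1} \<and> i \<in> {2..6} \<and> j \<in> {2..6} \<and> i \<noteq> (j::nat)}"
  have B: "1 / 10^7 \<le> sum w ?B" by (rule order_trans[OF _ semibip_bounds(2)[OF hom]]) simp
  obtain g where g: "\<And>i. i \<in> {0..6} \<Longrightarrow> g i \<in> P i" "\<And>i j k. (i, j, k) \<in> T \<Longrightarrow> {g i, g j, g k} \<in> E"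
  proof (rule pick[of "{0..6}" P "{0, 1}" T])
    show "P i \<subseteq> V" for i using a XV by (auto simp: P_def)
    show "P i \<noteq> {}" if "i \<in> {0, 1}" for i using that by (auto simp: P_def)
    show "1 / 10^7 \<le> sum w (P i)" if "i \<notin> {0, 1}" for i using that B by (simp add: P_def)
    fix i j k x assume t: "(i, j, k) \<in> T" and x: "x \<in> P i"
    then have "P j = ?B" "P k = ?B" "x \<in> cls X c 0" using a by (auto simp: P_def T_def)
    then show "sum w (P j) * sum w (P k) - link w (P j) (P k) x \<le> 1 / 1000 * (sum w (P j) * sum w (P k))"
      using relative_miss[OF semibip_miss[OF hom, of x 1 1] order_refl order_refl] B
      by (auto simp: pat1_def)
  qed (auto simp: T_def)
  have ga: "g 0 = a1" "g 1 = a2" using g(1)[of 0] g(1)[of 1] by (auto simp: P_def)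
  have ee: "{g a, g i, g j} \<in> E" if "a \<in> {0, 1}" "i \<in> {2..6}" "j \<in> {2..6}" "i \<noteq> j" for a i j
    using that g(2) by (simp add: T_def)
  have other: "\<exists>k\<in>{2..6}. k \<noteq> i" for i :: nat
    by (rule bexI[of _ "if i = 2 then 3 else 2"]) auto
  have bb: "adj (g i) (g j)" if "i \<in> {2..6}" "j \<in> {2..6}" "i \<noteq> j" for i j
    using adjI[OF ee[of 0 i j]] that by simp
  have ab: "adj (g a) (g i) \<and> adj (g i) (g a)" if "a \<in> {0, 1}" "i \<in> {2..6}" for a i
    using other[of i] adjI[OF ee[OF that]] by auto
  have ab': "adj (g 0) (g i) \<and> adj (g i) (g 0)" "adj (g 1) (g i) \<and> adj (g i) (g 1)" if "i \<in> {2..6}" for i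
    using ab[OF _ that] by simp_all
  have aa: "adj (g 0) (g 1)" "adj (g 1) (g 0)" using adjI[OF e] ga by auto
  show False
  proof (rule no_core7[of "{0..6}" g 0 2 3 1 4 5])
    show "g i \<in> V" if "i \<in> {0..6}" for i using g(1)[OF that] a XV by (auto simp: P_def split: if_splits)
    show "adj (g i) (g j)" if "i \<in> {0..6}" "j \<in> {0..6}" "i \<noteq> j" for i j
    proof -
      have *: "k \<in> {2..6} \<or> k = 0 \<or> k = 1" if "k \<in> {0..6}" for k :: nat using that by auto
      show ?thesis using *[OF that(1)] *[OF that(2)] that(3) aa ab' bb by metis
    qed
    show "{g 0, g 2, g 3} \<in> E" "{g 1, g 4, g 5} \<in> E" by (rule ee; simp)+
  qed auto
qed

text \<open>Core: \<open>v\<close>, \<open>b1\<close>, \<open>b2\<close>, one generic neighbour of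
  \<open>v\<close> in class 0 and three in class 1. The given edge is disjoint from a generic edge
  on the class 0 vertex and two of the last three.\<close>

lemma semibip_no_BB:
  assumes hom: "hom {0, 1} pat1 c X" and b: "b1 \<in> cls X c 1" "b2 \<in> cls X c 1" and e: "{v, b1, b2} \<in> E"
    and N: "1 / 10^7 \<le> sum w (nbr c 0)" "1 / 10^7 \<le> sum w (nbr c 1)"
  shows False
proof -
  define P where "P i = (if i = 0 then {v} else if i = 1 then nbr c 0 else if i = 2 then {b1}
     else if i = 3 then {b2} else nbr c 1)" for i :: nat
  define T :: "(nat \<times> nat \<times> nat) set" where "T = {(i, a, j). a = (1::nat) \<and> i \<in> {2..6} \<and> j \<in> {4..6} \<and> i \<noteq> (j::nat)}"
  obtain g where g: "\<And>i. i \<in> {0..6} \<Longrightarrow> g i \<in> P i" "\<And>i j k. (i, j, k) \<in> T \<Longrightarrow> {g i, g j, g k} \<in> E"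
  proof (rule pick[of "{0..6}" P "{0, 2, 3}" T])
    show "P i \<subseteq> V" for i using b XV vV nbr_sub(3) by (auto simp: P_def)
    show "P i \<noteq> {}" if "i \<in> {0, 2, 3}" for i using that by (auto simp: P_def)
    show "1 / 10^7 \<le> sum w (P i)" if "i \<notin> {0, 2, 3}" for i using that N by (simp add: P_def)
    fix i j k x assume t: "(i, j, k) \<in> T" and x: "x \<in> P i"
    then have "P j = nbr c 0" "P k = nbr c 1" "x \<in> cls X c 1" using b nbr_sub(1)[of c 1] by (auto simp: P_def T_def split: if_splits)
    then show "sum w (P j) * sum w (P k) - link w (P j) (P k) x \<le> 1 / 1000 * (sum w (P j) * sum w (P k))"
      using relative_miss[OF semibip_miss[OF hom, of x 0 1] nbr_sub(1) nbr_sub(1)] N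
      by (auto simp: pat1_def)
  qed (auto simp: T_def)
  have ga: "g 0 = v" "g 2 = b1" "g 3 = b2" using g(1)[of 0] g(1)[of 2] g(1)[of 3] by (auto simp: P_def)
  have ee: "{g i, g 1, g j} \<in> E" if "i \<in> {2..6}" "j \<in> {4..6}" "i \<noteq> j" for i j
    using that g(2) by (simp add: T_def)
  have gv: "adj v (g i) \<and> adj (g i) v" if i: "i \<in> {1..6}" for i
  proof -
    consider "i = 2" | "i = 3" | "i = 1" | "4 \<le> i" "i \<le> 6" using i by force
    then show ?thesis
    proof cases
      case 3 then show ?thesis using g(1)[of i] nbr_adj by (simp add: P_def)
    next
      case 4 then show ?thesis using g(1)[of i] nbr_adj by (simp add: P_def)
    qed (use adjI[OF e] ga in auto)
  qed
  have other: "\<exists>k\<in>{4..6}. k \<noteq> i" for i :: nat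
    by (rule bexI[of _ "if i = 4 then 5 else 4"]) auto
  have g1: "adj (g 1) (g i) \<and> adj (g i) (g 1)" if "i \<in> {2..6}" for i
    using other[of i] adjI[OF ee[OF that]] by auto
  have gi: "adj (g i) (g j) \<and> adj (g j) (g i)" if "i \<in> {2..6}" "j \<in> {4..6}" "i \<noteq> j" for i j
    using adjI[OF ee[OF that]] by simp
  have g23: "adj (g 2) (g 3)" "adj (g 3) (g 2)" using adjI[OF e] ga by auto
  show False
  proof (rule no_core7[of "{0..6}" g 0 2 3 4 1 5])
    show "g i \<in> V" if "i \<in> {0..6}" for i
      using g(1)[OF that] b XV vV nbr_sub(3) by (auto simp: P_def split: if_splits)
    show "adj (g i) (g j)" if "i \<in> {0..6}" "j \<in> {0..6}" "i \<noteq> j" for i j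
    proof -
      have *: "k = 0 \<or> k = 1 \<or> k = 2 \<or> k = 3 \<or> k \<in> {4..6}" if "k \<in> {0..6}" for k :: nat using that by auto
      have m: "k \<in> {1..6}" "k \<in> {2..6}" if "k \<in> {4..6}" for k :: nat using that by auto
      have m': "1 \<in> {1..6::nat}" "2 \<in> {1..6::nat}" "3 \<in> {1..6::nat}" "2 \<in> {2..6::nat}" "3 \<in> {2..6::nat}" by auto
      have n: "k \<noteq> 2" "k \<noteq> 3" if "k \<in> {4..6}" for k :: nat using that by auto
      show ?thesis using *[OF that(1)] *[OF that(2)] that(3) ga(1) gv g1 gi g23 m m' n by metis
    qed
    show "{g 0, g 2, g 3} \<in> E" using e ga by simp
    show "{g 4, g 1, g 5} \<in> E" by (rule ee) auto
  qed auto
qed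

text \<open>Core: \<open>v\<close>, \<open>a0\<close>, a vertex \<open>b1\<close> and four generic
  vertices forming edges with \<open>v\<close> and \<open>b1\<close>. The edges on \<open>v\<close>,
  \<open>b1\<close>, \<open>g 3\<close> and on \<open>a0\<close>, \<open>g 4\<close>,
  \<open>g 5\<close> are disjoint. The weight of the link provides a \<open>b1\<close> that has
  large codegree with \<open>v\<close> and is adjacent to \<open>a0\<close>.\<close>

lemma semibip_BB_no_A:
  assumes hom: "hom {0, 1} pat1 c X" and L: "1 / 100 \<le> link w (cls X c 1) (cls X c 1) v"
    and a: "a0 \<in> nbr c 0"
  shows False
proof -
  let ?A = "cls X c 0" and ?B = "cls X c 1"
  define N where "N y = {z \<in> ?B. {v, y, z} \<in> E}" for y
  \<comment> \<open>Vertices of class 1 with codegree at least 1 / 10^7 with \<open>v\<close>; the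
    others contribute at most 1 / 10^7 to the link, so \<open>S\<close> is heavy.\<close>
  define S where "S = {y \<in> ?B. 1 / 10^7 \<le> sum w (N y)}"
  have W: "1 / 10^7 \<le> sum w ?A" "1 / 2 \<le> sum w ?B"
    by (rule order_trans[OF _ semibip_bounds(1)[OF hom]], simp) (rule semibip_bounds(2)[OF hom])
  have f: "(\<Sum>z\<in>?B. edge v y z * (w y * w z)) = w y * sum w (N y)" for y
  proof -
    have "(\<Sum>z\<in>?B. edge v y z * (w y * w z)) = (\<Sum>z\<in>N y. edge v y z * (w y * w z))"
      by (rule sum.mono_neutral_right) (auto simp: N_def edge_def)
    also have "\<dots> = w y * sum w (N y)"
      unfolding sum_distrib_left by (rule sum.cong) (auto simp: N_def edge_def)
    finally show ?thesis .
  qed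
  have "link w ?B ?B v = (\<Sum>y\<in>?B. w y * sum w (N y))" unfolding link_def f ..
  also have "\<dots> \<le> (\<Sum>y\<in>?B. (if y \<in> S then w y else 0) + w y * (1 / 10^7))"
  proof (rule sum_mono)
    fix y assume y: "y \<in> ?B"
    then have w: "0 \<le> w y" using w_nonneg_X by auto
    have "w y * sum w (N y) \<le> w y * 1" using w by (intro mult_left_mono sum_sub_le_1) (auto simp: N_def)
    moreover have "w y * sum w (N y) \<le> w y * (1 / 10^7)" if "y \<notin> S"
      using w y that by (intro mult_left_mono) (auto simp: S_def)
    ultimately show "w y * sum w (N y) \<le> (if y \<in> S then w y else 0) + w y * (1 / 10^7)" using w by auto
  qed
  also have "\<dots> = sum w S + sum w ?B * (1 / 10^7)"
    unfolding sum.distrib sum_distrib_right[symmetric]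
    by (simp add: sum.inter_filter[symmetric] S_def conj_ac cong: conj_cong)
  also have "\<dots> \<le> sum w S + 1 * (1 / 10^7)" by (intro add_mono mult_right_mono sum_sub_le_1) auto
  finally have wS: "1 / 200 \<le> sum w S" using L by simp
  have a0: "a0 \<in> X" "c a0 = 0" using a by (auto simp: nbr_def)
  \<comment> \<open>\<open>a0\<close> misses at most 1 / 10^17 of the pairs in class 1, much less
    than there are between \<open>S\<close> and the class.\<close>
  have "\<exists>y\<in>S. \<exists>z\<in>?B. {a0, y, z} \<in> E"
  proof (rule ccontr)
    assume "\<not> ?thesis"
    then have "link w S ?B a0 = 0" unfolding link_def by (intro sum.neutral ballI) (auto simp: edge_def)
    moreover have "sum w S * sum w ?B - link w S ?B a0 \<le> sum w ?B * sum w ?B - link w ?B ?B a0"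
      by (rule miss_mono) (use w_nonneg_X in \<open>auto simp: S_def\<close>)
    moreover have "sum w ?B * sum w ?B - link w ?B ?B a0 \<le> 1 / 10^17"
      using a0 by (intro semibip_miss[OF hom]) (auto simp: pat1_def)
    moreover have "1 / 200 * (1 / 2) \<le> sum w S * sum w ?B" using wS W by (intro mult_mono) auto
    ultimately show False by simp
  qed
  then obtain b1 y where b1: "b1 \<in> S" and y: "{a0, b1, y} \<in> E" by blast
  have b1B: "b1 \<in> ?B" and wN: "1 / 10^7 \<le> sum w (N b1)" using b1 by (auto simp: S_def)
  have NB: "N b1 \<subseteq> ?B" by (auto simp: N_def)
  define P where "P i = (if i = 0 then {v} else if i = 1 then {a0} else if i = 2 then {b1}
     else if i = 7 then ?A else N b1)" for i :: nat
  define T :: "(nat \<times> nat \<times> nat) set" where "T = {(i, j, k). i = 1 \<and> j \<in> {3..6} \<and> k \<in> {3..6} \<and> j \<noteq> k \<or> i = 2 \<and> j = 7 \<and> k \<in> {3..6::nat}}"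
  obtain g where g: "\<And>i. i \<in> {0..7} \<Longrightarrow> g i \<in> P i" "\<And>i j k. (i, j, k) \<in> T \<Longrightarrow> {g i, g j, g k} \<in> E"
  proof (rule pick[of "{0..7}" P "{0, 1, 2}" T])
    show "P i \<subseteq> V" for i using a0 b1B XV vV NB by (auto simp: P_def)
    show "P i \<noteq> {}" if "i \<in> {0, 1, 2}" for i using that by (auto simp: P_def)
    show "1 / 10^7 \<le> sum w (P i)" if "i \<notin> {0, 1, 2}" for i using that W wN by (simp add: P_def)
    fix i j k x assume t: "(i, j, k) \<in> T" and x: "x \<in> P i"
    then consider "P j = N b1" "P k = N b1" "x = a0" | "P j = ?A" "P k = N b1" "x = b1"
      by (auto simp: P_def T_def)
    then show "sum w (P j) * sum w (P k) - link w (P j) (P k) x \<le> 1 / 1000 * (sum w (P j) * sum w (P k))"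
    proof cases
      case 1
      then show ?thesis using relative_miss[OF semibip_miss[OF hom, of x 1 1] NB NB] wN a0
        by (auto simp: pat1_def)
    next
      case 2
      then show ?thesis using relative_miss[OF semibip_miss[OF hom, of x 0 1] order_refl NB] wN W b1B
        by (auto simp: pat1_def)
    qed
  qed (auto simp: T_def)
  have ga: "g 0 = v" "g 1 = a0" "g 2 = b1" using g(1)[of 0] g(1)[of 1] g(1)[of 2] by (auto simp: P_def)
  have gN: "{v, b1, g i} \<in> E" if "i \<in> {3..6}" for i using g(1)[of i] that by (auto simp: P_def N_def split: if_splits)
  have e1: "{a0, g i, g j} \<in> E" if "i \<in> {3..6}" "j \<in> {3..6}" "i \<noteq> j" for i j
    using that g(2)[of 1 i j] ga by (simp add: T_def)
  have e2: "{b1, g 7, g j} \<in> E" if "j \<in> {3..6}" for j using that g(2)[of 2 7 j] ga by (simp add: T_def)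
  have other: "\<exists>k\<in>{3..6}. k \<noteq> i" for i :: nat
    by (rule bexI[of _ "if i = 3 then 4 else 3"]) auto
  have A0: "adj v a0" "adj a0 v" using nbr_adj[OF a] by auto
  have A1: "adj v b1" "adj b1 v" using adjI[OF gN[of 3]] by auto
  have A2: "adj a0 b1" "adj b1 a0" using adjI[OF y] by auto
  have A3: "adj v (g i)" "adj (g i) v" "adj b1 (g i)" "adj (g i) b1" if "i \<in> {3..6}" for i
    using adjI[OF gN[OF that]] by auto
  have A4: "adj a0 (g i)" "adj (g i) a0" if "i \<in> {3..6}" for i
    using other[of i] adjI[OF e1[OF that]] by auto
  have A5: "adj (g i) (g j)" if "i \<in> {3..6}" "j \<in> {3..6}" "i \<noteq> j" for i j
    using adjI[OF e1[OF that]] by auto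
  show False
  proof (rule no_core7[of "{0..6}" g 0 2 3 1 4 5])
    show "g i \<in> V" if "i \<in> {0..6}" for i
      using g(1)[of i] that a0 b1B XV vV NB by (auto simp: P_def split: if_splits)
    show "adj (g i) (g j)" if "i \<in> {0..6}" "j \<in> {0..6}" "i \<noteq> j" for i j
    proof -
      have *: "k = 0 \<or> k = 1 \<or> k = 2 \<or> k \<in> {3..6}" if "k \<in> {0..6}" for k :: nat using that by auto
      show ?thesis using *[OF that(1)] *[OF that(2)] that(3) ga A0 A1 A2 A3 A4 A5 by metis
    qed
    show "{g 0, g 2, g 3} \<in> E" using gN[of 3] ga by simp
    show "{g 1, g 4, g 5} \<in> E" using e1[of 4 5] ga by simp
  qed auto
qed

text \<open>Without neighbours in class 0, \<open>v\<close> gets colour 0. Otherwise its link lies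
  almost entirely between the classes, both neighbourhoods are heavy, edges inside class 1 are
  excluded, and \<open>v\<close> gets colour 1.\<close>

lemma extend_semibip:
  assumes hom: "hom {0, 1} pat1 c X"
  shows "good (insert v X)"
proof -
  let ?L = "\<lambda>i j. link w (cls X c i) (cls X c j) v"
  have col: "c y = 0 \<or> c y = 1" if "y \<in> X" for y using hom that by (auto simp: hom_def)
  have AA: "\<not> (c y = 0 \<and> c z = 0)" if "y \<in> X" "z \<in> X" "{v, y, z} \<in> E" for y z
    using semibip_no_AA[OF hom, of y z] that by auto
  show ?thesis
  proof (cases "nbr c 0 = {}")
    case True
    have "hom {0, 1} pat1 (c(v := 0)) (insert v X)"
    proof (rule hom_insert[OF hom _ pat1_sym])
      fix y z assume yz: "y \<in> X" "z \<in> X" "{v, y, z} \<in> E"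
      then have "{v, z, y} \<in> E" by (simp add: insert_commute)
      then have "c y \<noteq> 0" "c z \<noteq> 0" using True yz by (auto simp: nbr_def)
      then show "pat1 0 (c y) (c z)" using col[OF yz(1)] col[OF yz(2)] by (auto simp: pat1_def)
    qed auto
    then show ?thesis unfolding good_def by (intro disjI1 exI)
  next
    case False
    then obtain a0 where "a0 \<in> nbr c 0" by auto
    then have L11: "?L 1 1 < 1 / 100" using semibip_BB_no_A[OF hom] by force
    have L00: "?L 0 0 = 0" unfolding link_def
    proof (intro sum.neutral ballI)
      fix y z assume "y \<in> cls X c 0" "z \<in> cls X c 0"
      then have "{v, y, z} \<notin> E" using AA[of y z] by auto
      then show "edge v y z * (w y * w z) = 0" by (simp add: edge_def)
    qed
    have "link w X X v = ?L 0 0 + ?L 0 1 + (?L 1 0 + ?L 1 1)"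
      using link_cls[OF finite_X, of "{0, 1}" c w v] hom by (simp add: hom_def)
    moreover have "4 / 9 - 1 / 10^41 \<le> link w X X v" using deg_ge by simp
    moreover have "?L 1 0 = ?L 0 1" by (rule link_commute)
    ultimately have "4 / 9 - 1 / 10^41 < 2 * ?L 0 1 + 1 / 100" using L00 L11 by linarith
    then have "1 / 5 \<le> ?L 0 1" by simp
    also have "\<dots> \<le> sum w (nbr c 0) * sum w (nbr c 1)" by (rule link_nbr)
    finally have n: "1 / 5 \<le> sum w (nbr c 0) * sum w (nbr c 1)" .
    have "sum w (nbr c 0) * sum w (nbr c 1) \<le> sum w (nbr c 0) * 1"
      "sum w (nbr c 0) * sum w (nbr c 1) \<le> 1 * sum w (nbr c 1)"
      using nbr_sub(2) by (intro mult_left_mono mult_right_mono sum_sub_le_1 sum_sub_nonneg; simp)+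
    then have N: "1 / 10^7 \<le> sum w (nbr c 0)" "1 / 10^7 \<le> sum w (nbr c 1)" using n by auto
    have "hom {0, 1} pat1 (c(v := 1)) (insert v X)"
    proof (rule hom_insert[OF hom _ pat1_sym])
      fix y z assume yz: "y \<in> X" "z \<in> X" "{v, y, z} \<in> E"
      have "\<not> (c y = 1 \<and> c z = 1)" using semibip_no_BB[OF hom _ _ yz(3) N] yz by auto
      then show "pat1 1 (c y) (c z)" using AA[OF yz] col[OF yz(1)] col[OF yz(2)] by (auto simp: pat1_def)
    qed auto
    then show ?thesis unfolding good_def by (intro disjI1 exI)
  qed
qed

end

section \<open>Extending a colouring by the vertices of \<open>G62\<close>\<close>

context M_free_graph
begin

text \<open>\<open>hit\<close> takes care of the eight complementary pairs of edges of
  \<open>G62\<close> and \<open>t0\<close> of a ninth, so at most one pair is missed;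
  \<open>nonstar\<close> excludes the other alternative of \<open>core6_structure\<close>.\<close>

lemma no_core6:
  assumes z: "\<And>i. i \<in> {1..6} \<Longrightarrow> z i \<in> V"
    and adj: "\<And>i j. i \<in> {1..6} \<Longrightarrow> j \<in> {1..6} \<Longrightarrow> i \<noteq> j \<Longrightarrow> adj (z i) (z j)"
    and hit: "\<And>b d a' b' d'. (b, d, a', b', d') \<in> complementary_pairs \<Longrightarrow> {z 1, z b, z d} \<in> E \<or> {z a', z b', z d'} \<in> E"
    and ninth: "t0 \<in> non_G62" "z ` t0 \<in> E"
    and nonstar: "\<And>m. m \<in> {1..6} \<Longrightarrow> \<exists>e. e \<subseteq> {1..6} - {m} \<and> z ` e \<in> E"
  shows False
proof -
  define C where "C = z ` {1..6::nat}"
  have inj: "inj_on z {1..6}"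
  proof (rule inj_onI, rule ccontr)
    fix x y assume "x \<in> {1..6}" "y \<in> {1..6}" "z x = z y" "x \<noteq> y"
    then show False using adj[of x y] by (simp add: adj_def)
  qed
  have cC: "card C = 6" using card_image[OF inj] by (simp add: C_def)
  have "(\<exists>a\<in>C. \<forall>e\<in>E. e \<subseteq> C \<longrightarrow> a \<in> e) \<or>
    (\<exists>e1 e2. e1 \<subseteq> C \<and> card e1 = 3 \<and> e2 \<subseteq> C \<and> card e2 = 3 \<and> e2 \<noteq> e1 \<and> e2 \<noteq> C - e1 \<and>
       {e1, C - e1, e2, C - e2} \<inter> E = {})"
  proof (rule core6_structure[OF _ cC])
    show "C \<subseteq> V" using z by (auto simp: C_def)
    fix x y assume xy: "x \<in> C" "y \<in> C" "x \<noteq> y"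
    then obtain i j where ij: "i \<in> {1..6}" "j \<in> {1..6}" "x = z i" "y = z j" unfolding C_def by blast
    then have "i \<noteq> j" using xy(3) by blast
    then show "adj x y" using adj[OF ij(1,2)] ij(3,4) by simp
  qed
  then show False
  proof
    assume "\<exists>a\<in>C. \<forall>e\<in>E. e \<subseteq> C \<longrightarrow> a \<in> e"
    then obtain m where m: "m \<in> {1..6}" "\<And>e. e \<in> E \<Longrightarrow> e \<subseteq> C \<Longrightarrow> z m \<in> e"
      unfolding C_def by blast
    obtain e where e: "e \<subseteq> {1..6} - {m}" "z ` e \<in> E" using nonstar[OF m(1)] by blast
    have "z ` e \<subseteq> C" using e(1) by (auto simp: C_def)
    then have "z m \<in> z ` e" using m(2) e(2) by simp
    then obtain k where k: "k \<in> e" "z m = z k" by blast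
    then have "k \<in> {1..6}" "k \<noteq> m" using e(1) by auto
    then show False using inj_onD[OF inj k(2) m(1)] by simp
  next
    assume "\<exists>e1 e2. e1 \<subseteq> C \<and> card e1 = 3 \<and> e2 \<subseteq> C \<and> card e2 = 3 \<and> e2 \<noteq> e1 \<and> e2 \<noteq> C - e1 \<and>
       {e1, C - e1, e2, C - e2} \<inter> E = {}"
    then obtain e1 e2 where e: "e1 \<subseteq> C" "card e1 = 3" "e2 \<subseteq> C" "card e2 = 3" "e2 \<noteq> e1" "e2 \<noteq> C - e1"
      "{e1, C - e1, e2, C - e2} \<inter> E = {}" by (elim exE conjE) (rule that)
    have compl: "z ` ({1..6} - s) = C - z ` s" if "s \<subseteq> {1..6}" for s
      unfolding C_def by (rule inj_on_image_set_diff[OF inj]) (use that in auto)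
    have dd: "C - (C - e) = e" if "e \<subseteq> C" for e using that by blast
    \<comment> \<open>By \<open>hit\<close>, a missed complementary pair can only carry the labels
      of one of the two pairs absent from \<open>G62\<close>.\<close>
    have key: "\<exists>s. (s = {1, 2, 3} \<or> s = {1, 2, 6}) \<and> (e = z ` s \<or> e = C - z ` s)"
      if e: "e \<subseteq> C" "card e = 3" "e \<notin> E" "C - e \<notin> E" for e
    proof -
      define t where "t = {i \<in> {1..6}. z i \<in> e}"
      have t6: "t \<subseteq> {1..6}" by (auto simp: t_def)
      have zt: "z ` t = e" using e(1) by (auto simp: t_def C_def)
      have ct: "card t = 3" using card_image[OF inj_on_subset[OF inj t6]] zt e(2) by simp
      have ct': "card ({1..6} - t) = 3" using ct t6 finite_subset[OF t6] by (simp add: card_Diff_subset)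
      define s where "s = (if 1 \<in> t then t else {1..6} - t)"
      have s: "s \<subseteq> {1..6}" "card s = 3" "1 \<in> s" using t6 ct ct' by (auto simp: s_def)
      have es: "e = z ` s \<or> e = C - z ` s"
        using zt compl[OF t6] dd[OF e(1)] by (auto simp: s_def)
      have mis: "z ` s \<notin> E" "z ` ({1..6} - s) \<notin> E"
        using es e(3,4) dd[of "z ` s"] compl[OF s(1)] s(1) by (auto simp: C_def image_mono)
      obtain b d a' b' d' where tup: "(b, d, a', b', d') \<in> set [(2,3,4,5,6),(2,6,3,4,5),(2,4,3,5,6),(2,5,3,4,6),(3,4,2,5,6),(3,5,2,4,6),(3,6,2,4,5),
         (4,5,2,3,6),(4,6,2,3,5),(5,6,2,3,4)]" and eq: "s = {1, b, d}" "{1..6} - s = {a', b', d'}"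
        using triples_with_1[OF s] by (elim exE conjE) (rule that)
      have "\<not> ({z 1, z b, z d} \<in> E \<or> {z a', z b', z d'} \<in> E)" using mis unfolding eq(2) unfolding eq(1) by simp
      then have "(b, d, a', b', d') \<notin> complementary_pairs" using hit by blast
      then have "(b, d) = (2, 3) \<or> (b, d) = (2, 6)" using tup by auto
      then show ?thesis using es eq(1) by (intro exI[of _ s]) auto
    qed
    have nE: "e1 \<notin> E" "C - e1 \<notin> E" "e2 \<notin> E" "C - e2 \<notin> E" using e(7) by blast+
    obtain s1 where s1: "s1 = {1, 2, 3} \<or> s1 = {1, 2, 6}" "e1 = z ` s1 \<or> e1 = C - z ` s1"
      using key[OF e(1,2) nE(1,2)] by (elim exE conjE) (rule that)
    obtain s2 where s2: "s2 = {1, 2, 3} \<or> s2 = {1, 2, 6}" "e2 = z ` s2 \<or> e2 = C - z ` s2"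
      using key[OF e(3,4) nE(3,4)] by (elim exE conjE) (rule that)
    have sub: "s1 \<subseteq> {1..6}" using s1(1) by (elim disjE) simp_all
    have sub': "s2 \<subseteq> {1..6}" using s2(1) by (elim disjE) simp_all
    have zsub: "z ` s1 \<subseteq> C" "z ` s2 \<subseteq> C" unfolding C_def using sub sub' by (simp_all add: image_mono)
    have "s1 \<noteq> s2" using s1(2) s2(2) e(5,6) dd[OF zsub(1)] by metis
    have n: "z ` s1 \<notin> E" "z ` ({1..6} - s1) \<notin> E"
      unfolding compl[OF sub] using s1(2) nE(1,2) dd[OF zsub(1)] by metis+
    have n': "z ` s2 \<notin> E" "z ` ({1..6} - s2) \<notin> E"
      unfolding compl[OF sub'] using s2(2) nE(3,4) dd[OF zsub(2)] by metis+
    have c: "{1..6} - {1,2,3} = {4,5,6::nat}" "{1..6} - {1,2,6} = {3,4,5::nat}" by auto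
    \<comment> \<open>Two different missed pairs must be both of these, so every member of
      \<open>non_G62\<close> is missed, including \<open>t0\<close>.\<close>
    have "z ` {1,2,3} \<notin> E \<and> z ` {4,5,6} \<notin> E \<and> z ` {1,2,6} \<notin> E \<and> z ` {3,4,5} \<notin> E"
      using s1(1) s2(1) \<open>s1 \<noteq> s2\<close> n n' c by metis
    then show False using ninth unfolding non_G62_iff by metis
  qed
qed

end

context extension
begin

text \<open>Core: \<open>x\<close>, \<open>x'\<close> and one generic vertex of each of the five
  other classes. The given edge makes \<open>x\<close> and \<open>x'\<close> adjacent, and the
  labels 124 and 356 give disjoint edges.\<close>

lemma G62_no_inner:
  assumes hom: "hom {1..6} pat2 c X" and x: "x \<in> cls X c i" "x' \<in> cls X c i" and e: "{v, x, x'} \<in> E"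
  shows False
proof -
  have i: "i \<in> {1..6}" using hom x by (auto simp: hom_def)
  define P where "P a = (if a = 0 then {x'} else if a = i then {x} else cls X c a)" for a
  \<comment> \<open>Index 0 holds \<open>x'\<close>, a second vertex of colour \<open>i\<close>.
    Indices of prescribed vertices occur only in first position; \<open>ee\<close> restores the
    other orders.\<close>
  define T where "T = {(a, j, k). a \<in> {0..6} \<and> j \<noteq> i \<and> k \<noteq> i \<and> pat2 (if a = 0 then i else a) j k}"
  have W: "1 / 10^7 \<le> sum w (cls X c a)" if "a \<in> {1..6}" for a
    by (rule order_trans[OF _ G62_bounds(1)[OF hom that]]) simp
  obtain g where g: "\<And>a. a \<in> {0..6} \<Longrightarrow> g a \<in> P a" "\<And>a j k. (a, j, k) \<in> T \<Longrightarrow> {g a, g j, g k} \<in> E"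
  proof (rule pick[of "{0..6}" P "{0, i}" T])
    show "P a \<subseteq> V" for a using x XV by (auto simp: P_def)
    show "P a \<noteq> {}" if "a \<in> {0, i}" for a using that by (auto simp: P_def)
    show "1 / 10^7 \<le> sum w (P a)" if "a \<in> {0..6}" "a \<notin> {0, i}" for a using that W[of a] by (simp add: P_def)
    show "a \<in> {0..6} \<and> j \<in> {0..6} \<and> k \<in> {0..6} \<and> a \<noteq> j \<and> a \<noteq> k \<and> j \<noteq> k \<and> j \<notin> {0, i} \<and> k \<notin> {0, i}"
      if t: "(a, j, k) \<in> T" for a j k
    proof -
      have p: "pat2 (if a = 0 then i else a) j k" "a \<in> {0..6}" "j \<noteq> i" "k \<noteq> i" using t by (auto simp: T_def)
      show ?thesis using pat2_range[OF p(1)] p(2-4) by (auto split: if_splits)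
    qed
    fix a j k y assume t: "(a, j, k) \<in> T" and y: "y \<in> P a"
    have p: "pat2 (if a = 0 then i else a) j k" "j \<noteq> i" "k \<noteq> i" using t by (auto simp: T_def)
    have jk: "j \<in> {1..6}" "k \<in> {1..6}" using pat2_range[OF p(1)] by auto
    have y': "y \<in> X" "c y = (if a = 0 then i else a)" using y x by (auto simp: P_def split: if_splits)
    have P: "P j = cls X c j" "P k = cls X c k" using jk p by (auto simp: P_def)
    have "pat2 (c y) j k" using p(1) y'(2) by simp
    from relative_miss[OF G62_miss[OF hom y'(1) this] order_refl order_refl _ _ W[OF jk(1)] W[OF jk(2)]]
    show "sum w (P j) * sum w (P k) - link w (P j) (P k) y \<le> 1 / 1000 * (sum w (P j) * sum w (P k))"
      unfolding P by auto
  qed auto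
  have gx: "g 0 = x'" "g i = x" using g(1)[of 0] g(1)[of i] i by (auto simp: P_def)
  have ee: "{g a, g j, g k} \<in> E" if p: "pat2 a j k" for a j k
  proof -
    note r = pat2_range[OF p]
    consider "j = i" | "k = i" | "j \<noteq> i" "k \<noteq> i" by blast
    then show ?thesis
    proof cases
      case 1
      then have "pat2 i a k" using conjunct1[OF pat2_sym[OF p]] by simp
      then have "(i, a, k) \<in> T" using 1 r i by (simp add: T_def)
      then show ?thesis using g(2)[of i a k] 1 by (simp add: insert_commute)
    next
      case 2
      then have "pat2 i a j" using conjunct1[OF pat2_sym[OF conjunct2[OF pat2_sym[OF p]]]] by simp
      then have "(i, a, j) \<in> T" using 2 r i by (simp add: T_def)
      then show ?thesis using g(2)[of i a j] 2 by (simp add: insert_commute)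
    next
      case 3
      then have "(a, j, k) \<in> T" using p r by (simp add: T_def)
      then show ?thesis by (rule g(2))
    qed
  qed
  have e0: "{g 0, g j, g k} \<in> E" if p: "pat2 i j k" for j k
    using g(2)[of 0 j k] p pat2_range[OF p] by (auto simp: T_def)
  have A: "adj (g a) (g b)" if "a \<in> {1..6}" "b \<in> {1..6}" "a \<noteq> b" for a b
    using pat2_two_thirds[OF that] adjI[OF ee] by blast
  have A0: "adj (g 0) (g a) \<and> adj (g a) (g 0)" if "a \<in> {1..6}" for a
  proof (cases "a = i")
    case True then show ?thesis using adjI[OF e] gx by simp
  next
    case False then show ?thesis using pat2_two_thirds[OF i that] adjI[OF e0] by blast
  qed
  show False
  proof (rule no_core7[of "{0..6}" g 1 2 4 3 5 6])
    show "g a \<in> V" if "a \<in> {0..6}" for a using g(1)[OF that] x XV by (auto simp: P_def split: if_splits)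
    show "adj (g a) (g b)" if "a \<in> {0..6}" "b \<in> {0..6}" "a \<noteq> b" for a b
    proof -
      have *: "k = 0 \<or> k \<in> {1..6}" if "k \<in> {0..6}" for k :: nat using that by auto
      show ?thesis using *[OF that(1)] *[OF that(2)] that(3) A A0 by metis
    qed
    show "{g 1, g 2, g 4} \<in> E" "{g 3, g 5, g 6} \<in> E" by (rule ee; rule pat2_edges)+
  qed auto
qed

lemma G62_inner_zero:
  assumes hom: "hom {1..6} pat2 c X"
  shows "link w (cls X c i) (cls X c i) v = 0"
  unfolding link_def
proof (intro sum.neutral ballI)
  fix y z assume "y \<in> cls X c i" "z \<in> cls X c i"
  then have "{v, y, z} \<notin> E" using G62_no_inner[OF hom] by blast
  then show "edge v y z * (w y * w z) = 0" by (simp add: edge_def)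
qed

text \<open>Only four classes would matter to \<open>v\<close>, and pairs inside a class are
  excluded: 12 ordered pairs of classes of weight about 1 / 6 give about 1 / 3, below 4 / 9.\<close>

lemma G62_not_two_small:
  assumes hom: "hom {1..6} pat2 c X" and ij: "i \<in> {1..6}" "j \<in> {1..6}" "i \<noteq> j"
    and small: "sum w (nbr c i) < 1 / 10^7" "sum w (nbr c j) < 1 / 10^7"
  shows False
proof -
  define u :: "nat \<Rightarrow> real" where "u a = (if a = i \<or> a = j then 1 / 10^7 else 167 / 1000)" for a
  have nu: "sum w (nbr c a) \<le> u a" if "a \<in> {1..6}" for a
  proof -
    have "sum w (nbr c a) \<le> sum w (cls X c a)" by (rule sum_mono2) (use nbr_sub w_nonneg_X in auto)
    also have "\<dots> \<le> 167 / 1000" by (rule G62_bounds(2)[OF hom that])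
    finally show ?thesis using small by (auto simp: u_def)
  qed
  have u0: "0 \<le> u a" for a by (simp add: u_def)
  have "4 / 9 - 1 / 10^41 \<le> link w X X v" using deg_ge by simp
  also have "\<dots> = (\<Sum>a\<in>{1..6}. \<Sum>b\<in>{1..6}. link w (cls X c a) (cls X c b) v)"
    by (rule link_cls) (use hom in \<open>auto simp: hom_def\<close>)
  also have "\<dots> \<le> (\<Sum>a\<in>{1..6}. \<Sum>b\<in>{1..6}. u a * u b - (if a = b then u a * u a else 0))"
  proof (intro sum_mono)
    fix a b :: nat assume ab: "a \<in> {1..6}" "b \<in> {1..6}"
    show "link w (cls X c a) (cls X c b) v \<le> u a * u b - (if a = b then u a * u a else 0)"
    proof (cases "a = b")
      case True then show ?thesis using G62_inner_zero[OF hom] by simp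
    next
      case False
      have "link w (cls X c a) (cls X c b) v \<le> sum w (nbr c a) * sum w (nbr c b)" by (rule link_nbr)
      also have "\<dots> \<le> u a * u b" by (intro mult_mono nu ab u0 sum_sub_nonneg nbr_sub(2))
      finally show ?thesis using False by simp
    qed
  qed
  also have "\<dots> = (\<Sum>a\<in>{1..6}. u a) * (\<Sum>b\<in>{1..6}. u b) - (\<Sum>a\<in>{1..6}. u a * u a)"
    unfolding sum_product sum_subtractf by simp
  also have "(\<Sum>a\<in>{1..6}. u a) = 2 * (1 / 10^7) + 4 * (167 / 1000)"
    unfolding u_def by (rule sum_two_of_six[OF ij])
  also have "(\<Sum>a\<in>{1..6}. u a * u a) = 2 * (1 / 10^7 * (1 / 10^7)) + 4 * (167 / 1000 * (167 / 1000))"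
    unfolding sum_two_of_six[OF ij, symmetric] by (rule sum.cong) (auto simp: u_def)
  finally show False by simp
qed

text \<open>The class \<open>i\<close> will be the colour of \<open>v\<close>. All other
  neighbourhoods are heavy; a neighbour in class \<open>i\<close> too would complete
  \<open>v\<close> and one neighbour per class to a core of seven vertices with disjoint edges 124
  and 356.\<close>

lemma G62_nbr_empty:
  assumes hom: "hom {1..6} pat2 c X"
  obtains i where "i \<in> {1..6}" "nbr c i = {}" "\<And>a. a \<in> {1..6} \<Longrightarrow> a \<noteq> i \<Longrightarrow> 1 / 10^7 \<le> sum w (nbr c a)"
proof -
  have "\<exists>i\<in>{1..6}. \<forall>a\<in>{1..6}. a \<noteq> i \<longrightarrow> 1 / 10^7 \<le> sum w (nbr c a)"
  proof (cases "\<exists>i\<in>{1..6}. sum w (nbr c i) < 1 / 10^7")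
    case True
    then obtain i where "i \<in> {1..6}" "sum w (nbr c i) < 1 / 10^7" by blast
    then show ?thesis using G62_not_two_small[OF hom, of i] by (intro bexI[of _ i] ballI impI) (auto simp: not_less[symmetric])
  next
    case False then show ?thesis by (intro bexI[of _ 1]) (auto simp: not_less)
  qed
  then obtain i where i: "i \<in> {1..6}" and N: "\<And>a. a \<in> {1..6} \<Longrightarrow> a \<noteq> i \<Longrightarrow> 1 / 10^7 \<le> sum w (nbr c a)" by blast
  have "nbr c i = {}"
  proof (rule ccontr)
    assume ne: "nbr c i \<noteq> {}"
    define T where "T = {(a, j, k). j \<noteq> i \<and> k \<noteq> i \<and> pat2 a j k}"
    obtain g where g: "\<And>a. a \<in> {1..6} \<Longrightarrow> g a \<in> nbr c a" "\<And>a j k. (a, j, k) \<in> T \<Longrightarrow> {g a, g j, g k} \<in> E"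
    proof (rule pick[of "{1..6}" "nbr c" "{i}" T])
      show "a \<in> {1..6} \<and> j \<in> {1..6} \<and> k \<in> {1..6} \<and> a \<noteq> j \<and> a \<noteq> k \<and> j \<noteq> k \<and> j \<notin> {i} \<and> k \<notin> {i}"
        if t: "(a, j, k) \<in> T" for a j k using t pat2_range[of a j k] by (simp add: T_def)
      fix a j k y assume t: "(a, j, k) \<in> T" and y: "y \<in> nbr c a"
      have p: "pat2 a j k" "j \<noteq> i" "k \<noteq> i" using t by (auto simp: T_def)
      have jk: "j \<in> {1..6}" "k \<in> {1..6}" using pat2_range[OF p(1)] by auto
      have y': "y \<in> X" "pat2 (c y) j k" using y p(1) by (auto simp: nbr_def)
      from relative_miss[OF G62_miss[OF hom y'] nbr_sub(1) nbr_sub(1) _ _ N[OF jk(1) p(2)] N[OF jk(2) p(3)]]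
      show "sum w (nbr c j) * sum w (nbr c k) - link w (nbr c j) (nbr c k) y \<le> 1 / 1000 * (sum w (nbr c j) * sum w (nbr c k))"
        by auto
    qed (use ne N nbr_sub(3) in auto)
    have ee: "{g a, g j, g k} \<in> E" if p: "pat2 a j k" for a j k
    proof -
      note r = pat2_range[OF p]
      consider "j = i" | "k = i" | "j \<noteq> i" "k \<noteq> i" by blast
      then show ?thesis
      proof cases
        case 1
        then have "pat2 i a k" using conjunct1[OF pat2_sym[OF p]] by simp
      then have "(i, a, k) \<in> T" using 1 r i by (simp add: T_def)
        then show ?thesis using g(2)[of i a k] 1 by (simp add: insert_commute)
      next
        case 2
        then have "pat2 i a j" using conjunct1[OF pat2_sym[OF conjunct2[OF pat2_sym[OF p]]]] by simp
        then have "(i, a, j) \<in> T" using 2 r i by (simp add: T_def)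
        then show ?thesis using g(2)[of i a j] 2 by (simp add: insert_commute)
      next
        case 3
        then have "(a, j, k) \<in> T" using p r by (simp add: T_def)
        then show ?thesis by (rule g(2))
      qed
    qed
    define z where "z = g(0 := v)"
    have z: "z 0 = v" "\<And>a. a \<in> {1..6} \<Longrightarrow> z a = g a" by (auto simp: z_def)
    have A: "adj (z a) (z b)" if "a \<in> {1..6}" "b \<in> {1..6}" "a \<noteq> b" for a b
      using pat2_two_thirds[OF that] adjI[OF ee] z(2) that by metis
    have A0: "adj (z 0) (z a) \<and> adj (z a) (z 0)" if "a \<in> {1..6}" for a
      using nbr_adj[OF g(1)[OF that]] z that by simp
    have *: "k = 0 \<or> k \<in> {1..6}" if "k \<in> {0..6}" for k :: nat using that by auto
    show False
    proof (rule no_core7[of "{0..6}" z 1 2 4 3 5 6])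
      show "z a \<in> V" if "a \<in> {0..6}" for a
        using *[OF that] subsetD[OF nbr_sub(3) g(1)] vV z by metis
      show "adj (z a) (z b)" if "a \<in> {0..6}" "b \<in> {0..6}" "a \<noteq> b" for a b
        using *[OF that(1)] *[OF that(2)] that(3) A A0 by metis
      show "{z 1, z 2, z 4} \<in> E" "{z 3, z 5, z 6} \<in> E"
        using ee[of 1 2 4] ee[of 3 5 6] pat2_edges z(2) by simp_all
    qed auto
  qed
  then show ?thesis using that[OF i] N by blast
qed

text \<open>Otherwise \<open>v\<close>, \<open>y\<close>, a generic \<open>z\<close> of large
  codegree and generic neighbours of \<open>v\<close> form a core labelled by the six colours,
  \<open>v\<close> having label \<open>i\<close>. Each pair in \<open>complementary_pairs\<close>
  has a triple avoiding \<open>i\<close>, which is a generic edge, and \<open>{v, y, z}\<close> hits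
  a ninth pair.\<close>

lemma G62_codegree_small:
  assumes hom: "hom {1..6} pat2 c X" and ijk: "i \<in> {1..6}" "j \<in> {1..6}" "k \<in> {1..6}" "i \<noteq> j" "i \<noteq> k" "j \<noteq> k"
    and np: "\<not> pat2 i j k" and N: "\<And>a. a \<in> {1..6} \<Longrightarrow> a \<noteq> i \<Longrightarrow> 1 / 10^7 \<le> sum w (nbr c a)"
    and y: "y \<in> cls X c j"
  shows "sum w {z \<in> cls X c k. {v, y, z} \<in> E} < 1 / 10^7"
proof (rule ccontr)
  define M where "M = {z \<in> cls X c k. {v, y, z} \<in> E}"
  assume "\<not> sum w {z \<in> cls X c k. {v, y, z} \<in> E} < 1 / 10^7"
  then have wM: "1 / 10^7 \<le> sum w M" by (simp add: M_def)
  have Msub: "M \<subseteq> cls X c k" by (auto simp: M_def)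
  define P where "P a = (if a = i then {v} else if a = j then {y} else if a = k then M else nbr c a)" for a
  define T where "T = {(a, b, d). pat2 a b d \<and> a \<noteq> i \<and> b \<noteq> i \<and> d \<noteq> i \<and> b \<noteq> j \<and> d \<noteq> j}"
  have Psub: "P a \<subseteq> cls X c a" if "a \<noteq> i" for a
    using that y Msub nbr_sub(1)[of c a] by (auto simp: P_def)
  have Pw: "1 / 10^7 \<le> sum w (P a)" if "a \<in> {1..6}" "a \<noteq> i" "a \<noteq> j" for a
    using that wM N[of a] by (simp add: P_def)
  obtain g where g: "\<And>a. a \<in> {1..6} \<Longrightarrow> g a \<in> P a" "\<And>a b d. (a, b, d) \<in> T \<Longrightarrow> {g a, g b, g d} \<in> E"
  proof (rule pick[of "{1..6}" P "{i, j}" T])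
    show "P a \<subseteq> V" for a using vV y XV Msub nbr_sub(3)[of c a] by (auto simp: P_def)
    show "P a \<noteq> {}" if "a \<in> {i, j}" for a using that by (auto simp: P_def)
    show "1 / 10^7 \<le> sum w (P a)" if "a \<in> {1..6}" "a \<notin> {i, j}" for a using that Pw[of a] by simp
    show "a \<in> {1..6} \<and> b \<in> {1..6} \<and> d \<in> {1..6} \<and> a \<noteq> b \<and> a \<noteq> d \<and> b \<noteq> d \<and> b \<notin> {i, j} \<and> d \<notin> {i, j}"
      if t: "(a, b, d) \<in> T" for a b d using t pat2_range[of a b d] by (simp add: T_def)
    fix a b d x assume t: "(a, b, d) \<in> T" and x: "x \<in> P a"
    have p: "pat2 a b d" "a \<noteq> i" "b \<noteq> i" "d \<noteq> i" "b \<noteq> j" "d \<noteq> j" using t by (simp_all add: T_def)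
    have r: "b \<in> {1..6}" "d \<in> {1..6}" using pat2_range[OF p(1)] by auto
    have x': "x \<in> X" "pat2 (c x) b d" using subsetD[OF Psub[OF p(2)] x] p(1) by auto
    from relative_miss[OF G62_miss[OF hom x'] Psub[OF p(3)] Psub[OF p(4)] _ _ Pw[OF r(1) p(3,5)] Pw[OF r(2) p(4,6)]]
    show "sum w (P b) * sum w (P d) - link w (P b) (P d) x \<le> 1 / 1000 * (sum w (P b) * sum w (P d))"
      by auto
  qed auto
  have gv: "g i = v" "g j = y" "g k \<in> M" using g(1)[of i] g(1)[of j] g(1)[of k] ijk by (simp_all add: P_def)
  have vjk: "{v, g j, g k} \<in> E" using gv by (auto simp: M_def)
  have ee: "{g a, g b, g d} \<in> E" if p: "pat2 a b d" and ni: "a \<noteq> i" "b \<noteq> i" "d \<noteq> i" for a b d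
  proof -
    note r = pat2_range[OF p]
    consider "b = j" | "d = j" | "b \<noteq> j" "d \<noteq> j" by blast
    then show ?thesis
    proof cases
      case 1
      then have "pat2 j a d" using conjunct1[OF pat2_sym[OF p]] by simp
      then have "(j, a, d) \<in> T" using 1 r ni ijk by (simp add: T_def)
      then show ?thesis using g(2)[of j a d] 1 by (simp add: insert_commute)
    next
      case 2
      then have "pat2 j a b" using conjunct1[OF pat2_sym[OF conjunct2[OF pat2_sym[OF p]]]] by simp
      then have "(j, a, b) \<in> T" using 2 r ni ijk by (simp add: T_def)
      then show ?thesis using g(2)[of j a b] 2 by (simp add: insert_commute)
    next
      case 3
      then have "(a, b, d) \<in> T" using p ni by (simp add: T_def)
      then show ?thesis by (rule g(2))
    qed
  qed
  have A: "adj (g a) (g b)" if ab: "a \<in> {1..6}" "b \<in> {1..6}" "a \<noteq> b" "a \<noteq> i" "b \<noteq> i" for a b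
  proof -
    obtain l where "l \<noteq> i" "pat2 a b l" using pat2_two_thirds[OF ab(1-3)] by metis
    then show ?thesis using adjI[OF ee[of a b l]] ab by simp
  qed
  have Av: "adj v (g a) \<and> adj (g a) v" if a: "a \<in> {1..6}" "a \<noteq> i" for a
  proof (cases "a = j \<or> a = k")
    case True then show ?thesis using adjI[OF vjk] by auto
  next
    case False
    then have "g a \<in> nbr c a" using g(1)[OF a(1)] a(2) by (simp add: P_def)
    then show ?thesis by (rule nbr_adj)
  qed
  show False
  proof (rule no_core6[of g "{i, j, k}"])
    show "g a \<in> V" if a: "a \<in> {1..6}" for a
    proof (cases "a = i")
      case True then show ?thesis using gv vV by simp
    next
      case False then show ?thesis using subsetD[OF Psub g(1)[OF a]] XV by auto
    qed
    show "adj (g a) (g b)" if "a \<in> {1..6}" "b \<in> {1..6}" "a \<noteq> b" for a b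
      using A[OF that] Av[OF that(1)] Av[OF that(2)] gv(1) that(3) by metis
    show "{g 1, g b, g d} \<in> E \<or> {g a', g b', g d'} \<in> E"
      if t: "(b, d, a', b', d') \<in> complementary_pairs" for b d a' b' d'
    proof (cases "i \<in> {1, b, d}")
      case True
      then have "i \<notin> {a', b', d'}" using complementary_edges(3)[OF t] by blast
      then show ?thesis using ee[OF complementary_edges(2)[OF t]] by simp
    next
      case False
      then show ?thesis using ee[OF complementary_edges(1)[OF t]] by simp
    qed
    show "{i, j, k} \<in> non_G62" by (rule non_pat2_in_non_G62) (use ijk np in auto)
    show "g ` {i, j, k} \<in> E" using vjk gv(1) by simp
    show "\<exists>e. e \<subseteq> {1..6} - {m} \<and> g ` e \<in> E" if m: "m \<in> {1..6}" for m
    proof -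
      obtain a b d where abd: "pat2 a b d" "i \<notin> {a, b, d}" "m \<notin> {a, b, d}" using pat2_avoid[OF ijk(1) m] by blast
      have "{a, b, d} \<subseteq> {1..6} - {m}" using pat2_range[OF abd(1)] abd(3) by auto
      moreover have "g ` {a, b, d} \<in> E" using ee[OF abd(1)] abd(2) by auto
      ultimately show ?thesis by blast
    qed
  qed
qed

text \<open>\<open>v\<close> behaves like a vertex of class \<open>i\<close>: pairs outside the
  pattern contribute almost nothing to its link, so nearly all pairs prescribed by colour
  \<open>i\<close> must be present. This permits generic edges through \<open>v\<close>.\<close>

lemma G62_link_full:
  assumes hom: "hom {1..6} pat2 c X" and i: "i \<in> {1..6}" "nbr c i = {}"
    and N: "\<And>a. a \<in> {1..6} \<Longrightarrow> a \<noteq> i \<Longrightarrow> 1 / 10^7 \<le> sum w (nbr c a)"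
    and p: "pat2 i l m"
  shows "sum w (cls X c l) * sum w (cls X c m) - link w (cls X c l) (cls X c m) v \<le>
    1 / 1000 * (sum w (cls X c l) * sum w (cls X c m))"
proof -
  let ?W = "\<lambda>j. sum w (cls X c j)" and ?L = "\<lambda>j k. link w (cls X c j) (cls X c k) v"
  have W0: "0 \<le> ?W j" for j by (rule sum_sub_nonneg) auto
  \<comment> \<open>The added 1 / 10^7 keeps the deficit nonnegative for non-edges of the pattern,
    where only a codegree bound is known.\<close>
  define d where "d j k = of_bool (pat2 i j k) * (?W j * ?W k) - ?L j k + 1 / 10^7" for j k
  have d0: "0 \<le> d j k" if jk: "j \<in> {1..6}" "k \<in> {1..6}" for j k
  proof -
    consider "pat2 i j k" | "j = i \<or> k = i" | "j = k" | "\<not> pat2 i j k" "j \<noteq> i" "k \<noteq> i" "j \<noteq> k" by blast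
    then show ?thesis
    proof cases
      case 1
      have "?L j k \<le> ?W j * ?W k" by (rule link_le) (use w_nonneg_X in auto)
      then show ?thesis using 1 by (simp add: d_def)
    next
      case 2
      have "?L j k \<le> sum w (nbr c j) * sum w (nbr c k)" by (rule link_nbr)
      also have "\<dots> = 0" using 2 i by auto
      finally have "?L j k \<le> 0" .
      moreover have "0 \<le> of_bool (pat2 i j k) * (?W j * ?W k)" by (intro mult_nonneg_nonneg W0) simp
      ultimately show ?thesis unfolding d_def by simp
    next
      case 3
      then show ?thesis using G62_inner_zero[OF hom] W0 by (simp add: d_def)
    next
      case 4
      have "?L j k = (\<Sum>y\<in>cls X c j. w y * sum w {z \<in> cls X c k. {v, y, z} \<in> E})"
        unfolding link_def
      proof (rule sum.cong[OF refl])
        fix y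
        have "(\<Sum>z\<in>cls X c k. edge v y z * (w y * w z)) =
          (\<Sum>z\<in>{z \<in> cls X c k. {v, y, z} \<in> E}. edge v y z * (w y * w z))"
          by (rule sum.mono_neutral_right) (auto simp: edge_def)
        also have "\<dots> = w y * sum w {z \<in> cls X c k. {v, y, z} \<in> E}"
          unfolding sum_distrib_left by (rule sum.cong) (auto simp: edge_def)
        finally show "(\<Sum>z\<in>cls X c k. edge v y z * (w y * w z)) = w y * sum w {z \<in> cls X c k. {v, y, z} \<in> E}" .
      qed
      also have "\<dots> \<le> (\<Sum>y\<in>cls X c j. w y * (1 / 10^7))"
      proof (intro sum_mono mult_left_mono)
        fix y assume y: "y \<in> cls X c j"
        show "sum w {z \<in> cls X c k. {v, y, z} \<in> E} \<le> 1 / 10^7"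
          using G62_codegree_small[OF hom i(1) jk _ _ _ 4(1) N y] 4 by simp
        show "0 \<le> w y" using y w_nonneg_X by simp
      qed
      also have "\<dots> = ?W j * (1 / 10^7)" by (simp only: sum_distrib_right)
      also have "\<dots> \<le> 1 * (1 / 10^7)" by (intro mult_right_mono sum_sub_le_1) auto
      finally show ?thesis using 4 by (simp add: d_def)
    qed
  qed
  have lm: "l \<in> {1..6}" "m \<in> {1..6}" using pat2_range[OF p] by auto
  have "d l m \<le> (\<Sum>k\<in>{1..6}. d l k)" by (rule member_le_sum) (use lm d0 in auto)
  also have "\<dots> \<le> (\<Sum>j\<in>{1..6}. \<Sum>k\<in>{1..6}. d j k)"
    by (rule member_le_sum[where f = "\<lambda>j. \<Sum>k\<in>{1..6}. d j k"]) (use lm d0 in \<open>auto intro!: sum_nonneg\<close>)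
  also have "\<dots> = pdeg {1..6} pat2 ?W i - link w X X v + 36 * (1 / 10^7)"
  proof -
    have "link w X X v = (\<Sum>j\<in>{1..6}. \<Sum>k\<in>{1..6}. ?L j k)"
      by (rule link_cls) (use hom in \<open>auto simp: hom_def\<close>)
    then show ?thesis unfolding d_def pdeg_def by (simp add: sum.distrib sum_subtractf)
  qed
  also have "pdeg {1..6} pat2 ?W i \<le> 4 / 9 + 1 / 10^9"
  proof -
    let ?u = "1 / 6 + 3 * (1 / 10^20) :: real"
    have Wu: "?W j \<le> ?u" if "j \<in> {1..6}" for j
      by (rule abs_diff_bounds(2)[OF G62_weights[OF hom that], of 0]) simp_all
    have "pdeg {1..6} pat2 ?W i \<le> (\<Sum>j\<in>{1..6}. \<Sum>k\<in>{1..6}. of_bool (pat2 i j k) * (?u * ?u))"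
      unfolding pdeg_def by (intro sum_mono mult_left_mono mult_mono Wu W0) auto
    also have "\<dots> = (36 * (?u * ?u)) * pdeg {1..6} pat2 (\<lambda>_. 1 / 6) i"
      unfolding pdeg_def sum_distrib_left by (intro sum.cong refl) simp
    also have "\<dots> = (36 * (?u * ?u)) * (4 / 9)" by (simp only: pdeg_pat2_sixth[OF i(1)])
    also have "\<dots> \<le> 4 / 9 + 1 / 10^9" by simp
    finally show ?thesis .
  qed
  finally have "d l m \<le> 4 / 9 + 1 / 10^9 - link w X X v + 36 * (1 / 10^7)" by simp
  moreover have "4 / 9 - 1 / 10^41 \<le> link w X X v" using deg_ge by simp
  ultimately have "d l m \<le> 1 / 10^9 + 1 / 10^41 + 36 * (1 / 10^7)" by linarith
  then have "?W l * ?W m - ?L l m \<le> 1 / 1000 * (1 / 7 * (1 / 7))" using p by (simp add: d_def)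
  also have "\<dots> \<le> 1 / 1000 * (?W l * ?W m)"
    using G62_bounds(1)[OF hom lm(1)] G62_bounds(1)[OF hom lm(2)] by (intro mult_left_mono mult_mono) auto
  finally show ?thesis .
qed

text \<open>Here a single edge suffices, since \<open>v\<close> now lies in generic edges. With
  \<open>v\<close>, \<open>y\<close>, \<open>y'\<close> on the non-edge \<open>t\<close> and generic
  vertices elsewhere, each pair in \<open>complementary_pairs\<close> has a triple meeting
  \<open>t\<close> once, which is an edge; the given edge hits the ninth pair.\<close>

lemma G62_no_extra:
  assumes hom: "hom {1..6} pat2 c X" and i: "i \<in> {1..6}" "nbr c i = {}"
    and N: "\<And>a. a \<in> {1..6} \<Longrightarrow> a \<noteq> i \<Longrightarrow> 1 / 10^7 \<le> sum w (nbr c a)"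
    and jk: "j \<in> {1..6}" "k \<in> {1..6}" "i \<noteq> j" "i \<noteq> k" "j \<noteq> k" "\<not> pat2 i j k"
    and y: "y \<in> cls X c j" "y' \<in> cls X c k" and e: "{v, y, y'} \<in> E"
  shows False
proof -
  define t where "t = {i, j, k}"
  define U where "U = {1..6} - t"
  have t: "t \<in> non_G62" unfolding t_def by (rule non_pat2_in_non_G62) (use i jk in auto)
  note split = non_G62_split[OF t, folded U_def]
  define P where "P a = (if a = i then {v} else if a = j then {y} else if a = k then {y'} else cls X c a)" for a
  define T where "T = {(a, l, m). a \<in> t \<and> l \<in> U \<and> m \<in> U \<and> pat2 a l m}"
  have PU: "P a = cls X c a" if "a \<in> U" for a using that by (simp add: P_def U_def t_def)
  have W: "1 / 10^7 \<le> sum w (cls X c a)" if "a \<in> {1..6}" for a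
    by (rule order_trans[OF _ G62_bounds(1)[OF hom that]]) simp
  have U6: "a \<in> {1..6}" if "a \<in> U" for a using that by (simp add: U_def)
  have t6: "a \<in> {1..6}" if "a \<in> t" for a using that i jk by (auto simp: t_def)
  obtain g where g: "\<And>a. a \<in> {1..6} \<Longrightarrow> g a \<in> P a" "\<And>a l m. (a, l, m) \<in> T \<Longrightarrow> {g a, g l, g m} \<in> E"
  proof (rule pick[of "{1..6}" P t T])
    show "P a \<subseteq> V" for a using vV y XV by (auto simp: P_def)
    show "P a \<noteq> {}" if "a \<in> t" for a using that by (auto simp: P_def t_def)
    show "1 / 10^7 \<le> sum w (P a)" if "a \<in> {1..6}" "a \<notin> t" for a
      using that W[of a] PU[of a] by (simp add: U_def)
    show "a \<in> {1..6} \<and> l \<in> {1..6} \<and> m \<in> {1..6} \<and> a \<noteq> l \<and> a \<noteq> m \<and> l \<noteq> m \<and> l \<notin> t \<and> m \<notin> t"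
      if tt: "(a, l, m) \<in> T" for a l m using tt pat2_range[of a l m] by (simp add: T_def U_def)
    fix a l m x assume tt: "(a, l, m) \<in> T" and x: "x \<in> P a"
    have p: "pat2 a l m" "a \<in> t" "l \<in> U" "m \<in> U" using tt by (simp_all add: T_def)
    show "sum w (P l) * sum w (P m) - link w (P l) (P m) x \<le> 1 / 1000 * (sum w (P l) * sum w (P m))"
    proof (cases "a = i")
      case True
      then have "x = v" using x by (simp add: P_def)
      then show ?thesis unfolding PU[OF p(3)] PU[OF p(4)]
        using G62_link_full[OF hom i N] p(1) True by simp
    next
      case False
      then have "x \<in> cls X c a" using x y p(2) by (auto simp: P_def t_def split: if_splits)
      then have x': "x \<in> X" "pat2 (c x) l m" using p(1) by auto
      from relative_miss[OF G62_miss[OF hom x'] order_refl order_refl _ _ W[OF U6[OF p(3)]] W[OF U6[OF p(4)]]]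
      show ?thesis unfolding PU[OF p(3)] PU[OF p(4)] by auto
    qed
  qed auto
  have gv: "g i = v" "g j = y" "g k = y'" using g(1)[of i] g(1)[of j] g(1)[of k] i jk by (simp_all add: P_def)
  have gt: "{g i, g j, g k} \<in> E" using e gv by simp
  have ee: "{g a, g l, g m} \<in> E" if "a \<in> t" "l \<in> U" "m \<in> U" "pat2 a l m" for a l m
    by (rule g(2)) (simp add: T_def that)
  have Att: "adj (g a) (g b)" if "a \<in> t" "b \<in> t" "a \<noteq> b" for a b
    using that adjI[OF gt] by (auto simp: t_def)
  have AtU: "adj (g a) (g l) \<and> adj (g l) (g a)" if "a \<in> t" "l \<in> U" for a l
    using split(1)[OF that] adjI[OF ee[OF that]] by blast
  have AUU: "adj (g l) (g m)" if "l \<in> U" "m \<in> U" "l \<noteq> m" for l m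
    using split(2)[OF that] adjI[OF ee[OF _ that(1,2)]] by blast
  show False
  proof (rule no_core6[of g t])
    show "g a \<in> V" if a: "a \<in> {1..6}" for a
      using g(1)[OF a] vV y XV by (auto simp: P_def split: if_splits)
    show "adj (g a) (g b)" if "a \<in> {1..6}" "b \<in> {1..6}" "a \<noteq> b" for a b
    proof -
      have *: "a \<in> t \<or> a \<in> U" "b \<in> t \<or> b \<in> U" using that by (auto simp: U_def)
      then show ?thesis using Att AtU AUU that(3) by metis
    qed
    show "{g 1, g b, g d} \<in> E \<or> {g a', g b', g d'} \<in> E"
      if tt: "(b, d, a', b', d') \<in> complementary_pairs" for b d a' b' d'
    proof -
      have perm: "{g p, g q, g r} \<in> E" if "pat2 p q r"
        "(p \<in> t \<and> q \<in> U \<and> r \<in> U) \<or> (q \<in> t \<and> p \<in> U \<and> r \<in> U) \<or> (r \<in> t \<and> p \<in> U \<and> q \<in> U)" for p q r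
      proof -
        have s: "pat2 q p r" "pat2 r p q" using that(1) by (simp_all add: pat2_def insert_commute)
        have *: "{g q, g p, g r} = {g p, g q, g r}" "{g r, g p, g q} = {g p, g q, g r}" by auto
        show ?thesis using that(2) ee[of p q r] ee[of q p r] ee[of r p q] that(1) s unfolding * by metis
      qed
      show ?thesis
        using complementary_edges_split[OF tt t, folded U_def] perm[OF complementary_edges(1)[OF tt]]
          perm[OF complementary_edges(2)[OF tt]] by metis
    qed
    show "t \<in> non_G62" by (rule t)
    show "g ` t \<in> E" using gt by (simp add: t_def)
    show "\<exists>e. e \<subseteq> {1..6} - {m} \<and> g ` e \<in> E" if m: "m \<in> {1..6}" for m
    proof -
      obtain a l l' where al: "a \<in> t - {m}" "l \<in> U - {m}" "l' \<in> U - {m}" "pat2 a l l'" using split(3)[of m] by blast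
      have "{a, l, l'} \<subseteq> {1..6} - {m}" using pat2_range[OF al(4)] al(1-3) by auto
      moreover have "g ` {a, l, l'} \<in> E" using ee[of a l l'] al by auto
      ultimately show ?thesis by blast
    qed
  qed
qed

lemma extend_G62:
  assumes hom: "hom {1..6} pat2 c X"
  shows "good (insert v X)"
proof -
  obtain i where i: "i \<in> {1..6}" "nbr c i = {}"
    and N: "\<And>a. a \<in> {1..6} \<Longrightarrow> a \<noteq> i \<Longrightarrow> 1 / 10^7 \<le> sum w (nbr c a)"
    using G62_nbr_empty[OF hom] by blast
  have "hom {1..6} pat2 (c(v := i)) (insert v X)"
  proof (rule hom_insert[OF hom i(1) pat2_sym])
    fix y z assume yz: "y \<in> X" "z \<in> X" "{v, y, z} \<in> E"
    have r: "c y \<in> {1..6}" "c z \<in> {1..6}" using hom yz by (auto simp: hom_def)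
    have "{v, z, y} \<in> E" using yz by (simp add: insert_commute)
    then have ni: "i \<noteq> c y" "i \<noteq> c z" using i(2) yz by (auto simp: nbr_def)
    have "c y \<noteq> c z" using G62_no_inner[OF hom _ _ yz(3), of "c z"] yz by auto
    then show "pat2 i (c y) (c z)" using G62_no_extra[OF hom i N r ni _ _ _ _ yz(3)] yz by blast
  qed
  then show ?thesis unfolding good_def by (intro disjI2 exI)
qed

lemma extend_good:
  assumes "good X"
  shows "good (insert v X)"
  using assms extend_semibip extend_G62 unfolding good_def by metis

end

section \<open>Stability\<close>

context M_free_graph
begin

lemma lag_eq_edge_sum: "lag V w = 6 * (\<Sum>e\<in>E. \<Prod>i\<in>e. w i)"
proof -
  define f where "f = (\<lambda>(x, y, z). w x * w y * (w z :: real))"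
  define h where "h = (\<lambda>(x, y, z). {x, y, z :: nat})"
  define TT where "TT = {t \<in> V \<times> V \<times> V. h t \<in> E}"
  have fT: "finite TT" by (simp add: TT_def)
  have "lag V w = (\<Sum>t\<in>V \<times> V \<times> V. if h t \<in> E then f t else 0)"
    unfolding tri_def sum.cartesian_product by (intro sum.cong refl) (auto simp: f_def h_def edge_def)
  also have "\<dots> = sum f TT" unfolding TT_def by (rule sum.inter_filter[symmetric]) simp
  also have "\<dots> = (\<Sum>e\<in>E. sum f {t \<in> TT. h t = e})"
    by (rule sum.group[symmetric, OF fT finite_E]) (auto simp: TT_def)
  also have "\<dots> = (\<Sum>e\<in>E. 6 * (\<Prod>i\<in>e. w i))"
  proof (rule sum.cong[OF refl])
    fix e assume e: "e \<in> E"
    obtain a b c where abc: "e = {a, b, c}" "a \<noteq> b" "a \<noteq> c" "b \<noteq> c"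
      using edgeD[OF e] by (auto simp: card_3_iff)
    have V: "a \<in> V" "b \<in> V" "c \<in> V" using edgeD[OF e] abc(1) by auto
    have "{t \<in> TT. h t = e} = {(a,b,c),(a,c,b),(b,a,c),(b,c,a),(c,a,b),(c,b,a)}" (is "?L = ?R")
    proof (intro equalityI subsetI)
      fix t assume t: "t \<in> ?L"
      obtain x y z where xyz: "t = (x, y, z)" by (cases t) auto
      have eq: "{x, y, z} = {a, b, c}" using t xyz abc(1) by (simp add: h_def)
      then have "{x, y, z} \<in> E" using e abc(1) by simp
      then have "x \<noteq> y" "x \<noteq> z" "y \<noteq> z" using edge_distinct by blast+
      then show "t \<in> ?R" using eq xyz by (simp add: triple_eq_iff)
    next
      fix t assume "t \<in> ?R"
      then show "t \<in> ?L" using V e abc(1) by (auto simp: TT_def h_def insert_commute)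
    qed
    then have "sum f {t \<in> TT. h t = e} = sum f {(a,b,c),(a,c,b),(b,a,c),(b,c,a),(c,a,b),(c,b,a)}" by simp
    also have "\<dots> = 6 * (w a * w b * w c)" using abc(2-4) by (simp add: f_def)
    also have "w a * w b * w c = (\<Prod>i\<in>e. w i)" unfolding abc(1) using abc(2-4) by simp
    finally show "sum f {t \<in> TT. h t = e} = 6 * (\<Prod>i\<in>e. w i)" .
  qed
  finally show ?thesis by (simp add: sum_distrib_left)
qed

section \<open>Low-degree vertices and the backward transfer of colourings\<close>

lemma link_restrict:
  assumes w: "\<And>x. x \<in> V \<Longrightarrow> 0 \<le> w x" "sum w V = 1" and X: "X \<subseteq> V"
  shows "link w V V v \<le> link w X X v + 2 * sum w (V - X)"
proof -
  have spl: "sum f V = sum f (V - X) + sum f X" for f :: "nat \<Rightarrow> real"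
    by (rule sum.subset_diff[OF X finite_V])
  have "link w V V v = link w (V - X) V v + link w X V v" unfolding link_def by (rule spl)
  also have "link w X V v = link w X (V - X) v + link w X X v"
    unfolding link_def spl sum.distrib ..
  also have "link w (V - X) V v \<le> sum w (V - X) * sum w V" by (rule link_le) (use w in auto)
  also have "link w X (V - X) v \<le> sum w X * sum w (V - X)" by (rule link_le) (use w X in auto)
  finally have "link w V V v \<le> sum w (V - X) * sum w V + (sum w X * sum w (V - X) + link w X X v)" by simp
  moreover have "sum w X * sum w (V - X) \<le> 1 * sum w (V - X)"
  proof (rule mult_right_mono)
    show "sum w X \<le> 1" unfolding w(2)[symmetric] by (rule sum_mono2) (use w X in auto)
    show "0 \<le> sum w (V - X)" by (rule sum_nonneg) (use w in auto)
  qed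
  ultimately show ?thesis using w(2) by simp
qed

text \<open>At deficiency 1 / 10^86 this set has weight at most 1 / 10^44. The threshold also leaves
  room for losing \<open>2 * (1 / 10^42)\<close> when degrees are restricted to the coloured
  part.\<close>

definition low :: "(nat \<Rightarrow> real) \<Rightarrow> nat set" where
  "low w = {x \<in> V. link w V V x < 4 / 9 - 1 / 10^42}"

lemma low_sub: "low w \<subseteq> V"
  by (auto simp: low_def)

lemma sum_low_le:
  assumes "\<And>x. x \<in> V \<Longrightarrow> 0 \<le> w x" "sum w V = 1" "4 / 9 - \<delta> \<le> lag V w" "\<delta> \<le> 1 / 10^86"
  shows "sum w (low w) \<le> \<delta> * 10^42"
proof -
  have "\<delta> < (1 / 10^42)^2" using assms(4) by (simp add: power_divide)
  then have "sum w (low w) \<le> \<delta> / (1 / 10^42)"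
    by (intro low_degree_weight[OF assms(1-3) low_sub]) (auto simp: low_def)
  then show ?thesis by simp
qed

text \<open>Vertices are added one at a time. The weight outside the coloured set never grows, so
  the hypotheses of \<open>extension\<close> persist however many vertices are added.\<close>

lemma extend_to_high_degrees:
  assumes w: "\<And>x. x \<in> V \<Longrightarrow> 0 \<le> w x" "sum w V = 1"
    and X: "X \<subseteq> V - low w" "good X" "sum w (V - X) \<le> 1 / 10^42"
  shows "good (V - low w)"
proof -
  have "good (X \<union> Y)" if "finite Y" "Y \<subseteq> V - low w" for Y
    using that
  proof (induction Y rule: finite_induct)
    case empty then show ?case using X(2) by simp
  next
    case (insert y Y)
    then have IH: "good (X \<union> Y)" by simp
    show ?case
    proof (cases "y \<in> X \<union> Y")
      case True
      then have "X \<union> insert y Y = X \<union> Y" by auto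
      then show ?thesis using IH by simp
    next
      case False
      let ?Z = "X \<union> Y"
      have ZV: "?Z \<subseteq> V" using X(1) insert.prems by auto
      have wZ: "sum w (V - ?Z) \<le> 1 / 10^42"
        by (rule order_trans[OF sum_mono2 X(3)]) (use w in auto)
      have "sum w V = sum w (V - ?Z) + sum w ?Z" by (rule sum.subset_diff[OF ZV finite_V])
      then have tot: "sum w (V - ?Z) + sum w ?Z = 1" using w(2) by simp
      have nn: "0 \<le> sum w (V - ?Z)" by (rule sum_nonneg) (use w in auto)
      have deg: "4 / 9 - 1 / 10^41 \<le> link w ?Z ?Z x" if x: "x \<in> insert y ?Z" for x
      proof -
        have "x \<in> V - low w" using x X(1) insert.prems by auto
        then have "4 / 9 - 1 / 10^42 \<le> link w V V x" unfolding low_def by (auto simp: not_less)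
        also have "\<dots> \<le> link w ?Z ?Z x + 2 * sum w (V - ?Z)" by (rule link_restrict[OF w ZV])
        finally show ?thesis using wZ by simp
      qed
      have "extension H ?Z w y"
        by unfold_locales (use ZV insert.prems False w deg tot nn wZ in auto)
      then have "good (insert y ?Z)" by (rule extension.extend_good) (rule IH)
      then show ?thesis by simp
    qed
  qed
  from this[of "V - low w"] have "good (X \<union> (V - low w))" by simp
  moreover have "X \<union> (V - low w) = V - low w" using X(1) by auto
  ultimately show ?thesis by simp
qed

text \<open>Outside both low sets the colouring for \<open>w'\<close> applies. The discarded part is
  light for \<open>w\<close>, since \<open>low w'\<close> is light for \<open>w'\<close> and
  \<open>near\<close> transfers this, so the colouring extends back to all of
  \<open>V - low w\<close>.\<close>

lemma good_transfer:
  assumes w: "\<And>x. x \<in> V \<Longrightarrow> 0 \<le> w x" "sum w V = 1" "4 / 9 - 1 / 10^86 \<le> lag V w"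
    and w': "\<And>x. x \<in> V \<Longrightarrow> 0 \<le> w' x" "sum w' V = 1" "4 / 9 - 1 / 10^86 \<le> lag V w'"
    and near: "\<And>Z. Z \<subseteq> V \<Longrightarrow> sum w Z \<le> sum w' Z + 1 / 10^43" and good: "good (V - low w')"
  shows "good (V - low w)"
proof (rule extend_to_high_degrees[OF w(1,2)])
  let ?X = "V - low w - low w'"
  show "?X \<subseteq> V - low w" by auto
  show "good ?X" by (rule good_mono[OF good]) auto
  have "sum w (V - ?X) \<le> sum w (low w) + sum w (low w')"
  proof -
    have "V - ?X = low w \<union> low w'" using low_sub by auto
    moreover have "sum w (low w \<union> low w') \<le> sum w (low w) + sum w (low w')"
    proof -
      have f: "finite (low w)" "finite (low w')" using finite_subset[OF low_sub] by auto
      have "0 \<le> sum w (low w \<inter> low w')" by (rule sum_nonneg) (use w low_sub in auto)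
      then show ?thesis using sum.union_inter[OF f, of w] by linarith
    qed
    ultimately show ?thesis by simp
  qed
  moreover have "sum w (low w) \<le> 1 / 10^86 * 10^42" by (rule sum_low_le[OF w]) (assumption | rule order_refl)+
  moreover have "sum w' (low w') \<le> 1 / 10^86 * 10^42" by (rule sum_low_le[OF w']) (assumption | rule order_refl)+
  moreover have "sum w (low w') \<le> sum w' (low w') + 1 / 10^43" by (rule near[OF low_sub])
  ultimately show "sum w (V - ?X) \<le> 1 / 10^42" by simp
qed

lemma sum_shift_on:
  assumes "finite Z"
  shows "sum (shift w u v t) Z = sum w Z + t * (of_bool (v \<in> Z) - of_bool (u \<in> Z))"
proof -
  have "(\<Sum>x\<in>Z. of_bool (x = a)) = (of_bool (a \<in> Z) :: real)" for a
    using assms by (simp add: of_bool_def)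
  then show ?thesis
    unfolding shift_def by (simp add: sum.distrib sum_distrib_left[symmetric] sum_subtractf)
qed

lemma high_degrees_good:
  assumes "\<And>x. x \<in> V \<Longrightarrow> 0 \<le> w x" "sum w V = 1" "4 / 9 - 1 / 10^86 \<le> lag V w"
  shows "good (V - low w)"
proof -
  have "sum w V = 1 \<longrightarrow> 4 / 9 - 1 / 10^86 \<le> lag V w \<longrightarrow> good (V - low w)"
    using assms(1)
  proof (rule symmetrization_induct)
    fix w assume w: "\<And>x. x \<in> V \<Longrightarrow> 0 \<le> (w x :: real)" and g: "good {x \<in> V. w x \<noteq> 0}"
    show "sum w V = 1 \<longrightarrow> 4 / 9 - 1 / 10^86 \<le> lag V w \<longrightarrow> good (V - low w)"
    proof (intro impI)
      assume s: "sum w V = 1" and l: "4 / 9 - 1 / 10^86 \<le> lag V w"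
      \<comment> \<open>Vertices outside the support have no weight, so only \<open>low w\<close>
        counts as lost.\<close>
      let ?X = "{x \<in> V. w x \<noteq> 0} - low w"
      have "sum w (V - ?X) = sum w (low w)"
        by (rule sum.mono_neutral_right) (use low_sub in auto)
      also have "\<dots> \<le> 1 / 10^86 * 10^42" by (rule sum_low_le[OF w s l]) (assumption | rule order_refl)+
      finally have "sum w (V - ?X) \<le> 1 / 10^42" by simp
      moreover have "good ?X" by (rule good_mono[OF g]) auto
      ultimately show "good (V - low w)" by (intro extend_to_high_degrees[OF w s, of ?X]) auto
    qed
  next
    fix w u v
    assume w: "\<And>x. x \<in> V \<Longrightarrow> 0 \<le> (w x :: real)" and uv: "u \<in> V" "v \<in> V" "u \<noteq> v"
      and no: "\<And>z. z \<in> V \<Longrightarrow> w z \<noteq> 0 \<Longrightarrow> {u, v, z} \<notin> E" and le: "link w V V u \<le> link w V V v"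
      and IH: "sum (shift w u v (w u)) V = 1 \<longrightarrow> 4 / 9 - 1 / 10^86 \<le> lag V (shift w u v (w u)) \<longrightarrow>
        good (V - low (shift w u v (w u)))"
    show "sum w V = 1 \<longrightarrow> 4 / 9 - 1 / 10^86 \<le> lag V w \<longrightarrow> good (V - low w)"
    proof (intro impI)
      assume s: "sum w V = 1" and l: "4 / 9 - 1 / 10^86 \<le> lag V w"
      have wu: "0 \<le> w u" "w u \<le> 1"
        using w[OF uv(1)] member_le_sum[of u V w] uv(1) w s by auto
      \<comment> \<open>Each of the 10^43 parts moves at most 1 / 10^43, the tolerance in
        \<open>good_transfer\<close>.\<close>
      define W where "W k = shift w u v (real k * (w u / 10^43))" for k
      have nn: "0 \<le> W k x" if "x \<in> V" "k \<le> 10^43" for k x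
        unfolding W_def
      proof (rule shift_nonneg[OF w _ _ uv(3) that(1)])
        show "0 \<le> real k * (w u / 10^43)" using wu by simp
        have "real k \<le> 10^43" using that(2) by (metis of_nat_le_iff of_nat_numeral of_nat_power)
        then have "real k * (w u / 10^43) \<le> 10^43 * (w u / 10^43)" using wu by (intro mult_right_mono) auto
        then show "real k * (w u / 10^43) \<le> w u" by simp
      qed
      have sW: "sum (W k) V = 1" for k unfolding W_def sum_shift[OF uv(1,2)] by (rule s)
      have lW: "4 / 9 - 1 / 10^86 \<le> lag V (W k)" for k
      proof -
        have "lag V w \<le> lag V (W k)"
          unfolding W_def using lag_shift[OF uv no, of w "real k * (w u / 10^43)"] wu le by simp
        then show ?thesis using l by simp
      qed
      have near: "sum (W k) Z \<le> sum (W (Suc k)) Z + 1 / 10^43" if "Z \<subseteq> V" for k Z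
      proof -
        have fZ: "finite Z" using finite_subset[OF that] by simp
        let ?d = "w u / 10^43"
        have d: "0 \<le> ?d" "?d \<le> 1 / 10^43" using wu by (simp_all add: divide_right_mono)
        have "sum (W (Suc k)) Z = sum (W k) Z + ?d * (of_bool (v \<in> Z) - of_bool (u \<in> Z))"
          unfolding W_def sum_shift_on[OF fZ] by (simp add: algebra_simps)
        moreover have "?d * (of_bool (v \<in> Z) - of_bool (u \<in> Z)) \<ge> - ?d" using d by (auto simp: of_bool_def)
        ultimately show ?thesis using d by linarith
      qed
      have end_eq: "W (10^43) = shift w u v (w u)" by (simp add: W_def)
      have last: "good (V - low (W (10^43)))"
        using IH sW[of "10^43"] lW[of "10^43"] unfolding end_eq by blast
      have "good (V - low (W 0))"
      \<comment> \<open>Downwards from the completed transfer, where the induction hypothesis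
        supplies a colouring.\<close>
      proof (rule inc_induct[of 0 "10^43" "\<lambda>k. good (V - low (W k))"])
        show "good (V - low (W (10^43)))" by (rule last)
        fix k :: nat assume k: "k < 10^43" and g: "good (V - low (W (Suc k)))"
        show "good (V - low (W k))"
          by (rule good_transfer[OF _ sW lW _ sW lW near g]) (use k nn in auto)
      qed simp
      moreover have "W 0 = w" by (simp add: W_def shift_def)
      ultimately show "good (V - low w)" by simp
    qed
  qed
  then show ?thesis using assms(2,3) by blast
qed

section \<open>From weights to vertex deletion\<close>

lemma good_remove_verts:
  assumes good: "good (V - S)"
  shows "semibipartite (remove_verts H S) \<or> colorable G62 (remove_verts H S)"
proof -
  let ?Y = "V - S"
  have verts: "verts (remove_verts H S) = ?Y" by (auto simp: remove_verts_def induced_def)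
  have edges: "edges (remove_verts H S) = {e \<in> E. e \<subseteq> ?Y}" by (simp add: remove_verts_def induced_def)
  have triple: "\<exists>x y z. e = {x, y, z} \<and> x \<noteq> y \<and> x \<noteq> z \<and> y \<noteq> z \<and> x \<in> ?Y \<and> y \<in> ?Y \<and> z \<in> ?Y"
    if e: "e \<in> E" "e \<subseteq> ?Y" for e
  proof -
    obtain x y z where xyz: "e = {x, y, z}" "x \<noteq> y" "x \<noteq> z" "y \<noteq> z"
      using edgeD[OF e(1)] by (auto simp: card_3_iff)
    then show ?thesis using e(2) by (intro exI[of _ x] exI[of _ y] exI[of _ z]) simp
  qed
  consider c where "hom {0, 1} pat1 c ?Y" | c where "hom {1..6} pat2 c ?Y"
    using good unfolding good_def by blast
  then show ?thesis
  proof cases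
    case (1 c)
    define A B where "A = {x \<in> ?Y. c x = 0}" and "B = {x \<in> ?Y. c x = 1}"
    have AB: "A \<union> B = ?Y" "A \<inter> B = {}" using 1 by (auto simp: A_def B_def hom_def)
    have "card (e \<inter> A) = 1 \<and> card (e \<inter> B) = 2" if e: "e \<in> E" "e \<subseteq> ?Y" for e
    proof -
      obtain x y z where xyz: "e = {x, y, z}" "x \<noteq> y" "x \<noteq> z" "y \<noteq> z" "x \<in> ?Y" "y \<in> ?Y" "z \<in> ?Y"
        using triple[OF e] by (elim exE conjE) (rule that)
      then have p: "pat1 (c x) (c y) (c z)" using 1 e(1) by (simp add: hom_def)
      have mem: "p \<in> A \<longleftrightarrow> c p = 0" "p \<in> B \<longleftrightarrow> c p = 1" if "p \<in> ?Y" for p using that by (simp_all add: A_def B_def)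
      consider "c x = 0" "c y = 1" "c z = 1" | "c x = 1" "c y = 0" "c z = 1" | "c x = 1" "c y = 1" "c z = 0"
        using p unfolding pat1_def by auto
      then show ?thesis
      proof cases
        case 1
        then have "e \<inter> A = {x}" "e \<inter> B = {y, z}" using mem xyz by auto
        then show ?thesis using xyz by simp
      next
        case 2
        then have "e \<inter> A = {y}" "e \<inter> B = {x, z}" using mem xyz by auto
        then show ?thesis using xyz by simp
      next
        case 3
        then have "e \<inter> A = {z}" "e \<inter> B = {x, y}" using mem xyz by auto
        then show ?thesis using xyz by simp
      qed
    qed
    then have "semibipartite (remove_verts H S)" unfolding semibipartite_def verts edges
      using AB by (intro exI[of _ A] exI[of _ B]) simp
    then show ?thesis by (rule disjI1)
  next
    case (2 c)
    \<comment> \<open>Every class is large enough for all vertices. Positions start at 1, hence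
      \<open>Suc x\<close>; \<open>insert 0\<close> keeps \<open>Max\<close> defined when no vertex
      is left.\<close>
    define K where "K = (\<lambda>_::nat. Suc (Max (insert 0 ?Y)))"
    define f where "f x = (c x, Suc x)" for x
    have le: "x \<le> Max (insert 0 ?Y)" if "x \<in> ?Y" for x using that by (intro Max_ge) auto
    have c6: "c x \<in> {1..6}" if "x \<in> ?Y" for x using 2 that by (auto simp: hom_def)
    have vG: "verts G62 = {1..6}" by (simp add: G62_def)
    have fS: "f x \<in> (SIGMA v:verts G62. {1..K v})" if "x \<in> ?Y" for x
      using c6[OF that] le[OF that] unfolding vG by (auto simp: f_def K_def)
    have "embeds (remove_verts H S) (blowup G62 K)"
      unfolding embeds_def verts edges
    proof (intro exI[of _ f] conjI ballI)
      show "inj_on f ?Y" by (auto simp: inj_on_def f_def)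
      show "f ` ?Y \<subseteq> verts (blowup G62 K)" unfolding image_subset_iff blowup_def using fS by simp
      fix e assume "e \<in> {e \<in> E. e \<subseteq> ?Y}"
      then have e: "e \<in> E" "e \<subseteq> ?Y" by auto
      obtain x y z where xyz: "e = {x, y, z}" "x \<noteq> y" "x \<noteq> z" "y \<noteq> z" "x \<in> ?Y" "y \<in> ?Y" "z \<in> ?Y"
        using triple[OF e] by (elim exE conjE) (rule that)
      then have p: "pat2 (c x) (c y) (c z)" using 2 e(1) by (simp add: hom_def)
      have d: "c x \<noteq> c y" "c x \<noteq> c z" "c y \<noteq> c z" using p unfolding pat2_iff by auto
      have "f ` e \<subseteq> (SIGMA v:verts G62. {1..K v})" by (rule image_subsetI, rule fS) (use e(2) in blast)
      moreover have "inj_on fst (f ` e)" using d unfolding xyz(1) by (auto simp: inj_on_def f_def)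
      moreover have "fst ` f ` e \<in> edges G62" using p unfolding xyz(1) pat2_def by (simp add: f_def)
      ultimately show "f ` e \<in> edges (blowup G62 K)" by (simp add: blowup_def)
    qed
    moreover have "is_blowup G62 (blowup G62 K)" unfolding is_blowup_def by (intro exI[of _ K]) (simp add: K_def)
    ultimately have "colorable G62 (remove_verts H S)" unfolding colorable_def by blast
    then show ?thesis by (rule disjI2)
  qed
qed

text \<open>Low-degree vertices carry almost no weight. If there were more than
  \<open>\<epsilon> * real n\<close> of them, the rest would hold nearly the full sum
  \<open>N\<close>, but by the power mean inequality it holds at most
  \<open>(1 - \<epsilon>) powr (1 - 1 / p) * N\<close>.\<close>

lemma few_low_degrees:
  assumes p: "p > 1" and \<epsilon>: "0 < \<epsilon>" "\<epsilon> < 1"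
    and \<delta>: "0 < \<delta>" "\<delta> \<le> 1 / 10^86" "\<delta> * 10^43 < 1 - (1 - \<epsilon>) powr (1 - 1 / p)"
    and n: "card V = n" "0 < n" and norm: "(\<Sum>i\<in>V. \<bar>x i\<bar> powr p) \<le> 1"
    and big: "(1 - \<delta>) * (4 / 9 * real n powr (3 * (1 - 1 / p))) < 6 * (\<Sum>e\<in>E. \<Prod>i\<in>e. x i)"
  shows "\<exists>S. S \<subseteq> V \<and> real (card S) \<le> \<epsilon> * real n \<and> good (V - S)"
proof -
  define y where "y i = \<bar>x i\<bar>" for i
  define s where "s = sum y V"
  \<comment> \<open>The largest possible sum of absolute values for a vector of p-norm at most 1; a
    near-extremal \<open>x\<close> must almost attain it.\<close>
  define N where "N = real n powr (1 - 1 / p)"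
  have N0: "0 < N" using n by (simp add: N_def)
  have q0: "0 < 1 - 1 / p" using p by simp
  have N3: "real n powr (3 * (1 - 1 / p)) = N^3"
  proof -
    have "N^3 = N powr 3" using N0 by (simp add: powr_numeral)
    also have "\<dots> = real n powr ((1 - 1 / p) * 3)" unfolding N_def by (rule powr_powr)
    finally show ?thesis by (simp only: mult.commute)
  qed
  have \<delta>1: "\<delta> < 1" using \<delta>(2) by (rule order.strict_trans1) simp
  have sN: "s \<le> N" unfolding s_def y_def N_def
    by (rule sum_le_card_powr[OF finite_V p _ norm]) (simp add: n)
  have s0: "0 \<le> s" by (simp add: s_def y_def sum_nonneg)
  have "6 * (\<Sum>e\<in>E. \<Prod>i\<in>e. x i) \<le> 6 * (\<Sum>e\<in>E. \<Prod>i\<in>e. y i)"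
  proof (intro mult_left_mono sum_mono)
    fix e
    have "(\<Prod>i\<in>e. x i) \<le> \<bar>\<Prod>i\<in>e. x i\<bar>" by simp
    then show "(\<Prod>i\<in>e. x i) \<le> (\<Prod>i\<in>e. y i)" by (simp add: y_def abs_prod)
  qed simp
  also have "\<dots> = lag V y" by (rule lag_eq_edge_sum[symmetric])
  finally have lagy: "(1 - \<delta>) * (4 / 9 * N^3) < lag V y" using big N3 by simp
  have "lag V y \<le> 4 / 9 * s^3" unfolding s_def by (rule lag_le) (simp add: y_def)
  then have "(1 - \<delta>) * N^3 < s^3" using lagy by simp
  moreover have "s^3 \<le> s * N^2"
    using mult_left_mono[OF power_mono[OF sN s0, of 2] s0] by (simp add: power3_eq_cube power2_eq_square)
  ultimately have "(1 - \<delta>) * N * N^2 < s * N^2" by (simp add: power3_eq_cube power2_eq_square mult_ac)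
  then have sge: "(1 - \<delta>) * N < s" using N0 by simp
  have spos: "0 < s" using sge N0 \<delta>1 by (metis diff_gt_0_iff_gt less_trans mult_pos_pos)
  define w where "w i = y i / s" for i
  have w0: "0 \<le> w i" for i using spos by (simp add: w_def y_def)
  have w1: "sum w V = 1" using spos by (simp add: w_def sum_divide_distrib[symmetric] s_def)
  have lagw: "lag V w = lag V y / s^3"
  proof -
    have "(\<Sum>e\<in>E. \<Prod>i\<in>e. y i / s) = (\<Sum>e\<in>E. \<Prod>i\<in>e. y i) / s^3"
      unfolding sum_divide_distrib by (rule sum.cong) (simp_all add: prod_dividef edgeD)
    then show ?thesis unfolding lag_eq_edge_sum w_def by simp
  qed
  have "4 / 9 - \<delta> \<le> (1 - \<delta>) * (4 / 9)" using \<delta>(1) by simp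
  also have "\<dots> = (1 - \<delta>) * (4 / 9 * N^3) / N^3" using N0 by simp
  also have "\<dots> \<le> (1 - \<delta>) * (4 / 9 * N^3) / s^3"
    using spos sN N0 \<delta>1 by (intro divide_left_mono power_mono mult_nonneg_nonneg mult_pos_pos) auto
  also have "\<dots> \<le> lag V y / s^3" using lagy spos by (intro divide_right_mono) auto
  finally have lw: "4 / 9 - \<delta> \<le> lag V w" by (simp add: lagw)
  let ?Z = "low w"
  have wZ: "sum w ?Z \<le> \<delta> * 10^42" by (rule sum_low_le[OF w0 w1 lw \<delta>(2)])
  have "4 / 9 - 1 / 10^86 \<le> lag V w" using lw \<delta>(2) by linarith
  then have g: "good (V - ?Z)" by (rule high_degrees_good[OF w0 w1])
  have "real (card ?Z) \<le> \<epsilon> * real n"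
  proof (rule ccontr)
    assume "\<not> real (card ?Z) \<le> \<epsilon> * real n"
    then have "real (card (V - ?Z)) \<le> (1 - \<epsilon>) * real n"
      using card_Diff_subset[OF finite_subset[OF low_sub finite_V] low_sub, of w] card_mono[OF finite_V low_sub, of w] n
      by (simp add: algebra_simps of_nat_diff)
    then have "(\<Sum>i\<in>V - ?Z. \<bar>x i\<bar>) \<le> ((1 - \<epsilon>) * real n) powr (1 - 1 / p)"
    proof (intro sum_le_card_powr[OF _ p])
      have "(\<Sum>i\<in>V - ?Z. \<bar>x i\<bar> powr p) \<le> (\<Sum>i\<in>V. \<bar>x i\<bar> powr p)" by (rule sum_mono2) auto
      then show "(\<Sum>i\<in>V - ?Z. \<bar>x i\<bar> powr p) \<le> 1" using norm by simp
    qed simp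
    also have "\<dots> = (1 - \<epsilon>) powr (1 - 1 / p) * N" using \<epsilon> n by (simp add: N_def powr_mult)
    also have "(\<Sum>i\<in>V - ?Z. \<bar>x i\<bar>) = s * sum w (V - ?Z)"
      using spos by (simp add: w_def y_def sum_divide_distrib[symmetric])
    also have "sum w (V - ?Z) = 1 - sum w ?Z"
      using sum.subset_diff[OF low_sub finite_V, of w w] w1 by simp
    finally have up: "s * (1 - sum w ?Z) \<le> (1 - \<epsilon>) powr (1 - 1 / p) * N" .
    have "(1 - \<delta>) * N * (1 - \<delta> * 10^42) \<le> s * (1 - sum w ?Z)"
    proof (intro mult_mono)
      have "\<delta> * 10^42 \<le> 1 / 10^86 * 10^42" using \<delta>(2) by (intro mult_right_mono) auto
      then show "0 \<le> 1 - \<delta> * 10^42" by simp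
    qed (use sge wZ s0 in auto)
    then have "((1 - \<delta>) * (1 - \<delta> * 10^42)) * N \<le> (1 - \<epsilon>) powr (1 - 1 / p) * N" using up by (simp add: mult_ac)
    then have "(1 - \<delta>) * (1 - \<delta> * 10^42) \<le> (1 - \<epsilon>) powr (1 - 1 / p)" using N0 by simp
    moreover have "(1 - \<delta>) * (1 - \<delta> * 10^42) = 1 - \<delta> - \<delta> * 10^42 + \<delta> * \<delta> * 10^42" by (simp add: algebra_simps)
    moreover have "0 \<le> \<delta> * \<delta> * 10^42" by simp
    moreover have "\<delta> * 10^43 = 10 * (\<delta> * 10^42)" "\<delta> \<le> \<delta> * 10^42" using \<delta>(1) by simp_all
    ultimately show False using \<delta>(1,3) by linarith
  qed
  then show ?thesis using g low_sub by blast
qed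

end

theorem theorem6p6:
  fixes p :: real
  assumes "p > 1"
  shows "\<forall>\<epsilon>::real. \<epsilon> > 0 \<longrightarrow>
    (\<exists>\<delta>::real. \<delta> > 0 \<and> (\<exists>n0::nat. \<forall>n\<ge>n0. \<forall>H :: nat hypergraph.
       three_graph H \<and> card (verts H) = n \<and> M_free H \<and>
       p_spectral_radius p H > (1 - \<delta>) * (4 / 9 * real n powr (3 * (1 - 1 / p))) \<longrightarrow>
       (\<exists>S. S \<subseteq> verts H \<and> real (card S) \<le> \<epsilon> * real n \<and>
          (semibipartite (remove_verts H S) \<or> colorable G62 (remove_verts H S)))))"
proof (intro allI impI)
  fix \<epsilon> :: real assume "\<epsilon> > 0"
  \<comment> \<open>The cap keeps \<open>1 - \<epsilon>'\<close> positive.\<close>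
  define \<epsilon>' where "\<epsilon>' = min \<epsilon> (1 / 2)"
  have \<epsilon>': "0 < \<epsilon>'" "\<epsilon>' < 1" "\<epsilon>' \<le> \<epsilon>" using \<open>\<epsilon> > 0\<close> by (auto simp: \<epsilon>'_def)
  define gap where "gap = 1 - (1 - \<epsilon>') powr (1 - 1 / p)"
  have "(1 - \<epsilon>') powr (1 - 1 / p) < 1 powr (1 - 1 / p)"
    using \<epsilon>' assms by (intro powr_less_mono2) auto
  then have gap: "0 < gap" by (simp add: gap_def)
  \<comment> \<open>The factor 2 makes \<open>\<delta> * 10^43 < gap\<close> strict.\<close>
  define \<delta> where "\<delta> = min (1 / 10^86) (gap / (2 * 10^43))"
  have \<delta>: "0 < \<delta>" "\<delta> \<le> 1 / 10^86" using gap by (auto simp: \<delta>_def)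
  have "\<delta> \<le> gap / (2 * 10^43)" by (simp add: \<delta>_def)
  then have "\<delta> * 10^43 \<le> gap / (2 * 10^43) * 10^43" by (rule mult_right_mono) simp
  then have \<delta>gap: "\<delta> * 10^43 < gap" using gap by simp
  show "\<exists>\<delta>::real. \<delta> > 0 \<and> (\<exists>n0::nat. \<forall>n\<ge>n0. \<forall>H :: nat hypergraph.
       three_graph H \<and> card (verts H) = n \<and> M_free H \<and>
       p_spectral_radius p H > (1 - \<delta>) * (4 / 9 * real n powr (3 * (1 - 1 / p))) \<longrightarrow>
       (\<exists>S. S \<subseteq> verts H \<and> real (card S) \<le> \<epsilon> * real n \<and>
          (semibipartite (remove_verts H S) \<or> colorable G62 (remove_verts H S))))"
  proof (intro exI[of _ \<delta>] conjI exI[of _ "1::nat"] allI impI)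
    fix n :: nat and H :: "nat hypergraph"
    assume n: "1 \<le> n" and H: "three_graph H \<and> card (verts H) = n \<and> M_free H \<and>
       p_spectral_radius p H > (1 - \<delta>) * (4 / 9 * real n powr (3 * (1 - 1 / p)))"
    interpret M_free_graph H using H by unfold_locales auto
    let ?A = "{6 * (\<Sum>e\<in>E. \<Prod>i\<in>e. x i) | x. lp_norm V p x = 1}"
    have "V \<noteq> {}" using H n by auto
    then obtain v0 where v0: "v0 \<in> V" by blast
    \<comment> \<open>A unit vector shows that the set under \<open>Sup\<close> is nonempty, as
      \<open>less_cSupE\<close> requires.\<close>
    have "(\<Sum>i\<in>V. \<bar>of_bool (i = v0)\<bar> powr p) = (\<Sum>i\<in>V. if i = v0 then 1 else (0::real))"
      by (rule sum.cong) auto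
    then have "lp_norm V p (\<lambda>i. of_bool (i = v0)) = 1" using v0 by (simp add: lp_norm_def)
    then have "?A \<noteq> {}" by blast
    moreover have "(1 - \<delta>) * (4 / 9 * real n powr (3 * (1 - 1 / p))) < Sup ?A"
      using H by (simp add: p_spectral_radius_def)
    ultimately obtain x where x: "lp_norm V p x = 1"
      and big: "(1 - \<delta>) * (4 / 9 * real n powr (3 * (1 - 1 / p))) < 6 * (\<Sum>e\<in>E. \<Prod>i\<in>e. x i)"
      by (elim less_cSupE) auto
    have "(\<Sum>i\<in>V. \<bar>x i\<bar> powr p) \<le> 1"
    proof (rule ccontr)
      assume "\<not> (\<Sum>i\<in>V. \<bar>x i\<bar> powr p) \<le> 1"
      then have "1 powr (1 / p) < (\<Sum>i\<in>V. \<bar>x i\<bar> powr p) powr (1 / p)"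
        using assms by (intro powr_less_mono2) auto
      then show False using x by (simp add: lp_norm_def)
    qed
    then obtain S where S: "S \<subseteq> V" "real (card S) \<le> \<epsilon>' * real n" "good (V - S)"
      using few_low_degrees[OF assms \<epsilon>'(1,2) \<delta> \<delta>gap[unfolded gap_def] _ _ _ big] H n by auto
    have "\<epsilon>' * real n \<le> \<epsilon> * real n" using \<epsilon>'(3) by (rule mult_right_mono) simp
    then show "\<exists>S. S \<subseteq> verts H \<and> real (card S) \<le> \<epsilon> * real n \<and>
          (semibipartite (remove_verts H S) \<or> colorable G62 (remove_verts H S))"
      using S good_remove_verts[OF S(3)] by (intro exI[of _ S]) simp
  qed (rule \<delta>(1))
qed

end
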